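(* Let $q=p^h$ be a prime power ($p$ prime) and let $n\ge 2$ with $q\geq n+3$, where either $n\geq 3$, or $n=2$ and $q$ is odd. Let $\mathcal{K}$ be a set of $q$ points contained in a normal rational curve of $H_\infty=\mathrm{PG}(n,q)$. Then $\Gamma_{n,q}(\mathcal{K})$ is a semisymmetric graph. Moreover, $\mathrm{Aut}(\Gamma_{n,q}(\mathcal{K}))$ is isomorphic to $\mathrm{Persp}(H_\infty)\rtimes \mathrm{A\Gamma L}(1,q)$ and has size $hq^{n+2}(q-1)^2$.
   Context: A normal rational curve in $\mathrm{PG}(n,q)$, $2\le n\le q$, is a set of $q+1$ points projectively equivalent to $\{(0,\ldots,0,1)\}\cup\{(1,t,t^2,\ldots,t^n)\mid t\in\mathbb{F}_q\}$. Embed $H_\infty=\mathrm{PG}(n,q)$ as a hyperplane in $\mathrm{PG}(n+1,q)$; points of $\mathrm{PG}(n+1,q)\setminus H_\infty$ are called affine. For a point set $\mathcal{K}$ of $H_\infty$, $\Gamma_{n,q}(\mathcal{K})$ is the bipartite graph whose vertex classes are $\mathcal{P}$, the set of affine points, and $\mathcal{L}$, the set of lines of $\mathrm{PG}(n+1,q)$ not contained in $H_\infty$ and passing through a point of $\mathcal{K}$; adjacency is incidence. A graph is semisymmetric if it is regular and edge-transitive but not vertex-transitive. $\mathrm{Aut}(\Gamma)$ is the full automorphism group of a graph $\Gamma$. $\mathrm{Persp}(H_\infty)$ is the group of all elements of $\mathrm{P\Gamma L}(n+2,q)$ (the collineation group of $\mathrm{PG}(n+1,q)$) fixing every point of $H_\infty$.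 $N\rtimes H$ denotes a semidirect product with normal subgroup $N$. *)

theory Defs
  imports "HOL-Analysis.Cartesian_Space" "HOL-Algebra.Bij" "HOL-Algebra.Coset" "HOL-Computational_Algebra.Primes"
begin

section \<open>Graphs\<close>

record 'v ugraph =
  verts :: "'v set"
  edges :: "'v set set"

definition simple_graph :: "'v ugraph \<Rightarrow> bool" where
  "simple_graph G \<longleftrightarrow> finite (verts G) \<and> (\<forall>e\<in>edges G. e \<subseteq> verts G \<and> card e = 2)"

definition degree :: "'v ugraph \<Rightarrow> 'v \<Rightarrow> nat" where
  "degree G v = card {e \<in> edges G. v \<in> e}"

definition regular :: "'v ugraph \<Rightarrow> bool" where
  "regular G \<longleftrightarrow> (\<exists>k. \<forall>v\<in>verts G. degree G v = k)"

definition automorphisms :: "'v ugraph \<Rightarrow> ('v \<Rightarrow> 'v) set" where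
  "automorphisms G = {f \<in> Bij (verts G).
     \<forall>u\<in>verts G. \<forall>v\<in>verts G. {f u, f v} \<in> edges G \<longleftrightarrow> {u, v} \<in> edges G}"

definition Aut :: "'v ugraph \<Rightarrow> ('v \<Rightarrow> 'v) monoid" where
  "Aut G = (BijGroup (verts G))\<lparr>carrier := automorphisms G\<rparr>"

definition vertex_transitive :: "'v ugraph \<Rightarrow> bool" where
  "vertex_transitive G \<longleftrightarrow> (\<forall>u\<in>verts G. \<forall>v\<in>verts G. \<exists>f\<in>automorphisms G. f u = v)"

definition edge_transitive :: "'v ugraph \<Rightarrow> bool" where
  "edge_transitive G \<longleftrightarrow> (\<forall>d\<in>edges G. \<forall>e\<in>edges G. \<exists>f\<in>automorphisms G. f ` d = e)"

definition semisymmetric :: "'v ugraph \<Rightarrow> bool" where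
  "semisymmetric G \<longleftrightarrow>
     simple_graph G \<and> regular G \<and> edge_transitive G \<and> \<not> vertex_transitive G"

section \<open>Projective spaces\<close>

text \<open>
  A vector space of dimension \<open>m + 1\<close> over \<open>'a\<close> carries \<open>PG(m, q)\<close>. Every projective subspace is
  identified with the linear subspace of vectors it consists of, so that incidence is inclusion.
\<close>

definition proj_points :: "('a::field ^ 'd) set set" where
  "proj_points = {P. vec.subspace P \<and> vec.dim P = 1}"

definition proj_lines :: "('a::field ^ 'd) set set" where
  "proj_lines = {L. vec.subspace L \<and> vec.dim L = 2}"

definition hyperplane :: "('a::field ^ 'd) set \<Rightarrow> bool" where
  "hyperplane H \<longleftrightarrow> vec.subspace H \<and> vec.dim H + 1 = CARD('d)"

definition affine_points :: "('a::field ^ 'd) set \<Rightarrow> ('a ^ 'd) set set" where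
  "affine_points H = {P \<in> proj_points. \<not> P \<subseteq> H}"

definition affine_lines_through ::
  "('a::field ^ 'd) set \<Rightarrow> ('a ^ 'd) set set \<Rightarrow> ('a ^ 'd) set set" where
  "affine_lines_through H K = {L \<in> proj_lines. \<not> L \<subseteq> H \<and> (\<exists>P\<in>K. P \<subseteq> L)}"

definition Gamma :: "('a::field ^ 'd) set \<Rightarrow> ('a ^ 'd) set set \<Rightarrow> ('a ^ 'd) set ugraph" where
  "Gamma H K =
     \<lparr>verts = affine_points H \<union> affine_lines_through H K,
      edges = {{P, L} | P L. P \<in> affine_points H \<and> L \<in> affine_lines_through H K \<and> P \<subseteq> L}\<rparr>"

section \<open>Normal rational curves\<close>

text \<open>
  Coordinate vectors \<open>(x\<^sub>0, \<dots>, x\<^sub>n)\<close> are functions on \<^typ>\<open>nat\<close> of which only the values at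
  arguments up to \<open>n\<close> matter.
\<close>

definition standard_curve :: "nat \<Rightarrow> (nat \<Rightarrow> 'a::field) set" where
  "standard_curve n = {\<lambda>i. if i = n then 1 else 0} \<union> {\<lambda>i. t ^ i | t. True}"

definition ordered_basis :: "nat \<Rightarrow> ('a::field ^ 'd) set \<Rightarrow> (nat \<Rightarrow> 'a ^ 'd) \<Rightarrow> bool" where
  "ordered_basis n H b \<longleftrightarrow>
     inj_on b {..n} \<and> vec.independent (b ` {..n}) \<and> vec.span (b ` {..n}) = H"

text \<open>
  An ordered basis \<open>b\<close> of \<open>H\<close> is the same as a linear isomorphism from the coordinate space of
  \<open>PG(n, q)\<close> onto \<open>H\<close>; letting \<open>b\<close> range over all of them gives exactly the projective equivalents
  in \<open>H\<close> of the standard curve.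
\<close>

definition normal_rational_curve :: "nat \<Rightarrow> ('a::field ^ 'd) set \<Rightarrow> ('a ^ 'd) set set \<Rightarrow> bool" where
  "normal_rational_curve n H C \<longleftrightarrow>
     (\<exists>b. ordered_basis n H b \<and>
          C = (\<lambda>x. vec.span {\<Sum>i\<le>n. x i *s b i}) ` standard_curve n)"

section \<open>Groups\<close>

definition field_automorphism :: "('a::field \<Rightarrow> 'a) \<Rightarrow> bool" where
  "field_automorphism \<sigma> \<longleftrightarrow>
     bij \<sigma> \<and> (\<forall>x y. \<sigma> (x + y) = \<sigma> x + \<sigma> y) \<and> (\<forall>x y. \<sigma> (x * y) = \<sigma> x * \<sigma> y)"

definition semilinear :: "('a::field ^ 'd \<Rightarrow> 'a ^ 'd) \<Rightarrow> bool" where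
  "semilinear f \<longleftrightarrow> (\<exists>\<sigma>. field_automorphism \<sigma> \<and>
     (\<forall>x y. f (x + y) = f x + f y) \<and> (\<forall>c x. f (c *s x) = \<sigma> c *s f x))"

text \<open>
  Elements of \<open>P\<Gamma>L\<close> are represented by the permutations of the points that they induce.
\<close>

definition PGammaL :: "(('a::field ^ 'd) set \<Rightarrow> ('a ^ 'd) set) monoid" where
  "PGammaL = (BijGroup proj_points)\<lparr>carrier :=
     {\<lambda>P\<in>proj_points. f ` P | f. semilinear f \<and> bij f}\<rparr>"

definition Persp :: "('a::field ^ 'd) set \<Rightarrow> (('a ^ 'd) set \<Rightarrow> ('a ^ 'd) set) monoid" where
  "Persp H = PGammaL\<lparr>carrier :=
     {g \<in> carrier PGammaL. \<forall>P\<in>proj_points. P \<subseteq> H \<longrightarrow> g P = P}\<rparr>"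

definition AGammaL1 :: "('a::field \<Rightarrow> 'a) monoid" where
  "AGammaL1 = (BijGroup UNIV)\<lparr>carrier :=
     {\<lambda>x. a * \<sigma> x + b | a b \<sigma>. a \<noteq> 0 \<and> field_automorphism \<sigma>}\<rparr>"

definition semidirect_product ::
  "('a, 'c) monoid_scheme \<Rightarrow> ('b \<Rightarrow> 'a \<Rightarrow> 'a) \<Rightarrow> ('b, 'd) monoid_scheme \<Rightarrow> ('a \<times> 'b) monoid" where
  "semidirect_product N \<phi> H =
     \<lparr>carrier = carrier N \<times> carrier H,
      monoid.mult = (\<lambda>(a, x) (b, y). (a \<otimes>\<^bsub>N\<^esub> \<phi> x b, x \<otimes>\<^bsub>H\<^esub> y)),
      monoid.one = (\<one>\<^bsub>N\<^esub>, \<one>\<^bsub>H\<^esub>)\<rparr>"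

end

theory Submission
  imports Defs "HOL-Number_Theory.Residues" "HOL-Computational_Algebra.Polynomial"
begin

hide_const (open) Polynomial.order Polynomial.degree

text \<open>
  Removing a point of the curve and moving it to infinity, \<open>K\<close> becomes the set of all
  \<open>\<kappa>(t) = (1, t, \<dots>, t\<^sup>n)\<close>, and the graph becomes the incidence graph of the vectors of \<open>H\<close>
  and the cosets of the lines spanned by the \<open>\<kappa>(t)\<close>.

  Two distinct parallel lines whose difference is a multiple of some \<open>\<kappa>(s)\<close> have \<open>q\<close> common
  transversals. For two points the analogous configuration would write their difference in \<open>q\<close> ways
  as a combination of two curve vectors. This is impossible for \<open>n \<ge> 3\<close> by independence, and for
  \<open>n = 2\<close> because it would give a fixed-point-free involution on a set of odd size \<open>q\<close>. So no
  automorphism takes a line to a point. Disjoint lines in different directions have at most \<open>q - 2\<close>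
  transversals, so automorphisms preserve parallelism and permute the directions by some \<open>\<pi>\<close>.

  Coordinates with respect to \<open>n + 1\<close> directions then show that the action on vectors is separately
  a function of each coordinate, a further direction makes it additive, and the cross ratios of
  quadruples of parameters, which generate the field, make it semilinear with companion \<open>\<sigma>\<close>. Finally
  \<open>\<pi>\<close> transforms cross ratios by \<open>\<sigma>\<close>, which forces \<open>\<pi> t = a \<sigma> t + b\<close>. Conversely each such \<open>\<pi>\<close>
  lifts to a semilinear map, uniquely up to a perspectivity.
\<close>

section \<open>Automorphisms of a finite field\<close>

text \<open>Sending the omitted point to infinity makes the directions correspond to all of F_q, so
  AGammaL(1,q) appears as the stabiliser of infinity in PGammaL(2,q): a fractional semilinear map
  that keeps finite parameters finite has no pole. An automorphism of the graph is at first only a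
  bijection, and the companion field automorphism has to be built from coordinates. Relative to
  \<open>n + 1\<close> nodes on the curve, the coordinates of another curve vector are values of
  Lagrange polynomials. In the double quotient for two curve vectors and two nodes all but four
  differences cancel, which is how cross ratios arise. The bound \<open>q \<ge> n + 3\<close> lets
  \<open>n + 1\<close> nodes avoid both of these further parameters. Every automorphism has a unique
  normal form: \<open>e\<close> goes to \<open>e + w\<close>, and \<open>H\<close> is mapped by a
  scalar \<open>\<mu>\<close> times the lift of \<open>\<gamma>\<close>. The pair
  \<open>(w, \<mu>)\<close> is the perspectivity, the lifts of \<open>\<gamma>\<close> form the
  complement, and the order follows by counting triples. That count needs the exact number
  \<open>h\<close> of automorphisms of F_q, hence the opening part.\<close>

context
  fixes \<sigma> :: "'a::field \<Rightarrow> 'a"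
  assumes \<sigma>: "field_automorphism \<sigma>"
begin

lemma field_automorphism_add: "\<sigma> (x + y) = \<sigma> x + \<sigma> y"
  and field_automorphism_mult: "\<sigma> (x * y) = \<sigma> x * \<sigma> y"
  and field_automorphism_bij: "bij \<sigma>"
  using \<sigma> by (auto simp: field_automorphism_def)

lemma field_automorphism_eq_iff: "\<sigma> x = \<sigma> y \<longleftrightarrow> x = y"
  using field_automorphism_bij by (auto simp: bij_def inj_def)

lemma field_automorphism_0: "\<sigma> 0 = 0"
  using field_automorphism_add[of 0 0] by (metis add_0_right add_cancel_left_left)

lemma field_automorphism_eq_0_iff: "\<sigma> x = 0 \<longleftrightarrow> x = 0"
  using field_automorphism_eq_iff[of x 0] field_automorphism_0 by simp

lemma field_automorphism_1: "\<sigma> 1 = 1"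
  using field_automorphism_mult[of 1 1] field_automorphism_eq_0_iff[of 1] by simp

lemma field_automorphism_minus: "\<sigma> (- x) = - \<sigma> x"
  using field_automorphism_add[of x "- x"] field_automorphism_0 by (simp add: eq_neg_iff_add_eq_0 add.commute)

lemma field_automorphism_diff: "\<sigma> (x - y) = \<sigma> x - \<sigma> y"
  using field_automorphism_add[of x "- y"] by (simp add: field_automorphism_minus)

lemma field_automorphism_power: "\<sigma> (x ^ k) = \<sigma> x ^ k"
  by (induction k) (simp_all add: field_automorphism_1 field_automorphism_mult)

lemma field_automorphism_of_nat: "\<sigma> (of_nat k) = of_nat k"
  by (induction k) (simp_all add: field_automorphism_0 field_automorphism_1 field_automorphism_add)

lemma field_automorphism_sum: "\<sigma> (sum f A) = (\<Sum>x\<in>A. \<sigma> (f x))"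
  by (induction A rule: infinite_finite_induct)
    (simp_all add: field_automorphism_0 field_automorphism_add)

lemma field_automorphism_divide: "\<sigma> (x / y) = \<sigma> x / \<sigma> y"
proof (cases "y = 0")
  case False
  then have "\<sigma> (x / y) * \<sigma> y = \<sigma> x"
    using field_automorphism_mult[of "x / y" y] by simp
  then show ?thesis
    using False by (simp add: field_automorphism_eq_0_iff eq_divide_eq)
qed (simp add: field_automorphism_0)

end

lemmas field_automorphism_simps =
  field_automorphism_add field_automorphism_mult field_automorphism_0 field_automorphism_1
  field_automorphism_minus field_automorphism_diff field_automorphism_power
  field_automorphism_of_nat field_automorphism_sum field_automorphism_divide
  field_automorphism_eq_iff field_automorphism_eq_0_iff

lemma field_automorphism_id: "field_automorphism (\<lambda>x. x)"
  by (simp add: field_automorphism_def bij_id[unfolded id_def])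

lemma field_automorphism_comp:
  "field_automorphism \<sigma> \<Longrightarrow> field_automorphism \<tau> \<Longrightarrow> field_automorphism (\<lambda>x. \<sigma> (\<tau> x))"
  using bij_comp[of \<tau> \<sigma>] by (simp add: field_automorphism_def comp_def)

section \<open>Powers of Frobenius and the number of automorphisms of a finite field\<close>

lemma finite_field_generator:
  "\<exists>g :: 'a::{field,finite}. \<forall>x. x \<noteq> 0 \<longrightarrow> (\<exists>k::nat. x = g ^ k)"
proof -
  \<comment> \<open>Cyclicity of the multiplicative group is a theorem about ring records, so the
    type-class field is repackaged as one.\<close>
  define R :: "'a ring" where
    "R = \<lparr>carrier = UNIV, monoid.mult = (*), one = 1, zero = 0, add = (+)\<rparr>"
  interpret R: Ring.field R
  proof (intro cring.cring_fieldI2 cringI abelian_groupI comm_monoidI)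
    show "\<exists>y\<in>carrier R. y \<oplus>\<^bsub>R\<^esub> x = \<zero>\<^bsub>R\<^esub>" for x
      by (auto simp: R_def intro: exI[of _ "- x"])
    show "\<exists>b\<in>carrier R. a \<otimes>\<^bsub>R\<^esub> b = \<one>\<^bsub>R\<^esub>" if "a \<noteq> \<zero>\<^bsub>R\<^esub>" for a
      using that by (auto simp: R_def intro: exI[of _ "1 / a"])
  qed (simp_all add: R_def ring_distribs add_ac mult_ac)
  have pw: "g [^]\<^bsub>R\<^esub> (k::nat) = g ^ k" for g :: 'a and k
    by (induction k) (simp_all add: R_def mult.commute)
  have "finite (carrier R)" by simp
  then obtain g where g: "carrier (mult_of R) = {g [^]\<^bsub>R\<^esub> i | i::nat. i \<in> UNIV}"
    using R.finite_field_mult_group_has_gen by blast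
  have "x \<in> carrier (mult_of R)" if "x \<noteq> 0" for x
    using that by (simp add: carrier_mult_of) (simp add: R_def)
  then show ?thesis
    unfolding g pw by blast
qed

lemma poly_eq_sum:
  fixes P :: "'a::comm_ring_1 poly"
  assumes "Polynomial.degree P \<le> m"
  shows "poly P x = (\<Sum>i\<le>m. coeff P i * x ^ i)"
  unfolding poly_altdef using assms
  by (intro sum.mono_neutral_left) (auto simp: coeff_eq_0)

text \<open>Multiplication by a nonzero \<open>x\<close> permutes the nonzero elements; comparing
  their product before and after gives \<open>x ^ (q - 1) = 1\<close>.\<close>

lemma power_card_field: "(x :: 'a::{field,finite}) ^ CARD('a) = x"
proof (cases "x = 0")
  case False
  let ?U = "UNIV - {0 :: 'a}"
  have "(\<Prod>y\<in>?U. x * y) = (\<Prod>y\<in>?U. y)"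
    using False by (intro prod.reindex_bij_witness[of _ "\<lambda>y. y / x" "\<lambda>y. x * y"]) auto
  then have "x ^ card ?U * (\<Prod>y\<in>?U. y) = (\<Prod>y\<in>?U. y)"
    by (simp add: prod.distrib)
  then have "x ^ card ?U = 1"
    by simp
  moreover have "CARD('a) = Suc (card ?U)"
    using card.remove[of UNIV "0 :: 'a"] by simp
  ultimately show ?thesis by (metis power_Suc mult.right_neutral)
qed simp

text \<open>The first \<open>h\<close> iterates of Frobenius are distinct automorphisms. Conversely,
  an automorphism is determined by its value at a generator \<open>g\<close>, and it fixes the
  coefficients of the polynomial \<open>P\<close> whose roots are the Frobenius conjugates of
  \<open>g\<close>; so it sends \<open>g\<close> to one of these conjugates.\<close>

lemma card_field_automorphisms:
  assumes "prime p" and q: "CARD('a::{field,finite}) = p ^ h"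
  shows "card {\<sigma> :: 'a \<Rightarrow> 'a. field_automorphism \<sigma>} = h"
proof -
  have q1: "CARD('a) > 1"
    using card_mono[of UNIV "{0, 1 :: 'a}"] by simp
  then have "h > 0" using q by (cases h) auto
  have "prime CHAR('a)"
    by (intro prime_CHAR_semidom finite_imp_CHAR_pos finite)
  moreover have "CHAR('a) dvd p ^ h"
    using CHAR_dvd_CARD[where 'a = 'a] q by simp
  ultimately have p: "CHAR('a) = p"
    using \<open>prime p\<close> by (metis prime_dvd_power primes_dvd_imp_eq)
  have p1: "p > 1" using \<open>prime p\<close> by (rule prime_gt_1_nat)
  have pw: "x ^ (p ^ h) = x" for x :: 'a
    using power_card_field[of x] q by simp
  have frob_add: "(x + y) ^ (p ^ i) = x ^ (p ^ i) + y ^ (p ^ i)" for x y :: 'a and i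
    using freshmans_dream'[where 'a = 'a] p \<open>prime CHAR('a)\<close> by blast
  have frob_inj: "x = y" if "x ^ (p ^ i) = y ^ (p ^ i)" for x y :: 'a and i
  proof -
    have "(x - y) ^ (p ^ i) + y ^ (p ^ i) = x ^ (p ^ i)"
      using frob_add[of "x - y" y i] by simp
    then show ?thesis using that by simp
  qed
  have frob: "field_automorphism (\<lambda>x :: 'a. x ^ (p ^ i))" for i
    using frob_add frob_inj
    by (auto simp: field_automorphism_def power_mult_distrib bij_def inj_def
        intro!: finite_UNIV_inj_surj)
  have inj: "inj_on (\<lambda>i (x :: 'a). x ^ (p ^ i)) {..<h}"
  proof (rule inj_onI)
    fix i j assume ij: "i \<in> {..<h}" "j \<in> {..<h}"
      and eq: "(\<lambda>x :: 'a. x ^ (p ^ i)) = (\<lambda>x. x ^ (p ^ j))"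
    \<comment> \<open>Monomials of degree below \<open>q\<close> that agree as functions agree as
      polynomials, so their exponents can be compared.\<close>
    have lt: "p ^ i < CARD('a)" "p ^ j < CARD('a)"
      using ij p1 q by auto
    have "monom (1 :: 'a) (p ^ i) = monom 1 (p ^ j)"
      using lt fun_cong[OF eq] by (intro poly_eqI_degree[of UNIV]) (auto simp: poly_monom degree_monom_eq)
    then have "p ^ i = p ^ j"
      by (metis degree_monom_eq one_neq_zero)
    then show "i = j" using p1 by simp
  qed
  obtain g :: 'a where g: "\<And>x. x \<noteq> 0 \<Longrightarrow> \<exists>k::nat. x = g ^ k"
    using finite_field_generator by blast
  define P where "P = (\<Prod>i<h. [:- (g ^ (p ^ i)), 1:])"
  have poly_P: "poly P x = (\<Prod>i<h. x - g ^ (p ^ i))" for x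
    by (simp add: P_def poly_prod)
  have deg: "Polynomial.degree P \<le> h"
    using degree_prod_sum_le[of "{..<h}" "\<lambda>i. [:- (g ^ (p ^ i)), 1:]"] by (simp add: P_def)
  \<comment> \<open>Polynomials of degree at most \<open>h\<close> are thereby determined by their
    values on the field.\<close>
  have hq: "h < CARD('a)" using p1 q power_gt_expt[of p h] by simp
  have fr: "poly P x ^ p = poly P (x ^ p)" for x
  proof -
    have "poly P x ^ p = (\<Prod>i<h. (x - g ^ (p ^ i)) ^ p)"
      by (simp add: poly_P prod_power_distrib)
    also have "\<dots> = (\<Prod>i<h. x ^ p - g ^ (p ^ Suc i))"
      using field_automorphism_diff[OF frob[of 1]] by (simp add: power_mult[symmetric] mult.commute)
    \<comment> \<open>Frobenius shifts the roots cyclically: the new index \<open>h\<close> takes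
      the place of \<open>0\<close>, because \<open>g ^ (p ^ h) = g\<close>.\<close>
    also have "\<dots> = (\<Prod>i\<in>{..<Suc h} - {0}. x ^ p - g ^ (p ^ i))"
      by (rule prod.reindex_bij_witness[of _ "\<lambda>i. i - 1" Suc]) auto
    also have "\<dots> = (\<Prod>i<h. x ^ p - g ^ (p ^ i))"
    proof -
      have "{..<Suc h} - {0} = insert h ({..<h} - {0})" using \<open>h > 0\<close> by auto
      moreover have "(\<Prod>i<h. x ^ p - g ^ (p ^ i)) = (x ^ p - g ^ (p ^ 0)) * (\<Prod>i\<in>{..<h} - {0}. x ^ p - g ^ (p ^ i))"
        using \<open>h > 0\<close> by (intro prod.remove) auto
      ultimately show ?thesis by (simp add: pw)
    qed
    finally show ?thesis by (simp add: poly_P)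
  qed
  \<comment> \<open>Applying Frobenius to the coefficients of \<open>P\<close> does not change its
    values at \<open>p\<close>-th powers. These exhaust the field, so the coefficients themselves
    are fixed.\<close>
  have "poly (map_poly (\<lambda>c. c ^ p) P) (x ^ p) = poly P (x ^ p)" for x
  proof -
    have "poly (map_poly (\<lambda>c. c ^ p) P) (x ^ p) = (\<Sum>i\<le>h. coeff P i ^ p * (x ^ p) ^ i)"
      using deg p1 by (subst poly_eq_sum[of _ h]) (auto simp: coeff_map_poly degree_map_poly)
    also have "\<dots> = (\<Sum>i\<le>h. coeff P i * x ^ i) ^ p"
      using field_automorphism_sum[OF frob[of 1], of "\<lambda>i. coeff P i * x ^ i" "{..h}"]
      by (simp add: power_mult_distrib power_mult[symmetric] mult.commute)
    also have "\<dots> = poly P x ^ p"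
      using deg by (subst poly_eq_sum[of P h]) auto
    finally show ?thesis by (simp add: fr)
  qed
  moreover have "surj (\<lambda>x :: 'a. x ^ p)"
    using field_automorphism_bij[OF frob[of 1]] by (simp add: bij_def)
  ultimately have "poly (map_poly (\<lambda>c. c ^ p) P) y = poly P y" for y
    using surj_f_inv_f[of "\<lambda>x. x ^ p" y] by metis
  then have "map_poly (\<lambda>c. c ^ p) P = P"
    using deg hq p1 by (intro poly_eqI_degree[of UNIV]) (auto simp: degree_map_poly)
  then have cP: "coeff P i ^ p = coeff P i" for i
    using coeff_map_poly[of "\<lambda>c. c ^ p" P i] p1 by simp
  define E where "E = {x :: 'a. x ^ p = x}"
  \<comment> \<open>\<open>E\<close> is the prime field: it contains the \<open>p\<close> images of
    natural numbers and, as root set of \<open>X ^ p - X\<close>, has no room for more.\<close>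
  have E: "E = of_nat ` {..<p}"
  proof (rule sym, rule card_seteq)
    show "finite E" by simp
    have "(of_nat k :: 'a) ^ p = of_nat k" for k
      using field_automorphism_of_nat[OF frob[of 1], of k] by simp
    then show "of_nat ` {..<p} \<subseteq> E" by (auto simp: E_def)
    have "E \<subseteq> {x. poly (monom 1 p - [:0, 1:]) x = 0}"
      by (auto simp: E_def poly_monom)
    moreover have "monom 1 p - [:0, 1 :: 'a:] \<noteq> 0"
    proof
      assume z: "monom 1 p - [:0, 1 :: 'a:] = 0"
      have "coeff (monom 1 p - [:0, 1 :: 'a:]) 1 = - 1"
        using p1 by simp
      then show False unfolding z by simp
    qed
    moreover have "Polynomial.degree (monom 1 p - [:0, 1 :: 'a:]) \<le> p"
      using p1 by (intro degree_diff_le degree_monom_le) auto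
    ultimately have "card E \<le> p"
      using card_poly_roots_bound card_mono[OF finite]
      by (blast intro: order_trans)
    moreover have "inj_on (of_nat :: nat \<Rightarrow> 'a) {..<p}"
      by (auto intro!: inj_onI simp: of_nat_eq_iff_cong_CHAR p cong_def)
    ultimately show "card E \<le> card ((of_nat :: nat \<Rightarrow> 'a) ` {..<p})"
      by (simp add: card_image)
  qed
  have "{\<sigma> :: 'a \<Rightarrow> 'a. field_automorphism \<sigma>} = (\<lambda>i x. x ^ (p ^ i)) ` {..<h}"
  proof (intro equalityI subsetI)
    fix \<sigma> :: "'a \<Rightarrow> 'a" assume "\<sigma> \<in> {\<sigma>. field_automorphism \<sigma>}"
    then have \<sigma>: "field_automorphism \<sigma>" by simp
    have "\<sigma> (coeff P i) = coeff P i" for i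
    proof -
      have "coeff P i \<in> E" using cP[of i] by (simp add: E_def)
      then show ?thesis unfolding E using field_automorphism_of_nat[OF \<sigma>] by auto
    qed
    then have "\<sigma> (poly P g) = poly P (\<sigma> g)"
      by (simp add: poly_altdef field_automorphism_simps[OF \<sigma>])
    moreover have "poly P g = 0"
      using \<open>h > 0\<close> by (auto simp: poly_P intro!: prod_zero bexI[of _ 0])
    ultimately have "(\<Prod>i<h. \<sigma> g - g ^ (p ^ i)) = 0"
      using field_automorphism_0[OF \<sigma>] by (simp only: poly_P[of "\<sigma> g", symmetric])
    then obtain i where i: "i < h" "\<sigma> g = g ^ (p ^ i)"
      by auto
    have "\<sigma> x = x ^ (p ^ i)" for x
    proof (cases "x = 0")
      case False
      then obtain k where "x = g ^ k" using g by blast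
      then show ?thesis
        using i by (simp add: field_automorphism_power[OF \<sigma>] power_mult[symmetric] mult.commute)
    qed (use p1 field_automorphism_0[OF \<sigma>] in simp)
    then show "\<sigma> \<in> (\<lambda>i x. x ^ (p ^ i)) ` {..<h}"
      using i by blast
  qed (use frob in auto)
  then show ?thesis
    by (simp add: card_image inj)
qed

lemma even_card_involution:
  assumes "finite A" and "\<And>x. x \<in> A \<Longrightarrow> f x \<in> A" "\<And>x. x \<in> A \<Longrightarrow> f (f x) = x" "\<And>x. x \<in> A \<Longrightarrow> f x \<noteq> x"
  shows "even (card A)"
proof -
  have "2 * card ((\<lambda>x. {x, f x}) ` A) = card (\<Union> ((\<lambda>x. {x, f x}) ` A))"
  proof (rule card_partition)
    fix c assume "c \<in> (\<lambda>x. {x, f x}) ` A"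
    then obtain x where "x \<in> A" "c = {x, f x}" by blast
    then show "card c = 2" using assms(4)[of x] by auto
  next
    fix c d assume cd: "c \<in> (\<lambda>x. {x, f x}) ` A" "d \<in> (\<lambda>x. {x, f x}) ` A" "c \<noteq> d"
    then obtain x y where xy: "x \<in> A" "c = {x, f x}" "y \<in> A" "d = {y, f y}" by blast
    have orbit: "{u, f u} = {z, f z}" if "u \<in> A" "z \<in> {u, f u}" for u z
      using that assms(3)[of u] by auto
    show "c \<inter> d = {}"
    proof (rule ccontr)
      assume "c \<inter> d \<noteq> {}"
      then obtain z where "z \<in> {x, f x}" "z \<in> {y, f y}" using xy by blast
      then show False using orbit[of x z] orbit[of y z] xy \<open>c \<noteq> d\<close> by simp
    qed
  qed (use assms in auto)
  moreover have "\<Union> ((\<lambda>x. {x, f x}) ` A) = A"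
    using assms by auto
  ultimately show ?thesis by (metis dvd_triv_left)
qed

lemma ex_notin: "card S < CARD('a::finite) \<Longrightarrow> \<exists>x. x \<notin> (S :: 'a set)"
  by (cases "S = UNIV") auto

text \<open>Meant for multipliers obtained from cross ratios, which supply only quotients
  \<open>u / v\<close>; single elements have to be recovered. Once \<open>- 1\<close> is in
  \<open>M\<close>, the quotient \<open>(u + 1) / u = 1 + 1 / u\<close> gives \<open>1 / u\<close>
  and then \<open>u\<close>.\<close>

lemma subfield_eq_UNIV:
  fixes M :: "'a::{field,finite} set"
  assumes card: "CARD('a) \<ge> 5"
    and add: "\<And>x y. x \<in> M \<Longrightarrow> y \<in> M \<Longrightarrow> x + y \<in> M"
    and mult: "\<And>x y. x \<in> M \<Longrightarrow> y \<in> M \<Longrightarrow> x * y \<in> M"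
    and divide: "\<And>x y. x \<in> M \<Longrightarrow> y \<in> M \<Longrightarrow> y \<noteq> 0 \<Longrightarrow> x / y \<in> M"
    and ratio: "\<And>u v. u \<notin> {0, 1} \<Longrightarrow> v \<notin> {0, 1} \<Longrightarrow> u / v \<in> M"
  shows "M = UNIV"
proof -
  obtain u\<^sub>0 :: 'a where u0: "u\<^sub>0 \<notin> {0, 1}"
    using ex_notin[of "{0, 1 :: 'a}"] card by auto
  have one: "1 \<in> M" using ratio[OF u0 u0] u0 by simp
  have "u \<in> M" if u: "u \<notin> {0, 1}" for u
  proof (rule ccontr)
    assume "u \<notin> M"
    have "- 1 \<in> M"
    proof (cases "- 1 = (1 :: 'a)")
      case True then show ?thesis using one by metis
    next
      case False
      have "u \<noteq> 0" using u by simp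
      show ?thesis
      proof (cases "- u = 1")
        case True
        \<comment> \<open>If \<open>- u = 1\<close>, the quotient of \<open>- u\<close> by
          \<open>u\<close> is not among those supplied; some \<open>v\<close> works for which
          \<open>- v\<close> also avoids \<open>0\<close> and \<open>1\<close>.\<close>
        have "card {0, 1, - 1 :: 'a} < CARD('a)" using card by (simp add: card_insert_if)
        then obtain v where v: "v \<notin> {0, 1, - 1 :: 'a}"
          using ex_notin by blast
        then have "- v / v \<in> M" using ratio[of "- v" v] by (auto simp: minus_equation_iff)
        then show ?thesis using v by simp
      next
        case False
        then have "- u / u \<in> M" using ratio[of "- u" u] u by auto
        then show ?thesis using \<open>u \<noteq> 0\<close> by simp
      qed
    qed
    then have "u + 1 \<noteq> 0"
      using \<open>u \<notin> M\<close> by (metis add_eq_0_iff2)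
    then have "u + 1 \<notin> {0, 1}" using u by auto
    then have "(u + 1) / u \<in> M" using ratio u by blast
    then have 1: "1 + 1 / u \<in> M" using u by (auto simp: add_divide_distrib)
    then have "(1 + 1 / u) + - 1 \<in> M" using add \<open>- 1 \<in> M\<close> by blast
    then have "u \<in> M" using divide[OF one, of "1 / u"] u by simp
    then show False using \<open>u \<notin> M\<close> by simp
  qed
  moreover have "0 \<in> M"
  proof -
    have "- 1 \<in> M"
    proof (cases "- 1 = (1 :: 'a)")
      case True then show ?thesis using one by metis
    next
      case False then show ?thesis using calculation[of "- 1"] by auto
    qed
    then show ?thesis using add[OF one] by fastforce
  qed
  ultimately have "x \<in> M" for x
    using one by (cases "x \<in> {0, 1}") auto
  then show ?thesis by blast
qed

section \<open>Recognising semidirect products\<close>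

text \<open>The action is read off from \<open>normal\<close>. Cancelling \<open>j x\<close> and
  using injectivity of \<open>i\<close> shows that the element chosen there is unique, and all laws
  of the action follow from this uniqueness.\<close>

lemma semidirect_product_iso:
  fixes G :: "('g, 'x) monoid_scheme" and N :: "('n, 'y) monoid_scheme" and Q :: "('q, 'z) monoid_scheme"
  assumes "group G" and fin: "finite (carrier N)"
    and N: "\<And>x y. x \<in> carrier N \<Longrightarrow> y \<in> carrier N \<Longrightarrow> x \<otimes>\<^bsub>N\<^esub> y \<in> carrier N"
    and Q: "\<And>x y. x \<in> carrier Q \<Longrightarrow> y \<in> carrier Q \<Longrightarrow> x \<otimes>\<^bsub>Q\<^esub> y \<in> carrier Q"
    and i: "i \<in> hom N G" "inj_on i (carrier N)" and j: "j \<in> hom Q G"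
    and bij: "bij_betw (\<lambda>(a, x). i a \<otimes>\<^bsub>G\<^esub> j x) (carrier N \<times> carrier Q) (carrier G)"
    and normal: "\<And>a x. a \<in> carrier N \<Longrightarrow> x \<in> carrier Q \<Longrightarrow>
      \<exists>a'\<in>carrier N. j x \<otimes>\<^bsub>G\<^esub> i a = i a' \<otimes>\<^bsub>G\<^esub> j x"
  shows "\<exists>\<phi>\<in>hom Q (AutoGroup N). G \<cong> semidirect_product N \<phi> Q"
proof -
  interpret G: group G by fact
  have iG: "i a \<in> carrier G" if "a \<in> carrier N" for a
    using i(1) that by (auto simp: hom_def)
  have jG: "j x \<in> carrier G" if "x \<in> carrier Q" for x
    using j that by (auto simp: hom_def)
  have im: "i (a \<otimes>\<^bsub>N\<^esub> b) = i a \<otimes>\<^bsub>G\<^esub> i b" if "a \<in> carrier N" "b \<in> carrier N" for a b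
    using i(1) that by (auto simp: hom_def)
  have jm: "j (x \<otimes>\<^bsub>Q\<^esub> y) = j x \<otimes>\<^bsub>G\<^esub> j y" if "x \<in> carrier Q" "y \<in> carrier Q" for x y
    using j that by (auto simp: hom_def)
  define \<phi> where "\<phi> = (\<lambda>x. \<lambda>a\<in>carrier N. SOME a'. a' \<in> carrier N \<and> j x \<otimes>\<^bsub>G\<^esub> i a = i a' \<otimes>\<^bsub>G\<^esub> j x)"
  have \<phi>: "\<phi> x a \<in> carrier N" "j x \<otimes>\<^bsub>G\<^esub> i a = i (\<phi> x a) \<otimes>\<^bsub>G\<^esub> j x"
    if "x \<in> carrier Q" "a \<in> carrier N" for x a
  proof -
    have "\<exists>a'. a' \<in> carrier N \<and> j x \<otimes>\<^bsub>G\<^esub> i a = i a' \<otimes>\<^bsub>G\<^esub> j x"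
      using normal[OF that(2,1)] by blast
    from someI_ex[OF this] show "\<phi> x a \<in> carrier N" "j x \<otimes>\<^bsub>G\<^esub> i a = i (\<phi> x a) \<otimes>\<^bsub>G\<^esub> j x"
      using that by (auto simp: \<phi>_def)
  qed
  have \<phi>_eqI: "\<phi> x a = a'"
    if "x \<in> carrier Q" "a \<in> carrier N" "a' \<in> carrier N" "j x \<otimes>\<^bsub>G\<^esub> i a = i a' \<otimes>\<^bsub>G\<^esub> j x" for x a a'
  proof -
    have "i (\<phi> x a) = i a'"
      using \<phi>[OF that(1,2)] that iG jG by simp
    then show ?thesis using i(2) \<phi>[OF that(1,2)] that by (auto dest: inj_onD)
  qed
  have \<phi>_mult: "\<phi> x (a \<otimes>\<^bsub>N\<^esub> b) = \<phi> x a \<otimes>\<^bsub>N\<^esub> \<phi> x b"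
    if "x \<in> carrier Q" "a \<in> carrier N" "b \<in> carrier N" for x a b
  proof (rule \<phi>_eqI)
    have "j x \<otimes>\<^bsub>G\<^esub> i (a \<otimes>\<^bsub>N\<^esub> b) = (j x \<otimes>\<^bsub>G\<^esub> i a) \<otimes>\<^bsub>G\<^esub> i b"
      using that iG jG by (simp add: im G.m_assoc)
    also have "\<dots> = i (\<phi> x a) \<otimes>\<^bsub>G\<^esub> (j x \<otimes>\<^bsub>G\<^esub> i b)"
      using that iG jG \<phi> by (simp add: G.m_assoc)
    also have "\<dots> = i (\<phi> x a \<otimes>\<^bsub>N\<^esub> \<phi> x b) \<otimes>\<^bsub>G\<^esub> j x"
      using that iG jG \<phi>(1) by (simp add: \<phi>(2) im G.m_assoc)
    finally show "j x \<otimes>\<^bsub>G\<^esub> i (a \<otimes>\<^bsub>N\<^esub> b) = i (\<phi> x a \<otimes>\<^bsub>N\<^esub> \<phi> x b) \<otimes>\<^bsub>G\<^esub> j x" .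
  qed (use that N \<phi> in auto)
  have \<phi>_comp: "\<phi> (x \<otimes>\<^bsub>Q\<^esub> y) a = \<phi> x (\<phi> y a)"
    if "x \<in> carrier Q" "y \<in> carrier Q" "a \<in> carrier N" for x y a
  proof (rule \<phi>_eqI)
    have "j (x \<otimes>\<^bsub>Q\<^esub> y) \<otimes>\<^bsub>G\<^esub> i a = j x \<otimes>\<^bsub>G\<^esub> (i (\<phi> y a) \<otimes>\<^bsub>G\<^esub> j y)"
      using that iG jG by (simp add: jm \<phi>(2)[symmetric] G.m_assoc)
    also have "\<dots> = (j x \<otimes>\<^bsub>G\<^esub> i (\<phi> y a)) \<otimes>\<^bsub>G\<^esub> j y"
      using that iG jG \<phi>(1) by (simp add: G.m_assoc)
    also have "\<dots> = (i (\<phi> x (\<phi> y a)) \<otimes>\<^bsub>G\<^esub> j x) \<otimes>\<^bsub>G\<^esub> j y"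
      using that \<phi>(1) by (simp only: \<phi>(2))
    also have "\<dots> = i (\<phi> x (\<phi> y a)) \<otimes>\<^bsub>G\<^esub> j (x \<otimes>\<^bsub>Q\<^esub> y)"
      using that iG jG \<phi>(1) by (simp add: jm G.m_assoc)
    finally show "j (x \<otimes>\<^bsub>Q\<^esub> y) \<otimes>\<^bsub>G\<^esub> i a = i (\<phi> x (\<phi> y a)) \<otimes>\<^bsub>G\<^esub> j (x \<otimes>\<^bsub>Q\<^esub> y)" .
  qed (use that Q \<phi> in auto)
  have \<phi>_inj: "inj_on (\<phi> x) (carrier N)" if "x \<in> carrier Q" for x
  proof (rule inj_onI)
    fix a b assume ab: "a \<in> carrier N" "b \<in> carrier N" "\<phi> x a = \<phi> x b"
    then have "j x \<otimes>\<^bsub>G\<^esub> i a = j x \<otimes>\<^bsub>G\<^esub> i b"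
      using \<phi>(2) that by simp
    then have "i a = i b" using ab that iG jG by simp
    then show "a = b" using i(2) ab by (auto dest: inj_onD)
  qed
  have \<phi>_auto: "\<phi> x \<in> auto N" if "x \<in> carrier Q" for x
  proof -
    \<comment> \<open>Surjectivity comes from finiteness: an injective self-map of
      \<open>carrier N\<close> is onto.\<close>
    have "\<phi> x ` carrier N = carrier N"
      using \<phi>(1)[OF that] \<phi>_inj[OF that] fin by (intro endo_inj_surj) auto
    then show ?thesis
      using \<phi>(1)[OF that] \<phi>_inj[OF that] \<phi>_mult[OF that]
      by (auto simp: auto_def hom_def Bij_def bij_betw_def \<phi>_def)
  qed
  have "\<phi> (x \<otimes>\<^bsub>Q\<^esub> y) = compose (carrier N) (\<phi> x) (\<phi> y)" if "x \<in> carrier Q" "y \<in> carrier Q" for x y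
  proof
    fix a
    show "\<phi> (x \<otimes>\<^bsub>Q\<^esub> y) a = compose (carrier N) (\<phi> x) (\<phi> y) a"
      using \<phi>_comp[OF that, of a] by (cases "a \<in> carrier N") (auto simp: compose_def \<phi>_def)
  qed
  then have "\<phi> \<in> hom Q (AutoGroup N)"
    using \<phi>_auto by (auto simp: hom_def AutoGroup_def BijGroup_def auto_def)
  moreover have "G \<cong> semidirect_product N \<phi> Q"
  proof -
    let ?S = "semidirect_product N \<phi> Q" and ?f = "\<lambda>(a, x). i a \<otimes>\<^bsub>G\<^esub> j x"
    have S: "carrier ?S = carrier N \<times> carrier Q"
      by (simp add: semidirect_product_def)
    have f: "?f (u \<otimes>\<^bsub>?S\<^esub> v) = ?f u \<otimes>\<^bsub>G\<^esub> ?f v" if u: "u \<in> carrier ?S" and v: "v \<in> carrier ?S" for u v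
    proof -
      obtain a x b y where eq: "u = (a, x)" "v = (b, y)" by (cases u, cases v) auto
      have ab: "a \<in> carrier N" "b \<in> carrier N" "x \<in> carrier Q" "y \<in> carrier Q"
        using u v by (auto simp: eq S)
      have "?f (u \<otimes>\<^bsub>?S\<^esub> v) = i a \<otimes>\<^bsub>G\<^esub> ((i (\<phi> x b) \<otimes>\<^bsub>G\<^esub> j x) \<otimes>\<^bsub>G\<^esub> j y)"
        using ab iG jG \<phi>(1) by (simp add: eq semidirect_product_def im jm G.m_assoc)
      also have "\<dots> = ?f u \<otimes>\<^bsub>G\<^esub> ?f v"
        using ab iG jG by (simp add: eq \<phi>(2)[symmetric] G.m_assoc)
      finally show ?thesis .
    qed
    have closed: "u \<otimes>\<^bsub>?S\<^esub> v \<in> carrier ?S" if "u \<in> carrier ?S" "v \<in> carrier ?S" for u v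
      using that N Q \<phi>(1) by (auto simp: semidirect_product_def)
    \<comment> \<open>The factorisation map goes from the product to \<open>G\<close>, whereas the
      isomorphism is wanted in the other direction.\<close>
    let ?h = "inv_into (carrier ?S) ?f"
    have bij': "bij_betw ?f (carrier ?S) (carrier G)" using bij S by simp
    have h: "bij_betw ?h (carrier G) (carrier ?S)"
      using bij' by (rule bij_betw_inv_into)
    have hm: "?h (g \<otimes>\<^bsub>G\<^esub> g') = ?h g \<otimes>\<^bsub>?S\<^esub> ?h g'" if g: "g \<in> carrier G" "g' \<in> carrier G" for g g'
    proof (rule inv_into_f_eq)
      have "?h g \<in> carrier ?S" "?h g' \<in> carrier ?S"
        using h g by (auto dest: bij_betwE)
      then show "?h g \<otimes>\<^bsub>?S\<^esub> ?h g' \<in> carrier ?S"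
        "?f (?h g \<otimes>\<^bsub>?S\<^esub> ?h g') = g \<otimes>\<^bsub>G\<^esub> g'"
        using closed f bij_betw_inv_into_right[OF bij'] g by auto
    qed (use bij' in \<open>simp add: bij_betw_def\<close>)
    then have "?h \<in> iso G ?S"
      using h by (auto simp: iso_def hom_def dest: bij_betwE)
    then show ?thesis by (auto simp: is_iso_def)
  qed
  ultimately show ?thesis by blast
qed

section \<open>Coordinates adapted to the curve\<close>

text \<open>\<open>B 0\<close>, ..., \<open>B n\<close> span the hyperplane at infinity,
  \<open>B (Suc n)\<close> lies off it, and \<open>crd\<close> is the dual family of coordinate
  functionals. Indexing by natural numbers instead of \<open>'d\<close> makes basis indices coincide
  with exponents on the curve.\<close>

locale curve_coordinates =
  fixes B :: "nat \<Rightarrow> 'a::{field,finite} ^ 'd::finite"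
    and crd :: "nat \<Rightarrow> 'a ^ 'd \<Rightarrow> 'a"
    and n :: nat
  assumes crd_add: "crd i (x + y) = crd i x + crd i y"
    and crd_scale: "crd i (c *s x) = c * crd i x"
    and crd_B: "i \<le> Suc n \<Longrightarrow> j \<le> Suc n \<Longrightarrow> crd i (B j) = (if i = j then 1 else 0)"
    and expand: "(\<Sum>i\<le>Suc n. crd i x *s B i) = x"
    and n_ge_2: "n \<ge> 2"
    and card_ge: "CARD('a) \<ge> n + 3"
    and parity: "n \<ge> 3 \<or> odd CARD('a)"
begin

definition e :: "'a ^ 'd" where "e = B (Suc n)"
definition ht :: "'a ^ 'd \<Rightarrow> 'a" where "ht = crd (Suc n)"
definition H :: "('a ^ 'd) set" where "H = {x. ht x = 0}"
definition kap :: "'a \<Rightarrow> 'a ^ 'd" where "kap t = (\<Sum>i\<le>n. t ^ i *s B i)"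
definition K :: "('a ^ 'd) set set" where "K = range (\<lambda>t. vec.span {kap t})"

lemma crd_0 [simp]: "crd i 0 = 0"
  using crd_scale[of i 0 0] by simp

lemma crd_sum: "crd i (sum f A) = (\<Sum>x\<in>A. crd i (f x))"
  by (induction A rule: infinite_finite_induct) (simp_all add: crd_add)

lemma crd_minus: "crd i (- x) = - crd i x"
  using crd_add[of i x "- x"] by (simp add: eq_neg_iff_add_eq_0 add.commute)

lemma crd_diff: "crd i (x - y) = crd i x - crd i y"
  using crd_add[of i x "- y"] by (simp add: crd_minus)

lemma vec_eqI: "(\<And>i. i \<le> n \<Longrightarrow> crd i x = crd i y) \<Longrightarrow> ht x = ht y \<Longrightarrow> x = y"
proof -
  assume a: "\<And>i. i \<le> n \<Longrightarrow> crd i x = crd i y" and "ht x = ht y"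
  then have "crd i x = crd i y" if "i \<le> Suc n" for i
    using that by (cases "i = Suc n") (auto simp: ht_def)
  then have "(\<Sum>i\<le>Suc n. crd i x *s B i) = (\<Sum>i\<le>Suc n. crd i y *s B i)"
    by (intro sum.cong) auto
  then show ?thesis by (simp only: expand)
qed

lemma ht_add [simp]: "ht (x + y) = ht x + ht y"
  and ht_diff [simp]: "ht (x - y) = ht x - ht y"
  and ht_scale [simp]: "ht (c *s x) = c * ht x"
  and ht_0 [simp]: "ht 0 = 0"
  and ht_e [simp]: "ht e = 1"
  and ht_sum: "ht (sum f A) = (\<Sum>x\<in>A. ht (f x))"
  by (simp_all add: ht_def crd_add crd_diff crd_scale e_def crd_B crd_sum)

lemma crd_kap: "i \<le> n \<Longrightarrow> crd i (kap t) = t ^ i"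
  by (simp add: kap_def crd_sum crd_scale crd_B if_distrib cong: if_cong)

lemma ht_kap [simp]: "ht (kap t) = 0"
  by (simp add: kap_def ht_def crd_sum crd_scale crd_B if_distrib cong: if_cong)

lemma crd_e [simp]: "i \<le> n \<Longrightarrow> crd i e = 0"
  by (simp add: e_def crd_B)

lemma ht_B [simp]: "i \<le> n \<Longrightarrow> ht (B i) = 0"
  by (simp add: ht_def crd_B)

lemma H_closed [simp, intro]: "0 \<in> H" "kap t \<in> H"
  "x \<in> H \<Longrightarrow> y \<in> H \<Longrightarrow> x + y \<in> H" "x \<in> H \<Longrightarrow> y \<in> H \<Longrightarrow> x - y \<in> H" "x \<in> H \<Longrightarrow> c *s x \<in> H"
  by (simp_all add: H_def)

lemma H_sum: "(\<And>i. i \<in> A \<Longrightarrow> f i \<in> H) \<Longrightarrow> sum f A \<in> H"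
  by (simp add: H_def ht_sum)

lemma H_part [simp, intro]: "x - ht x *s e \<in> H"
  by (simp add: H_def)

section \<open>Lagrange interpolation along the curve\<close>

definition lagrange_poly :: "'a set \<Rightarrow> 'a \<Rightarrow> 'a poly" where
  "lagrange_poly T t = (\<Prod>s\<in>T - {t}. smult (1 / (t - s)) [:- s, 1:])"

text \<open>Evaluation at \<open>x\<close> of a polynomial of degree at most \<open>n\<close> is a
  linear functional of \<open>kap x\<close>. The Lagrange polynomials, applied through their
  coefficients, therefore give the basis dual to the vectors \<open>kap t\<close> with
  \<open>t \<in> T\<close>.\<close>

definition lc :: "'a set \<Rightarrow> 'a \<Rightarrow> 'a ^ 'd \<Rightarrow> 'a" where
  "lc T t x = (\<Sum>i\<le>n. coeff (lagrange_poly T t) i * crd i x)"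

lemma poly_lagrange_poly: "poly (lagrange_poly T t) x = (\<Prod>s\<in>T - {t}. (x - s) / (t - s))"
  by (simp add: lagrange_poly_def poly_prod diff_divide_distrib)

lemma poly_lagrange_poly_nodes: "s \<in> T \<Longrightarrow> poly (lagrange_poly T t) s = (if s = t then 1 else 0)"
  by (auto simp: poly_lagrange_poly intro!: prod.neutral prod_zero bexI[of _ s])

lemma degree_lagrange_poly: "t \<in> T \<Longrightarrow> card T = Suc n \<Longrightarrow> Polynomial.degree (lagrange_poly T t) \<le> n"
proof -
  assume t: "t \<in> T" "card T = Suc n"
  have "Polynomial.degree (lagrange_poly T t) \<le> (\<Sum>s\<in>T - {t}. Polynomial.degree (smult (1 / (t - s)) [:- s, 1:]))"
    unfolding lagrange_poly_def by (rule order_trans[OF degree_prod_sum_le]) (auto simp: comp_def)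
  also have "\<dots> \<le> (\<Sum>s\<in>T - {t}. 1)"
    by (intro sum_mono) auto
  also have "\<dots> = n" using t by simp
  finally show ?thesis .
qed

text \<open>Interpolating \<open>X ^ i\<close> at \<open>n + 1\<close> nodes reproduces it;
  comparing coefficients inverts the Vandermonde matrix.\<close>

lemma lagrange:
  assumes T: "card T = Suc n" and i: "i \<le> n"
  shows "(\<Sum>t\<in>T. t ^ i * coeff (lagrange_poly T t) j) = (if i = j then 1 else 0)"
proof -
  have "(\<Sum>t\<in>T. smult (t ^ i) (lagrange_poly T t)) = monom 1 i"
  proof (rule poly_eqI_degree[of T])
    fix x assume x: "x \<in> T"
    have "poly (\<Sum>t\<in>T. smult (t ^ i) (lagrange_poly T t)) x = (\<Sum>t\<in>T. if x = t then t ^ i else 0)"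
      by (simp add: poly_sum poly_lagrange_poly_nodes[OF x] if_distrib cong: if_cong)
    also have "\<dots> = poly (monom 1 i) x"
      using x by (simp add: poly_monom)
    finally show "poly (\<Sum>t\<in>T. smult (t ^ i) (lagrange_poly T t)) x = poly (monom 1 i) x" .
  next
    have "Polynomial.degree (\<Sum>t\<in>T. smult (t ^ i) (lagrange_poly T t)) \<le> n"
      using degree_lagrange_poly[OF _ T]
      by (intro degree_sum_le) (auto intro: order_trans[OF degree_smult_le])
    then show "card T > Polynomial.degree (\<Sum>t\<in>T. smult (t ^ i) (lagrange_poly T t))"
      using T by simp
    show "card T > Polynomial.degree (monom (1 :: 'a) i)"
      using T i by (simp add: degree_monom_eq)
  qed
  then have "coeff (\<Sum>t\<in>T. smult (t ^ i) (lagrange_poly T t)) j = coeff (monom 1 i) j"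
    by simp
  then show ?thesis by (simp add: coeff_sum)
qed

lemma lc_add: "lc T t (x + y) = lc T t x + lc T t y"
  by (simp add: lc_def crd_add ring_distribs sum.distrib)

lemma lc_scale: "lc T t (c *s x) = c * lc T t x"
  by (simp add: lc_def crd_scale sum_distrib_left mult_ac)

lemma lc_0 [simp]: "lc T t 0 = 0"
  by (simp add: lc_def)

lemma lc_diff: "lc T t (x - y) = lc T t x - lc T t y"
  by (simp add: lc_def crd_diff ring_distribs sum_subtractf)

lemma lc_sum: "lc T t (sum f A) = (\<Sum>x\<in>A. lc T t (f x))"
  by (induction A rule: infinite_finite_induct) (simp_all add: lc_add)

text \<open>Both the nonvanishing of coordinates off the nodes and the cross ratios come from this
  product.\<close>

lemma lc_kap:
  assumes "t \<in> T" "card T = Suc n"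
  shows "lc T t (kap x) = (\<Prod>s\<in>T - {t}. (x - s) / (t - s))"
proof -
  have "lc T t (kap x) = (\<Sum>i\<le>n. coeff (lagrange_poly T t) i * x ^ i)"
    by (simp add: lc_def crd_kap)
  also have "\<dots> = poly (lagrange_poly T t) x"
    using poly_eq_sum[OF degree_lagrange_poly[OF assms]] by simp
  finally show ?thesis by (simp add: poly_lagrange_poly)
qed

lemma lc_kap_nodes:
  assumes "t \<in> T" "card T = Suc n" "s \<in> T"
  shows "lc T t (kap s) = (if s = t then 1 else 0)"
  using poly_lagrange_poly_nodes[OF assms(3), of t] lc_kap[OF assms(1,2)] by (simp add: poly_lagrange_poly)

lemma lc_kap_nonzero:
  assumes "t \<in> T" "card T = Suc n" "x \<notin> T"
  shows "lc T t (kap x) \<noteq> 0"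
  unfolding lc_kap[OF assms(1,2)] using assms(3) by (auto simp: prod_zero_iff)

lemma lc_expand:
  assumes T: "card T = Suc n" and x: "x \<in> H"
  shows "(\<Sum>t\<in>T. lc T t x *s kap t) = x"
proof (rule vec_eqI)
  fix i assume i: "i \<le> n"
  have "crd i (\<Sum>t\<in>T. lc T t x *s kap t) = (\<Sum>t\<in>T. lc T t x * t ^ i)"
    using i by (simp add: crd_sum crd_scale crd_kap)
  also have "\<dots> = (\<Sum>t\<in>T. \<Sum>j\<le>n. crd j x * (t ^ i * coeff (lagrange_poly T t) j))"
    by (simp add: lc_def sum_distrib_left sum_distrib_right mult_ac)
  also have "\<dots> = (\<Sum>j\<le>n. \<Sum>t\<in>T. crd j x * (t ^ i * coeff (lagrange_poly T t) j))"
    by (rule sum.swap)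
  also have "\<dots> = (\<Sum>j\<le>n. crd j x * (if i = j then 1 else 0))"
    by (simp add: sum_distrib_left[symmetric] lagrange[OF T i])
  also have "\<dots> = crd i x" using i by (simp add: if_distrib cong: if_cong)
  finally show "crd i (\<Sum>t\<in>T. lc T t x *s kap t) = crd i x" .
qed (use x in \<open>simp add: ht_sum H_def\<close>)

lemma lc_eqI:
  assumes "card T = Suc n" "x \<in> H" "y \<in> H" "\<And>t. t \<in> T \<Longrightarrow> lc T t x = lc T t y"
  shows "x = y"
  using lc_expand[OF assms(1,2)] lc_expand[OF assms(1,3)] assms(4)
  by (metis (no_types, lifting) sum.cong)

text \<open>Excluding two parameters leaves \<open>q - 2 \<ge> n + 1\<close> candidates.\<close>

lemma extend_nodes:
  fixes S A :: "'a set"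
  assumes "card S \<le> Suc n" "S \<inter> A = {}" "card A \<le> 2"
  obtains T where "S \<subseteq> T" "T \<inter> A = {}" "card T = Suc n"
proof -
  have "Suc n \<le> card (- A)"
    using card_ge assms(3) card_Diff_subset[of A UNIV] unfolding Compl_eq_Diff_UNIV by simp
  moreover have "S \<subseteq> - A" using assms(2) by auto
  ultimately obtain T where "S \<subseteq> T" "T \<subseteq> - A" "card T = Suc n"
    using exists_subset_between[of S "Suc n" "- A"] assms(1) by (metis finite)
  then show ?thesis using that by blast
qed

text \<open>The arc property of the curve: after padding \<open>S\<close> to a full set of nodes,
  the coefficient at \<open>t\<close> is the coordinate \<open>lc T t\<close> of the sum.\<close>

lemma kap_independent:
  assumes "finite S" "card S \<le> Suc n" "(\<Sum>t\<in>S. c t *s kap t) = 0" "t \<in> S"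
  shows "c t = 0"
proof -
  obtain T where T: "S \<subseteq> T" "card T = Suc n"
    using extend_nodes[OF assms(2), of "{}"] by auto
  have "0 = lc T t (\<Sum>s\<in>S. c s *s kap s)" using assms(3) by simp
  also have "\<dots> = (\<Sum>s\<in>S. if s = t then c s else 0)"
    unfolding lc_sum lc_scale
  proof (rule sum.cong[OF refl])
    fix s assume "s \<in> S"
    then have "s \<in> T" "t \<in> T" using T assms(4) by auto
    then show "c s * lc T t (kap s) = (if s = t then c s else 0)"
      using T lc_kap_nodes[of t T s] by simp
  qed
  also have "\<dots> = c t" using assms(1,4) by simp
  finally show ?thesis by simp
qed

lemma kap_independent2:
  assumes "r \<noteq> s" "a *s kap r = b *s kap s"
  shows "a = 0 \<and> b = 0"
proof -
  let ?c = "(\<lambda>_. 0)(r := a, s := - b)"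
  have 0: "(\<Sum>t\<in>{r, s}. ?c t *s kap t) = 0"
    using assms by (simp add: vec.scale_minus_left)
  have "card {r, s} \<le> Suc n" using n_ge_2 by (simp add: card_insert_if)
  note ind = kap_independent[OF _ this 0]
  show ?thesis
    using assms(1) ind[of r] ind[of s] by auto
qed

lemma kap_independent3:
  assumes "distinct [r, s, t]" "a *s kap r + b *s kap s = c *s kap t"
  shows "a = 0 \<and> b = 0 \<and> c = 0"
proof -
  let ?c = "(\<lambda>_. 0)(r := a, s := b, t := - c)"
  have 0: "(\<Sum>t\<in>{r, s, t}. ?c t *s kap t) = 0"
    using assms by (simp add: add_diff_eq diff_add_eq vec.scale_minus_left)
  have "card {r, s, t} \<le> Suc n" using n_ge_2 by (simp add: card_insert_if)
  note ind = kap_independent[OF _ this 0]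
  show ?thesis
    using assms(1) ind[of r] ind[of s] ind[of t] by auto
qed

text \<open>In a plane any four vectors are dependent, which is why the case \<open>n = 2\<close>
  gets a separate parity argument later.\<close>

lemma kap_independent4:
  assumes "n \<ge> 3" "distinct [r, s, t, u]" "a *s kap r + b *s kap s = c *s kap t + d *s kap u"
  shows "a = 0 \<and> b = 0 \<and> c = 0 \<and> d = 0"
proof -
  let ?c = "(\<lambda>_. 0)(r := a, s := b, t := - c, u := - d)"
  have 0: "(\<Sum>t\<in>{r, s, t, u}. ?c t *s kap t) = 0"
    using assms by (simp add: add_diff_eq diff_add_eq vec.scale_minus_left)
  have "card {r, s, t, u} \<le> Suc n" using assms(1) by (simp add: card_insert_if)
  note ind = kap_independent[OF _ this 0]
  show ?thesis
    using assms(2) ind[of r] ind[of s] ind[of t] ind[of u] by auto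
qed

lemma kap_nonzero [simp]: "kap t \<noteq> 0"
  using crd_kap[of 0 t] by auto

end

section \<open>Maps permuting the directions of the curve\<close>

text \<open>The arguments are ordered to match coordinates: for nodes \<open>T\<close> containing
  \<open>t\<close>, \<open>u\<close> but not \<open>x\<close>, \<open>y\<close>, this is the
  quotient of \<open>lc T t (kap x)\<close> by \<open>lc T t (kap y)\<close>, divided by the same
  quotient at \<open>u\<close>.\<close>

definition cross_ratio :: "'a::field \<Rightarrow> 'a \<Rightarrow> 'a \<Rightarrow> 'a \<Rightarrow> 'a" where
  "cross_ratio x y t u = ((x - u) / (y - u)) / ((x - t) / (y - t))"

text \<open>Cross ratios determine \<open>\<pi>\<close> only up to a fractional linear map after
  \<open>\<sigma>\<close>. What excludes a pole is that \<open>\<pi>\<close> is defined on all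
  finite parameters with finite values.\<close>

lemma cross_ratio_preserving_affine:
  fixes \<pi> :: "'a::{field,finite} \<Rightarrow> 'a"
  assumes \<pi>: "inj \<pi>" and \<sigma>: "field_automorphism \<sigma>"
    and cr: "\<And>x y t u. distinct [x, y, t, u] \<Longrightarrow>
      cross_ratio (\<pi> x) (\<pi> y) (\<pi> t) (\<pi> u) = \<sigma> (cross_ratio x y t u)"
  shows "\<pi> t = (\<pi> 1 - \<pi> 0) * \<sigma> t + \<pi> 0"
proof -
  \<comment> \<open>Projectively, \<open>\<rho>\<close> fixes \<open>0\<close> and exchanges
    \<open>1\<close> with infinity, and \<open>\<psi>\<close> is \<open>\<pi>\<close> normalised to
    fix \<open>0\<close> and \<open>1\<close>. With \<open>t = 1\<close> and \<open>u = 0\<close>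
    the cross ratio becomes \<open>\<rho> x / \<rho> y\<close>.\<close>
  define \<rho> :: "'a \<Rightarrow> 'a" where "\<rho> z = z / (z - 1)" for z
  define \<psi> where "\<psi> x = (\<pi> x - \<pi> 0) / (\<pi> 1 - \<pi> 0)" for x
  have d: "\<pi> 1 - \<pi> 0 \<noteq> 0" using inj_eq[OF \<pi>, of 1 0] by simp
  have \<rho>\<rho>: "\<rho> (\<rho> z) = z" if "z \<noteq> 1" for z
  proof -
    have "\<rho> z - 1 = 1 / (z - 1)" using that by (simp add: \<rho>_def field_simps)
    then have "\<rho> (\<rho> z) = \<rho> z * (z - 1)"
      unfolding \<rho>_def[of "\<rho> z"] by simp
    then show ?thesis using that by (simp add: \<rho>_def)
  qed
  have \<rho>01: "\<rho> z \<notin> {0, 1}" if "z \<notin> {0, 1}" for z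
    using that by (auto simp: \<rho>_def divide_eq_1_iff)
  have \<psi>01: "\<psi> x \<notin> {0, 1}" if "x \<notin> {0, 1}" for x
    using that d inj_eq[OF \<pi>] by (auto simp: \<psi>_def divide_eq_1_iff)
  have \<psi>1: "\<psi> x - 1 = (\<pi> x - \<pi> 1) / (\<pi> 1 - \<pi> 0)" for x
    using d by (simp add: \<psi>_def divide_simps)
  have ratio: "\<rho> (\<psi> x) / \<rho> (\<psi> y) = \<sigma> (\<rho> x) / \<sigma> (\<rho> y)" if "x \<notin> {0, 1}" "y \<notin> {0, 1}" for x y
  proof (cases "x = y")
    case True
    have "\<rho> (\<psi> x) \<noteq> 0" "\<rho> x \<noteq> 0" using \<rho>01[OF \<psi>01[OF that(1)]] \<rho>01[OF that(1)] by auto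
    then show ?thesis using True by (simp add: field_automorphism_simps[OF \<sigma>])
  next
    case False
    have \<rho>\<psi>: "\<rho> (\<psi> x) = (\<pi> x - \<pi> 0) / (\<pi> x - \<pi> 1)" for x
      using d by (simp add: \<rho>_def \<psi>1) (simp add: \<psi>_def)
    have "cross_ratio (\<pi> x) (\<pi> y) (\<pi> 1) (\<pi> 0) = \<sigma> (cross_ratio x y 1 0)"
      using that False by (intro cr) auto
    moreover have "cross_ratio (\<pi> x) (\<pi> y) (\<pi> 1) (\<pi> 0) = \<rho> (\<psi> x) / \<rho> (\<psi> y)"
      by (simp add: cross_ratio_def \<rho>\<psi>)
    moreover have "cross_ratio x y 1 0 = \<rho> x / \<rho> y"
      by (simp add: cross_ratio_def \<rho>_def)
    ultimately show ?thesis by (simp add: field_automorphism_divide[OF \<sigma>])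
  qed
  have \<rho>\<psi>: "\<rho> (\<psi> y) = \<sigma> (\<rho> y)" if y: "y \<notin> {0, 1}" for y
  proof -
    define k where "k = \<rho> (\<psi> y) / \<sigma> (\<rho> y)"
    have ne: "\<rho> (\<psi> y) \<noteq> 0" "\<sigma> (\<rho> y) \<noteq> 0"
      using \<rho>01[OF \<psi>01[OF y]] \<rho>01[OF y] by (auto simp: field_automorphism_simps[OF \<sigma>])
    then have "k \<noteq> 0" by (simp add: k_def)
    have k: "\<rho> (\<psi> x) = k * \<sigma> (\<rho> x)" if "x \<notin> {0, 1}" for x
      using ratio[OF that y] ne by (simp add: k_def divide_eq_eq)
    have "k = 1"
    proof (rule ccontr)
      assume "k \<noteq> 1"
      \<comment> \<open>At the argument \<open>\<rho> z\<close> the composite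
        \<open>\<rho> \<psi>\<close> would take the value \<open>1\<close>, which
        \<open>\<rho>\<close> takes only at infinity: this \<open>z\<close> locates the forbidden
        pole.\<close>
      obtain z where z: "\<sigma> z = 1 / k"
        using field_automorphism_bij[OF \<sigma>] by (metis bij_pointE)
      have z01: "z \<notin> {0, 1}"
        using z \<open>k \<noteq> 0\<close> \<open>k \<noteq> 1\<close> field_automorphism_0[OF \<sigma>] field_automorphism_1[OF \<sigma>] by auto
      then have "\<rho> (\<psi> (\<rho> z)) = k * \<sigma> (\<rho> (\<rho> z))" using k \<rho>01 by blast
      also have "\<dots> = 1" using z01 z \<open>k \<noteq> 0\<close> by (simp add: \<rho>\<rho>)
      finally show False using \<rho>01[OF \<psi>01[OF \<rho>01[OF z01]]] by simp
    qed
    then show ?thesis using ne by (simp add: k_def)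
  qed
  have "\<psi> t = \<sigma> t"
  proof (cases "t \<in> {0, 1}")
    case True
    then show ?thesis using d by (auto simp: \<psi>_def field_automorphism_simps[OF \<sigma>])
  next
    case False
    have "\<rho> (\<psi> t) = \<rho> (\<sigma> t)"
      using \<rho>\<psi>[OF False] by (simp add: \<rho>_def field_automorphism_simps[OF \<sigma>])
    moreover have "\<sigma> t \<noteq> 1" using False field_automorphism_eq_iff[OF \<sigma>, of t 1] field_automorphism_1[OF \<sigma>] by auto
    ultimately show ?thesis using \<rho>\<rho>[of "\<psi> t"] \<rho>\<rho>[of "\<sigma> t"] \<psi>01[OF False] by auto
  qed
  then show ?thesis using d by (simp add: \<psi>_def divide_eq_eq) (simp add: algebra_simps)
qed

context curve_coordinates
begin

text \<open>A direction outside the nodes moves all coordinates at once, while each image coordinate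
  depends only on the corresponding coordinate of the argument. Hence the increment along that
  direction cannot depend on the starting vector, and summing over a basis gives additivity.\<close>

lemma direction_preserving_additive:
  assumes g: "\<And>v. v \<in> H \<Longrightarrow> g v \<in> H" and \<pi>: "inj \<pi>"
    and step: "\<And>v a t. v \<in> H \<Longrightarrow> \<exists>b. g (v + a *s kap t) = g v + b *s kap (\<pi> t)"
    and v: "v \<in> H" and w: "w \<in> H"
  shows "g (v + w) = g v + (g w - g 0)"
proof -
  have cardpi: "card (\<pi> ` T) = Suc n" if "card T = Suc n" for T
    using that \<pi> by (simp add: card_image inj_on_subset)
  have coord: "lc (\<pi> ` T) (\<pi> t) (g v) = lc (\<pi> ` T) (\<pi> t) (g w)"
    if T: "card T = Suc n" "t \<in> T" and vw: "v \<in> H" "w \<in> H" "lc T t v = lc T t w" for T t v w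
  proof -
    \<comment> \<open>A step along a node direction other than \<open>t\<close> leaves the
      \<open>t\<close>-coordinate of the image unchanged.\<close>
    have *: "lc (\<pi> ` T) (\<pi> t) (g (v + (\<Sum>s\<in>S. c s *s kap s))) = lc (\<pi> ` T) (\<pi> t) (g v)"
      if "S \<subseteq> T - {t}" for S c
      using finite[of S] that
    proof (induction S)
      case (insert x S)
      let ?z = "v + (\<Sum>s\<in>S. c s *s kap s)"
      have "?z \<in> H" using vw by (intro H_closed H_sum) auto
      then obtain b where b: "g (?z + c x *s kap x) = g ?z + b *s kap (\<pi> x)"
        using step by blast
      have eq: "v + (\<Sum>s\<in>insert x S. c s *s kap s) = ?z + c x *s kap x"
        using insert by (simp add: add_ac)
      have "lc (\<pi> ` T) (\<pi> t) (kap (\<pi> x)) = 0"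
        using insert.prems T(2) inj_eq[OF \<pi>] by (subst lc_kap_nodes) (auto simp: cardpi[OF T(1)])
      then show ?case
        unfolding eq b lc_add lc_scale using insert by simp
    qed simp
    have "w - v = (\<Sum>s\<in>T. lc T s (w - v) *s kap s)"
      using lc_expand[OF T(1), of "w - v"] vw by simp
    also have "\<dots> = (\<Sum>s\<in>T - {t}. lc T s (w - v) *s kap s)"
      using T vw(3) by (subst sum.remove[of T t]) (auto simp: lc_diff)
    finally have "w = v + (\<Sum>s\<in>T - {t}. lc T s (w - v) *s kap s)"
      by (simp add: algebra_simps)
    with *[OF subset_refl, of "\<lambda>s. lc T s (w - v)"] show ?thesis by simp
  qed
  have one: "g (v + a *s kap x) = g v + (g (a *s kap x) - g 0)" if v: "v \<in> H" for v a x
  proof -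
    obtain T where T: "T \<inter> {x} = {}" "card T = Suc n"
      using extend_nodes[of "{}" "{x}"] by auto
    have "\<exists>t u. t \<in> T \<and> u \<in> T \<and> t \<noteq> u"
    proof (rule ccontr)
      assume "\<not> ?thesis"
      then have "card T \<le> 1" by (auto simp: card_le_Suc0_iff_eq)
      then show False using T n_ge_2 by simp
    qed
    then obtain t u where tu: "t \<in> T" "u \<in> T" "t \<noteq> u" by blast
    \<comment> \<open>\<open>v'\<close> shares its \<open>t\<close>-coordinate with \<open>v\<close>
      and its \<open>u\<close>-coordinate with \<open>0\<close>. It carries the increment from
      \<open>v\<close> to \<open>0\<close>, which need not have a coordinate in common; hence two
      nodes are used.\<close>
    define v' where "v' = lc T t v *s kap t"
    have v': "v' \<in> H" "lc T t v' = lc T t v" "lc T u v' = lc T u 0"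
      using T tu by (simp_all add: v'_def lc_scale lc_kap_nodes)
    obtain b1 where b1: "g (v + a *s kap x) = g v + b1 *s kap (\<pi> x)" using step v by blast
    obtain b2 where b2: "g (v' + a *s kap x) = g v' + b2 *s kap (\<pi> x)" using step v' by blast
    obtain b3 where b3: "g (0 + a *s kap x) = g 0 + b3 *s kap (\<pi> x)" using step H_closed(1) by blast
    have ne: "lc (\<pi> ` T) (\<pi> s) (kap (\<pi> x)) \<noteq> 0" if "s \<in> T" for s
      using that T by (intro lc_kap_nonzero) (auto simp: cardpi inj_eq[OF \<pi>])
    have "lc (\<pi> ` T) (\<pi> t) (g (v + a *s kap x)) = lc (\<pi> ` T) (\<pi> t) (g (v' + a *s kap x))"
      using T tu v v' by (intro coord) (auto simp: lc_add)
    moreover have "lc (\<pi> ` T) (\<pi> t) (g v) = lc (\<pi> ` T) (\<pi> t) (g v')"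
      using T tu v v' by (intro coord) auto
    ultimately have "b1 = b2"
      using ne[OF tu(1)] by (simp add: b1 b2 lc_add lc_scale)
    have "lc (\<pi> ` T) (\<pi> u) (g (v' + a *s kap x)) = lc (\<pi> ` T) (\<pi> u) (g (0 + a *s kap x))"
      using T tu v v' by (intro coord) (auto simp: lc_add)
    moreover have "lc (\<pi> ` T) (\<pi> u) (g v') = lc (\<pi> ` T) (\<pi> u) (g 0)"
      using T tu v v' by (intro coord) auto
    ultimately have "b2 = b3"
      using ne[OF tu(2)] by (simp only: b2 b3 lc_add lc_scale) simp
    then show ?thesis using b1 b3 \<open>b1 = b2\<close> by simp
  qed
  have many: "g (v + (\<Sum>s\<in>S. c s *s kap s)) = g v + (g (\<Sum>s\<in>S. c s *s kap s) - g 0)"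
    if "v \<in> H" for v S c
    using finite[of S]
  proof (induction S)
    case (insert x S)
    let ?z = "\<Sum>s\<in>S. c s *s kap s"
    have z: "?z \<in> H" by (intro H_sum) auto
    have "g (v + (\<Sum>s\<in>insert x S. c s *s kap s)) = g ((v + ?z) + c x *s kap x)"
      using insert by (simp add: add_ac)
    also have "\<dots> = g v + (g ?z - g 0) + (g (c x *s kap x) - g 0)"
      using one[of "v + ?z"] that z insert.IH by auto
    also have "\<dots> = g v + ((g ?z + (g (c x *s kap x) - g 0)) - g 0)"
      by simp
    also have "g ?z + (g (c x *s kap x) - g 0) = g (\<Sum>s\<in>insert x S. c s *s kap s)"
      using one[OF z, of "c x" x] insert by (simp add: add_ac)
    finally show ?case .
  qed simp
  obtain T :: "'a set" where T: "card T = Suc n"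
    using extend_nodes[of "{}" "{}"] by auto
  show ?thesis
    using many[OF v, of "\<lambda>s. lc T s w" T] unfolding lc_expand[OF T w] .
qed

lemma additive_sum:
  fixes f :: "'a ^ 'd \<Rightarrow> 'a ^ 'd"
  assumes "\<And>v w. v \<in> H \<Longrightarrow> w \<in> H \<Longrightarrow> f (v + w) = f v + f w" "\<And>x. x \<in> A \<Longrightarrow> u x \<in> H"
  shows "f (sum u A) = (\<Sum>x\<in>A. f (u x))"
proof -
  have "f 0 = f 0 + f 0" using assms(1)[of 0 0] by (simp add: H_def)
  then have "f 0 = 0" by (simp only: add_cancel_right_right)
  then show ?thesis
    using assms(2)
  proof (induction A rule: infinite_finite_induct)
    case (insert x A)
    then show ?case using assms(1)[of "u x" "sum u A"] by (simp add: H_sum)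
  qed auto
qed

text \<open>On each direction \<open>f\<close> is an additive scalar function \<open>S t\<close>.
  Expanding one curve vector in others ties these functions together tightly enough to make all of
  them semilinear for one \<open>\<sigma>\<close>.\<close>

lemma direction_preserving_semilinear:
  assumes add: "\<And>v w. v \<in> H \<Longrightarrow> w \<in> H \<Longrightarrow> f (v + w) = f v + f w"
    and \<pi>: "inj \<pi>"
    and f: "\<And>a t. \<exists>b. f (a *s kap t) = b *s kap (\<pi> t)"
    and inj: "\<And>v. v \<in> H \<Longrightarrow> f v = 0 \<Longrightarrow> v = 0"
  obtains \<sigma> where "field_automorphism \<sigma>" "\<And>t. \<pi> t = (\<pi> 1 - \<pi> 0) * \<sigma> t + \<pi> 0"
    "\<And>a v. v \<in> H \<Longrightarrow> f (a *s v) = \<sigma> a *s f v"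
proof -
  define S where "S t a = (SOME b. f (a *s kap t) = b *s kap (\<pi> t))" for t a
  have S: "f (a *s kap t) = S t a *s kap (\<pi> t)" for t a
    unfolding S_def using f by (rule someI_ex)
  have S_add: "S t (a + b) = S t a + S t b" for t a b
  proof -
    have "S t (a + b) *s kap (\<pi> t) = (S t a + S t b) *s kap (\<pi> t)"
      using add[of "a *s kap t" "b *s kap t"] by (simp add: S[symmetric] vec.scale_left_distrib)
    then show ?thesis by (simp add: vec.scale_cancel_right)
  qed
  have S_eq_0: "a = 0" if "S t a = 0" for t a
    using inj[of "a *s kap t"] S[of a t] that by (simp add: vec.scale_eq_0_iff)
  have S_0: "S t 0 = 0" for t using S_add[of t 0 0] by (metis add_0 add_cancel_right_right)
  have cardpi: "card (\<pi> ` T) = Suc n" if "card T = Suc n" for T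
    using that \<pi> by (simp add: card_image inj_on_subset)
  \<comment> \<open>The \<open>\<pi> t\<close>-coordinate of the image of \<open>a *s kap x\<close>,
    found once directly and once from the expansion over \<open>T\<close>.\<close>
  have key: "S t (a * lc T t (kap x)) = S x a * lc (\<pi> ` T) (\<pi> t) (kap (\<pi> x))"
    if T: "card T = Suc n" "t \<in> T" for T t x a
  proof -
    have "a *s kap x = (\<Sum>s\<in>T. (a * lc T s (kap x)) *s kap s)"
      using lc_expand[OF T(1), of "a *s kap x"] by (simp add: lc_scale)
    then have "f (a *s kap x) = (\<Sum>s\<in>T. S s (a * lc T s (kap x)) *s kap (\<pi> s))"
      using additive_sum[of f T, OF add] by (simp add: S)
    then have "S x a * lc (\<pi> ` T) (\<pi> t) (kap (\<pi> x))
        = (\<Sum>s\<in>T. S s (a * lc T s (kap x)) * lc (\<pi> ` T) (\<pi> t) (kap (\<pi> s)))"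
      by (simp only: S lc_scale[symmetric] lc_sum[symmetric])
    also have "\<dots> = (\<Sum>s\<in>T. if s = t then S s (a * lc T s (kap x)) else 0)"
      using T inj_eq[OF \<pi>] by (intro sum.cong) (auto simp: lc_kap_nodes cardpi)
    also have "\<dots> = S t (a * lc T t (kap x))" using T(2) by simp
    finally show ?thesis by simp
  qed
  \<comment> \<open>\<open>R t\<close> relates a multiplier of the argument of \<open>S t\<close> to
    the multiplier it produces on the value. The aim is to show that it is the graph of a field
    automorphism, the same for all \<open>t\<close>.\<close>
  define R where "R t = {(d, d'). \<forall>a. S t (a * d) = S t a * d'}" for t
  \<comment> \<open>With \<open>t\<close> a node and \<open>x\<close> not, the coordinate in
    \<open>key\<close> is nonzero, so \<open>S t\<close> and \<open>S x\<close> agree up to nonzero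
    rescaling and admit the same multipliers.\<close>
  have R_sub: "R x \<subseteq> R t" for x t
  proof (cases "x = t")
    case False
    then obtain T where T: "t \<in> T" "x \<notin> T" "card T = Suc n"
      using extend_nodes[of "{t}" "{x}"] by auto
    let ?L = "lc T t (kap x)"
    have L: "?L \<noteq> 0" using lc_kap_nonzero T by blast
    show ?thesis
    proof clarify
      fix d d' assume d: "(d, d') \<in> R x"
      have "S t (a * d) = S t a * d'" for a
      proof -
        have Sx: "S x (a / ?L * d) = S x (a / ?L) * d'"
          using d unfolding R_def by blast
        have "S t (a * d) = S t ((a / ?L * d) * ?L)" using L by simp
        also have "\<dots> = S x (a / ?L) * d' * lc (\<pi> ` T) (\<pi> t) (kap (\<pi> x))"
          unfolding key[OF T(3,1)] Sx ..
        also have "\<dots> = S t (a / ?L * ?L) * d'"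
          unfolding key[OF T(3,1)] by (simp add: mult_ac)
        finally show ?thesis using L by simp
      qed
      then show "(d, d') \<in> R t" by (simp add: R_def)
    qed
  qed simp
  have cr: "(cross_ratio x y t u, cross_ratio (\<pi> x) (\<pi> y) (\<pi> t) (\<pi> u)) \<in> R y"
    if dist: "distinct [x, y, t, u]" for x y t u
  proof -
    obtain T where T: "{t, u} \<subseteq> T" "T \<inter> {x, y} = {}" "card T = Suc n"
      using extend_nodes[of "{t, u}" "{x, y}"] dist n_ge_2 by (auto simp: card_insert_if)
    define m where "m s = lc T s (kap x) / lc T s (kap y)" for s
    define m' where "m' s = lc (\<pi> ` T) (\<pi> s) (kap (\<pi> x)) / lc (\<pi> ` T) (\<pi> s) (kap (\<pi> y))" for s
    have xyT: "x \<notin> T" "y \<notin> T" using T by auto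
    have \<pi>T: "\<pi> x \<notin> \<pi> ` T" "\<pi> y \<notin> \<pi> ` T"
      using T by (auto simp: inj_eq[OF \<pi>])
    have L: "lc T s (kap x) \<noteq> 0" "lc T s (kap y) \<noteq> 0"
      "lc (\<pi> ` T) (\<pi> s) (kap (\<pi> x)) \<noteq> 0" "lc (\<pi> ` T) (\<pi> s) (kap (\<pi> y)) \<noteq> 0" if "s \<in> T" for s
      using that T xyT \<pi>T by (simp_all add: lc_kap_nonzero cardpi)
    have m_eq: "lc U s (kap x) / lc U s (kap y)
        = (\<Prod>r\<in>U. (x - r) / (y - r)) / ((x - s) / (y - s))"
      if "card U = Suc n" "s \<in> U" "x \<notin> U" "y \<notin> U" for U s x y
    proof -
      have "(\<Prod>r\<in>U - {s}. (x - r) / (s - r)) / (\<Prod>r\<in>U - {s}. (y - r) / (s - r))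
          = (\<Prod>r\<in>U - {s}. (x - r) / (y - r))"
        unfolding prod_dividef[symmetric] by (intro prod.cong) auto
      moreover have "(\<Prod>r\<in>U. (x - r) / (y - r)) = (x - s) / (y - s) * (\<Prod>r\<in>U - {s}. (x - r) / (y - r))"
        using that by (intro prod.remove) auto
      moreover have "x - s \<noteq> 0" "y - s \<noteq> 0" using that by auto
      ultimately show ?thesis using that by (simp add: lc_kap)
    qed
    have P: "(\<Prod>r\<in>U. (x - r) / (y - r)) \<noteq> 0" if "x \<notin> U" "y \<notin> U" for U :: "'a set" and x y
      using that by auto
    have crm: "cross_ratio x y t u = m t / m u"
      using P[of x T y] T m_eq[of T _ x y] unfolding m_def by (simp add: cross_ratio_def mult_ac)
    have crm': "cross_ratio (\<pi> x) (\<pi> y) (\<pi> t) (\<pi> u) = m' t / m' u"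
      using P[of "\<pi> x" "\<pi> ` T" "\<pi> y"] T \<pi>T m_eq[of "\<pi> ` T" _ "\<pi> x" "\<pi> y"] cardpi
      unfolding m'_def by (simp add: cross_ratio_def mult_ac)
    \<comment> \<open>\<open>m\<close> and \<open>m'\<close> compare the coordinates of the two
      curve vectors before and after \<open>\<pi>\<close>. Using this at \<open>s = t\<close> and at
      \<open>s = u\<close> eliminates \<open>S x\<close> and leaves the two cross ratios.\<close>
    have mx: "S x a * m' s = S y (a * m s)" if s: "s \<in> T" for s a
    proof -
      have "S x a * lc (\<pi> ` T) (\<pi> s) (kap (\<pi> x)) = S s ((a * m s) * lc T s (kap y))"
        using L[OF s] key[OF T(3) s, of a x] by (simp add: m_def)
      also have "\<dots> = S y (a * m s) * lc (\<pi> ` T) (\<pi> s) (kap (\<pi> y))"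
        using key[OF T(3) s] by simp
      finally show ?thesis using L[OF s] by (simp add: m'_def divide_eq_eq)
    qed
    have tu: "t \<in> T" "u \<in> T" using T by auto
    have ne: "m u \<noteq> 0" "m' u \<noteq> 0" using L[OF tu(2)] by (auto simp: m_def m'_def)
    have "S y (a * (m t / m u)) = S y a * (m' t / m' u)" for a
    proof -
      have "S y (a * (m t / m u)) = S x (a / m u) * m' t"
        using mx[OF tu(1), of "a / m u"] by simp
      also have "S x (a / m u) = S y a / m' u"
        using mx[OF tu(2), of "a / m u"] ne by (simp add: eq_divide_eq)
      finally show ?thesis by simp
    qed
    then show ?thesis by (simp add: R_def crm crm')
  qed
  define M where "M = {d. \<exists>d'. (d, d') \<in> R 0}"
  have "M = UNIV"
  proof (rule subfield_eq_UNIV)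
    show "CARD('a) \<ge> 5" using card_ge n_ge_2 by simp
  next
    fix a b assume "a \<in> M" "b \<in> M"
    then obtain a' b' where ab: "(a, a') \<in> R 0" "(b, b') \<in> R 0" by (auto simp: M_def)
    then have "(a + b, a' + b') \<in> R 0" "(a * b, a' * b') \<in> R 0"
      by (auto simp: R_def ring_distribs S_add mult.assoc[symmetric])
    then show "a + b \<in> M" "a * b \<in> M" by (auto simp: M_def)
    show "a / b \<in> M" if "b \<noteq> 0"
    proof -
      have "b' \<noteq> 0"
        using ab(2) S_eq_0[of 0 b] that by (auto simp: R_def dest: spec[of _ 1])
      have "S 0 (c * (a / b)) = S 0 c * (a' / b')" for c
      proof -
        have "S 0 (c * (a / b)) * b' = S 0 (c * (a / b) * b)" using ab(2)
          unfolding R_def mem_Collect_eq case_prod_conv by metis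
        also have "\<dots> = S 0 c * a'" using ab that by (simp add: R_def)
        finally show ?thesis using \<open>b' \<noteq> 0\<close> by (simp add: eq_divide_eq)
      qed
      then have "(a / b, a' / b') \<in> R 0" unfolding R_def by blast
      then show ?thesis unfolding M_def by blast
    qed
  next
    fix a b :: 'a assume ab: "a \<notin> {0, 1}" "b \<notin> {0, 1}"
    show "a / b \<in> M"
    proof (cases "a = b")
      case True
      then have "(a / b, 1) \<in> R 0" using ab by (simp add: R_def)
      then show ?thesis by (auto simp: M_def)
    next
      case False
      \<comment> \<open>The map \<open>z / (z - 1)\<close> is its own inverse, so these two
        parameters together with \<open>1\<close> and \<open>0\<close> have cross ratio
        \<open>a / b\<close>.\<close>
      let ?x = "a / (a - 1)" and ?y = "b / (b - 1)"
      have x1: "?x - 1 = 1 / (a - 1)" "?y - 1 = 1 / (b - 1)"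
        using ab by (simp_all add: field_simps)
      then have "?x \<noteq> 1" "?y \<noteq> 1" "?x \<noteq> 0" "?y \<noteq> 0" using ab by auto
      moreover have "?x \<noteq> ?y"
      proof
        assume "?x = ?y"
        then have "1 / (a - 1) = 1 / (b - 1)" by (simp only: x1[symmetric])
        then show False using False ab by simp
      qed
      ultimately have "distinct [?x, ?y, 1, 0]" by auto
      from cr[OF this] have "cross_ratio ?x ?y 1 0 \<in> M"
        using R_sub unfolding M_def by blast
      moreover have "cross_ratio ?x ?y 1 0 = a / b"
        unfolding cross_ratio_def x1 using ab by simp
      ultimately show ?thesis by simp
    qed
  qed
  define \<sigma> where "\<sigma> d = S 0 d / S 0 1" for d
  have S1: "S 0 1 \<noteq> 0" using S_eq_0[of 0 1] by auto
  have R\<sigma>: "d' = \<sigma> d" if "(d, d') \<in> R t" for d d' t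
  proof -
    have "(d, d') \<in> R 0" using that R_sub by blast
    then have "S 0 (1 * d) = S 0 1 * d'" unfolding R_def by blast
    then show ?thesis using S1 by (simp add: \<sigma>_def)
  qed
  have \<sigma>R: "(d, \<sigma> d) \<in> R t" for d t
  proof -
    have "d \<in> M" using \<open>M = UNIV\<close> by simp
    then obtain d' where "(d, d') \<in> R 0" by (auto simp: M_def)
    then show ?thesis using R\<sigma> R_sub by blast
  qed
  have S\<sigma>: "S t (a * d) = S t a * \<sigma> d" for t a d
    using \<sigma>R[of d t] by (simp add: R_def)
  have \<sigma>_add: "\<sigma> (a + b) = \<sigma> a + \<sigma> b" for a b
    by (simp add: \<sigma>_def S_add add_divide_distrib)
  have \<sigma>_0: "\<sigma> a = 0 \<longleftrightarrow> a = 0" for a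
    using S1 S_eq_0[of 0 a] S_0 by (auto simp: \<sigma>_def)
  have "inj \<sigma>"
  proof (rule injI)
    fix a b assume "\<sigma> a = \<sigma> b"
    then have "\<sigma> (a - b) = 0" using \<sigma>_add[of "a - b" b] by simp
    then show "a = b" by (simp add: \<sigma>_0)
  qed
  then have "bij \<sigma>" by (simp add: bij_def finite_UNIV_inj_surj)
  moreover have "\<sigma> (a * b) = \<sigma> a * \<sigma> b" for a b
    using S\<sigma>[of 0 a b] by (simp add: \<sigma>_def)
  ultimately have \<sigma>: "field_automorphism \<sigma>"
    using \<sigma>_add by (simp add: field_automorphism_def)
  show ?thesis
  proof
    show "field_automorphism \<sigma>" by fact
    show "\<pi> t = (\<pi> 1 - \<pi> 0) * \<sigma> t + \<pi> 0" for t
      using \<pi> \<sigma> R\<sigma>[OF cr] by (rule cross_ratio_preserving_affine)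
    fix a v assume v: "v \<in> H"
    obtain T :: "'a set" where T: "card T = Suc n" using extend_nodes[of "{}" "{}"] by auto
    have "f (a *s v) = f (\<Sum>s\<in>T. (a * lc T s v) *s kap s)"
      using lc_expand[OF T, of "a *s v"] v by (simp add: lc_scale)
    also have "\<dots> = (\<Sum>s\<in>T. S s (lc T s v * a) *s kap (\<pi> s))"
      using additive_sum[of f T, OF add] by (simp add: S mult.commute)
    also have "\<dots> = \<sigma> a *s (\<Sum>s\<in>T. f (lc T s v *s kap s))"
      by (simp add: S\<sigma> S vec.scale_sum_right mult.commute[of "\<sigma> a"])
    also have "(\<Sum>s\<in>T. f (lc T s v *s kap s)) = f (\<Sum>s\<in>T. lc T s v *s kap s)"
      by (rule additive_sum[of f T, OF add, symmetric]) auto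
    also have "\<dots> = f v"
      by (simp only: lc_expand[OF T v])
    finally show "f (a *s v) = \<sigma> a *s f v" .
  qed
qed

end

section \<open>Points and lines as vectors\<close>

lemma in_span_singleton_iff: "x \<in> vec.span {y :: 'a::field ^ 'd} \<longleftrightarrow> (\<exists>c. x = c *s y)"
  by (auto simp: vec.span_singleton)

lemma in_span_pair_iff: "x \<in> vec.span {y, z :: 'a::field ^ 'd} \<longleftrightarrow> (\<exists>a b. x = a *s y + b *s z)"
proof
  assume "x \<in> vec.span {y, z}"
  then obtain a b where "x - a *s y = b *s z"
    by (auto simp: vec.span_insert[of y] vec.span_singleton)
  then have "x = a *s y + b *s z" by (simp add: algebra_simps)
  then show "\<exists>a b. x = a *s y + b *s z" by blast
next
  assume "\<exists>a b. x = a *s y + b *s z"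
  then show "x \<in> vec.span {y, z}"
    by clarify (intro vec.span_add vec.span_scale vec.span_base; simp)
qed

lemma span_singleton_scale:
  "c \<noteq> 0 \<Longrightarrow> vec.span {c *s x} = vec.span {x :: 'a::field ^ 'd}"
proof -
  assume c: "c \<noteq> 0"
  have "x = (1 / c) *s (c *s x)" using c by simp
  then have "x \<in> vec.span {c *s x}" unfolding in_span_singleton_iff by blast
  moreover have "c *s x \<in> vec.span {x}" unfolding in_span_singleton_iff by blast
  ultimately show ?thesis
    by (intro equalityI vec.span_minimal) auto
qed

lemma proj_points_iff: "P \<in> proj_points \<longleftrightarrow> (\<exists>x :: 'a::field ^ 'd. x \<noteq> 0 \<and> P = vec.span {x})"
proof
  assume "P \<in> proj_points"
  then have P: "vec.subspace P" "vec.dim P = 1" by (auto simp: proj_points_def)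
  obtain A where A: "A \<subseteq> P" "vec.independent A" "P \<subseteq> vec.span A" "card A = vec.dim P"
    using vec.basis_exists by blast
  then obtain x where x: "A = {x}" using P(2) by (auto simp: card_1_singleton_iff)
  have "P = vec.span {x}" using A P vec.span_minimal x by blast
  moreover have "x \<noteq> 0" using A(2) x vec.dependent_zero by blast
  ultimately show "\<exists>x. x \<noteq> 0 \<and> P = vec.span {x}" by blast
next
  assume "\<exists>x. x \<noteq> 0 \<and> P = vec.span {x}"
  then obtain x where x: "x \<noteq> 0" "P = vec.span {x}" by blast
  have "vec.independent {x}"
    using x vec.independent_insertI[of x "{}"] by (simp add: vec.independent_empty)
  then have "vec.dim (vec.span {x}) = 1"
    using vec.dim_eq_card_independent[of "{x}"] by (simp add: vec.dim_span)
  then show "P \<in> proj_points" using x by (simp add: proj_points_def)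
qed

context curve_coordinates
begin

text \<open>An affine point has exactly one representative of height \<open>1\<close>, so
  subtracting \<open>e\<close> identifies affine points with vectors of \<open>H\<close> and lines
  with cosets.\<close>

definition apoint :: "'a ^ 'd \<Rightarrow> ('a ^ 'd) set" where "apoint v = vec.span {e + v}"
definition aline :: "'a ^ 'd \<Rightarrow> 'a \<Rightarrow> ('a ^ 'd) set" where "aline v t = vec.span {e + v, kap t}"

abbreviation \<Gamma> :: "('a ^ 'd) set ugraph" where "\<Gamma> \<equiv> Gamma H K"

lemma subspace_H: "vec.subspace H"
  by (simp add: vec.subspace_def)

lemma ht_H [simp]: "v \<in> H \<Longrightarrow> ht v = 0"
  by (simp add: H_def)

lemma e_plus_nonzero: "v \<in> H \<Longrightarrow> e + v \<noteq> 0"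
proof
  assume "v \<in> H" "e + v = 0"
  then have "ht (e + v) = 0" by simp
  then show False using \<open>v \<in> H\<close> by simp
qed

lemma normalise:
  assumes "ht x \<noteq> 0"
  obtains v where "v \<in> H" "x = ht x *s (e + v)"
proof
  show "(1 / ht x) *s x - e \<in> H" using assms by (simp add: H_def del: ht_H)
  have "ht x *s (e + ((1 / ht x) *s x - e)) = x" using assms by simp
  then show "x = ht x *s (e + ((1 / ht x) *s x - e))" by (rule sym)
qed

lemma affine_points_eq: "affine_points H = apoint ` H"
proof (intro equalityI subsetI)
  fix P assume "P \<in> affine_points H"
  then obtain x where x: "x \<noteq> 0" "P = vec.span {x}" "\<not> P \<subseteq> H"
    by (auto simp: affine_points_def proj_points_iff)
  have hx: "ht x \<noteq> 0"
  proof
    assume "ht x = 0"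
    then have "{x} \<subseteq> H" by (simp add: H_def del: ht_H)
    then show False using x vec.span_minimal subspace_H by blast
  qed
  then obtain v where v: "v \<in> H" "x = ht x *s (e + v)" by (rule normalise)
  have "vec.span {x} = apoint v" unfolding apoint_def using span_singleton_scale[OF hx, of "e + v"] v(2) by simp
  then show "P \<in> apoint ` H" using v x by blast
next
  fix P assume "P \<in> apoint ` H"
  then obtain v where v: "v \<in> H" "P = apoint v" by blast
  have "e + v \<in> P" by (simp add: v apoint_def vec.span_base)
  moreover have "e + v \<notin> H" using v by (simp add: H_def del: ht_H)
  moreover have "P \<in> proj_points"
    using v e_plus_nonzero by (auto simp: apoint_def proj_points_iff)
  ultimately show "P \<in> affine_points H"
    by (auto simp: affine_points_def)
qed

lemma independent_aline: "v \<in> H \<Longrightarrow> vec.independent {e + v, kap t}"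
proof (rule vec.independent_insertI)
  assume v: "v \<in> H"
  show "e + v \<notin> vec.span {kap t}"
  proof
    assume "e + v \<in> vec.span {kap t}"
    then obtain c where "e + v = c *s kap t" by (auto simp: in_span_singleton_iff)
    then have "ht (e + v) = ht (c *s kap t)" by simp
    then show False using v by simp
  qed
  show "vec.independent {kap t}" using vec.independent_insertI[of "kap t" "{}"] by (simp add: vec.independent_empty)
qed

lemma dim_aline: "v \<in> H \<Longrightarrow> vec.dim (aline v t) = 2"
proof -
  assume v: "v \<in> H"
  have "e + v \<noteq> kap t"
  proof
    assume "e + v = kap t"
    then have "ht (e + v) = ht (kap t)" by simp
    then show False using v by simp
  qed
  then show ?thesis
    using vec.dim_eq_card_independent[OF independent_aline[OF v]] by (simp add: aline_def vec.dim_span)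
qed

lemma affine_lines_eq: "affine_lines_through H K = {aline v t | v t. v \<in> H}"
proof (intro equalityI subsetI)
  fix L assume "L \<in> affine_lines_through H K"
  then obtain t where L: "vec.subspace L" "vec.dim L = 2" "\<not> L \<subseteq> H" "vec.span {kap t} \<subseteq> L"
    by (auto simp: affine_lines_through_def proj_lines_def K_def)
  then obtain x where x: "x \<in> L" "ht x \<noteq> 0" by (auto simp: H_def simp del: ht_H)
  then obtain v where v: "v \<in> H" "x = ht x *s (e + v)" using normalise by blast
  have "(1 / ht x) *s x = (1 / ht x) *s (ht x *s (e + v))" by (rule arg_cong[OF v(2)])
  also have "\<dots> = e + v" using x(2) by simp
  finally have "e + v \<in> L" using vec.subspace_scale[OF L(1) x(1)] by metis
  moreover have "kap t \<in> L" using L(4) vec.span_base by blast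
  ultimately have "aline v t \<subseteq> L" unfolding aline_def using L(1) by (intro vec.span_minimal) auto
  then have "aline v t = L"
    using L dim_aline[OF v(1)] by (intro vec.subspace_dim_equal) (auto simp: aline_def)
  then show "L \<in> {aline v t | v t. v \<in> H}" using v by blast
next
  fix L assume "L \<in> {aline v t | v t. v \<in> H}"
  then obtain v t where v: "v \<in> H" "L = aline v t" by blast
  have "e + v \<in> L" by (simp add: v aline_def vec.span_base)
  moreover have "e + v \<notin> H" using v by (simp add: H_def del: ht_H)
  moreover have "vec.span {kap t} \<subseteq> L" unfolding v aline_def by (intro vec.span_mono) auto
  moreover have "L \<in> proj_lines" using dim_aline v by (simp add: proj_lines_def aline_def)
  ultimately show "L \<in> affine_lines_through H K"
    by (auto simp: affine_lines_through_def K_def)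
qed

lemma apoint_eq_iff [simp]: "v \<in> H \<Longrightarrow> w \<in> H \<Longrightarrow> apoint v = apoint w \<longleftrightarrow> v = w"
proof
  assume vw: "v \<in> H" "w \<in> H" "apoint v = apoint w"
  then have "e + v \<in> vec.span {e + w}" unfolding apoint_def using vec.span_base[of "e + v" "{e + v}"] by simp
  then obtain c where c: "e + v = c *s (e + w)" by (auto simp: in_span_singleton_iff)
  then have "ht (e + v) = ht (c *s (e + w))" by simp
  then have "c = 1" using vw by simp
  then show "v = w" using c by simp
qed simp

lemma apoint_subset_aline_iff: "v \<in> H \<Longrightarrow> w \<in> H \<Longrightarrow> apoint w \<subseteq> aline v t \<longleftrightarrow> (\<exists>c. w = v + c *s kap t)"
proof
  assume vw: "v \<in> H" "w \<in> H" "apoint w \<subseteq> aline v t"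
  then have "e + w \<in> vec.span {e + v, kap t}"
    unfolding apoint_def aline_def using vec.span_base[of "e + w" "{e + w}"] by auto
  then obtain a b where ab: "e + w = a *s (e + v) + b *s kap t" by (auto simp: in_span_pair_iff)
  then have "ht (e + w) = ht (a *s (e + v) + b *s kap t)" by simp
  then have "a = 1" using vw by simp
  then have "w = v + b *s kap t" using ab by (simp add: add.assoc)
  then show "\<exists>c. w = v + c *s kap t" by blast
next
  assume "\<exists>c. w = v + c *s kap t"
  then obtain c where "e + w = 1 *s (e + v) + c *s kap t" by (auto simp: add.assoc)
  then have "e + w \<in> aline v t" unfolding aline_def in_span_pair_iff by blast
  then show "apoint w \<subseteq> aline v t" unfolding apoint_def by (intro vec.span_minimal) (auto simp: aline_def)
qed

text \<open>Vectors of height \<open>0\<close> on a line are multiples of its curve vector, so the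
  line determines its direction.\<close>

lemma aline_eq_iff:
  assumes "v \<in> H" "w \<in> H"
  shows "aline v t = aline w s \<longleftrightarrow> t = s \<and> (\<exists>c. w = v + c *s kap t)"
proof
  assume eq: "aline v t = aline w s"
  have "apoint w \<subseteq> aline w s" using apoint_subset_aline_iff[OF assms(2,2)] by (metis add.right_neutral vec.scale_zero_left)
  then have c: "\<exists>c. w = v + c *s kap t" using eq apoint_subset_aline_iff assms by metis
  have "kap s \<in> aline v t" unfolding eq unfolding aline_def by (intro vec.span_base) simp
  then obtain a b where ab: "kap s = a *s (e + v) + b *s kap t" by (auto simp: aline_def in_span_pair_iff)
  then have "ht (kap s) = ht (a *s (e + v) + b *s kap t)" by simp
  then have "a = 0" using assms by simp
  then have "1 *s kap s = b *s kap t" using ab by simp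
  then have "t = s" using kap_independent2[of s t 1 b] by auto
  then show "t = s \<and> (\<exists>c. w = v + c *s kap t)" using c by blast
next
  assume "t = s \<and> (\<exists>c. w = v + c *s kap t)"
  then obtain c where c: "t = s" "w = v + c *s kap t" by blast
  have "e + w = 1 *s (e + v) + c *s kap t" "e + v = 1 *s (e + w) + (- c) *s kap t"
    using c by (simp_all add: add.assoc vec.scale_minus_left)
  then have "e + w \<in> aline v t" "e + v \<in> aline w t" unfolding aline_def in_span_pair_iff by blast+
  then show "aline v t = aline w s"
    unfolding c(1)[symmetric] by (intro equalityI; unfold aline_def; intro vec.span_minimal) (auto intro: vec.span_base)
qed

lemma aline_shift [simp]: "v \<in> H \<Longrightarrow> aline (v + c *s kap t) t = aline v t"
  using aline_eq_iff[of v "v + c *s kap t" t t] by auto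

lemma apoint_neq_aline [simp]: "v \<in> H \<Longrightarrow> w \<in> H \<Longrightarrow> apoint v \<noteq> aline w t" "v \<in> H \<Longrightarrow> w \<in> H \<Longrightarrow> aline w t \<noteq> apoint v"
proof -
  show "apoint v \<noteq> aline w t" if "v \<in> H" "w \<in> H"
  proof
    assume "apoint v = aline w t"
    moreover have "vec.dim (apoint v) = 1"
      using that affine_points_eq by (auto simp: affine_points_def proj_points_def)
    ultimately show False using dim_aline that by simp
  qed
  then show "aline w t \<noteq> apoint v" if "v \<in> H" "w \<in> H" using that by metis
qed

lemma verts_eq: "verts \<Gamma> = apoint ` H \<union> {aline v t | v t. v \<in> H}"
  by (simp add: Gamma_def affine_points_eq affine_lines_eq)

text \<open>A line can be re-anchored at any of its affine points, so the two ends of an edge may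
  share the same \<open>v\<close>.\<close>

lemma edges_eq: "edges \<Gamma> = {{apoint v, aline v t} | v t. v \<in> H}"
proof -
  have "edges \<Gamma> = {{P, L} | P L. P \<in> apoint ` H \<and> L \<in> {aline v t | v t. v \<in> H} \<and> P \<subseteq> L}"
    by (simp add: Gamma_def affine_points_eq affine_lines_eq)
  also have "\<dots> = {{apoint v, aline v t} | v t. v \<in> H}"
  proof (intro equalityI subsetI)
    fix E assume "E \<in> {{P, L} | P L. P \<in> apoint ` H \<and> L \<in> {aline v t | v t. v \<in> H} \<and> P \<subseteq> L}"
    then obtain w v t where E: "E = {apoint w, aline v t}" "w \<in> H" "v \<in> H" "apoint w \<subseteq> aline v t" by blast
    then obtain c where "w = v + c *s kap t" using apoint_subset_aline_iff by blast
    then have "E = {apoint w, aline w t}" using E by simp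
    then show "E \<in> {{apoint v, aline v t} | v t. v \<in> H}" using E(2) by blast
  next
    fix E assume "E \<in> {{apoint v, aline v t} | v t. v \<in> H}"
    then obtain v t where E: "E = {apoint v, aline v t}" "v \<in> H" by blast
    have "v = v + 0 *s kap t" by simp
    then have "apoint v \<subseteq> aline v t" using apoint_subset_aline_iff[OF E(2,2)] by blast
    then show "E \<in> {{P, L} | P L. P \<in> apoint ` H \<and> L \<in> {aline v t | v t. v \<in> H} \<and> P \<subseteq> L}"
      using E by blast
  qed
  finally show ?thesis .
qed

lemma edge_apoint_iff:
  assumes "v \<in> H" "X \<in> verts \<Gamma>"
  shows "{apoint v, X} \<in> edges \<Gamma> \<longleftrightarrow> (\<exists>t. X = aline v t)"
proof
  assume "{apoint v, X} \<in> edges \<Gamma>"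
  then obtain w t where w: "{apoint v, X} = {apoint w, aline w t}" "w \<in> H" unfolding edges_eq by blast
  then show "\<exists>t. X = aline v t" using assms by (auto simp: doubleton_eq_iff)
qed (use assms in \<open>auto simp: edges_eq\<close>)

lemma edge_aline_iff:
  assumes "v \<in> H" "X \<in> verts \<Gamma>"
  shows "{X, aline v t} \<in> edges \<Gamma> \<longleftrightarrow> (\<exists>c. X = apoint (v + c *s kap t))"
proof
  assume "{X, aline v t} \<in> edges \<Gamma>"
  then obtain w s where w: "{X, aline v t} = {apoint w, aline w s}" "w \<in> H" unfolding edges_eq by blast
  then have "X = apoint w" "aline v t = aline w s" using assms by (auto simp: doubleton_eq_iff)
  then show "\<exists>c. X = apoint (v + c *s kap t)" using aline_eq_iff[OF assms(1) w(2)] by auto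
next
  assume "\<exists>c. X = apoint (v + c *s kap t)"
  then obtain c where c: "X = apoint (v + c *s kap t)" by blast
  have "{X, aline v t} = {apoint (v + c *s kap t), aline (v + c *s kap t) t}" using c assms by simp
  moreover have "v + c *s kap t \<in> H" using assms by blast
  ultimately show "{X, aline v t} \<in> edges \<Gamma>" unfolding edges_eq by blast
qed

lemma verts_cases:
  assumes "X \<in> verts \<Gamma>"
  obtains v where "v \<in> H" "X = apoint v" | v t where "v \<in> H" "X = aline v t"
  using assms unfolding verts_eq by blast

lemma apoint_verts [simp, intro]: "v \<in> H \<Longrightarrow> apoint v \<in> verts \<Gamma>"
  and aline_verts [simp, intro]: "v \<in> H \<Longrightarrow> aline v t \<in> verts \<Gamma>"
  by (auto simp: verts_eq)

lemma edge_apoint_aline [simp]: "v \<in> H \<Longrightarrow> {apoint v, aline v t} \<in> edges \<Gamma>"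
  by (auto simp: edges_eq)

lemma edge_apoint_aline_shift [simp]: "v \<in> H \<Longrightarrow> {apoint (v + c *s kap t), aline v t} \<in> edges \<Gamma>"
  using edge_aline_iff[of v "apoint (v + c *s kap t)" t] by auto

lemma edge_aline_apoint [simp]: "v \<in> H \<Longrightarrow> {aline v t, apoint v} \<in> edges \<Gamma>"
  and edge_aline_apoint_shift [simp]: "v \<in> H \<Longrightarrow> {aline v t, apoint (v + c *s kap t)} \<in> edges \<Gamma>"
  by (simp_all add: insert_commute[of "aline v t"])

section \<open>Automorphisms permute the parallel classes of lines\<close>

text \<open>For \<open>n \<ge> 3\<close> two decompositions with different pairs of directions give
  a relation among three or four distinct curve vectors. In a plane two such pairs may be disjoint
  but cannot share just one direction, so the pairs partition the \<open>q\<close>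
  directions.\<close>

lemma few_decompositions:
  fixes r r' c d :: "'a \<Rightarrow> 'a"
  assumes r: "inj r" and ne: "\<And>a. r a \<noteq> r' a" "\<And>a. c a \<noteq> 0" "\<And>a. d a \<noteq> 0"
    and D: "\<And>a. D = c a *s kap (r a) + d a *s kap (r' a)"
  shows False
proof -
  have surj: "\<exists>b. x = r b" for x
    using r finite_UNIV_inj_surj[of r] by (metis finite surjD)
  show False
  proof (cases "n \<ge> 3")
    case True
    have "card {r 0, r' 0} < CARD('a)" using card_ge by (simp add: card_insert_if)
    then obtain x where x: "x \<notin> {r 0, r' 0}" using ex_notin by blast
    then obtain b where b: "r b \<notin> {r 0, r' 0}" using surj by metis
    have eq: "c 0 *s kap (r 0) + d 0 *s kap (r' 0) = c b *s kap (r b) + d b *s kap (r' b)"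
      using D[of 0] D[of b] by simp
    consider "r' b = r 0" | "r' b = r' 0" | "r' b \<noteq> r 0" "r' b \<noteq> r' 0"
      by blast
    then show False
    proof cases
      case 1
      then have "(c 0 - d b) *s kap (r 0) + d 0 *s kap (r' 0) = c b *s kap (r b)"
        using eq by (simp add: vec.scale_left_diff_distrib algebra_simps)
      then show False
        using kap_independent3[of "r 0" "r' 0" "r b" "c 0 - d b" "d 0" "c b"] b ne(1)[of 0] ne(2)[of b] by auto
    next
      case 2
      then have "c 0 *s kap (r 0) + (d 0 - d b) *s kap (r' 0) = c b *s kap (r b)"
        using eq by (simp add: vec.scale_left_diff_distrib algebra_simps)
      then show False
        using kap_independent3[of "r 0" "r' 0" "r b" "c 0" "d 0 - d b" "c b"] b ne(1)[of 0] ne(2)[of b] by auto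
    next
      case 3
      then have "distinct [r 0, r' 0, r b, r' b]"
        using b ne(1)[of 0] ne(1)[of b] by auto
      then show False using kap_independent4[OF True _ eq] ne(2)[of 0] by blast
    qed
  next
    case False
    then have odd: "odd CARD('a)" using parity by blast
    define \<tau> where "\<tau> x = r' (inv_into UNIV r x)" for x
    have \<tau>: "\<tau> (r a) = r' a" for a
      using r by (simp add: \<tau>_def)
    have "\<tau> (\<tau> x) = x \<and> \<tau> x \<noteq> x" for x
    proof -
      obtain a where a: "x = r a" using surj by blast
      \<comment> \<open>The second direction of one decomposition is the first direction of another;
        unless the latter ends in \<open>r a\<close>, three distinct curve vectors are
        dependent.\<close>
      obtain b where b: "r' a = r b" using surj by blast
      have "r' b = r a"
      proof (rule ccontr)
        assume "r' b \<noteq> r a"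
        then have dist: "distinct [r a, r b, r' b]" using b ne(1)[of a] ne(1)[of b] by auto
        have "c a *s kap (r a) + d a *s kap (r b) = c b *s kap (r b) + d b *s kap (r' b)"
          using D[of a] D[of b] b by simp
        then have "c a *s kap (r a) + (d a - c b) *s kap (r b) = d b *s kap (r' b)"
          by (simp add: vec.scale_left_diff_distrib algebra_simps)
        then show False using kap_independent3[OF dist] ne(2)[of a] by blast
      qed
      then show ?thesis using a b \<tau>[of a] \<tau>[of b] ne(1)[of a] by auto
    qed
    then have "even CARD('a)" by (intro even_card_involution[of UNIV \<tau>]) auto
    then show False using odd by simp
  qed
qed

context
  fixes f assumes f: "f \<in> automorphisms \<Gamma>"
begin

lemma automorphism_verts [simp]: "X \<in> verts \<Gamma> \<Longrightarrow> f X \<in> verts \<Gamma>"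
  using f by (auto simp: automorphisms_def Bij_def bij_betw_def)

lemma automorphism_eq_iff: "X \<in> verts \<Gamma> \<Longrightarrow> Y \<in> verts \<Gamma> \<Longrightarrow> f X = f Y \<longleftrightarrow> X = Y"
  using f by (auto simp: automorphisms_def Bij_def bij_betw_def inj_on_eq_iff)

lemma automorphism_edge: "X \<in> verts \<Gamma> \<Longrightarrow> Y \<in> verts \<Gamma> \<Longrightarrow> {X, Y} \<in> edges \<Gamma> \<Longrightarrow> {f X, f Y} \<in> edges \<Gamma>"
  using f by (auto simp: automorphisms_def)

text \<open>Follow the path from the line through one of its points, along a transversal, to a
  parallel line. If the first line became a point, the classes would be exchanged all along the
  path, and the image would write a fixed difference of two points as a sum of two curve multiples,
  once for each of the \<open>q\<close> transversals.\<close>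

lemma automorphism_line_neq_point:
  assumes v: "v \<in> H" and u: "u \<in> H"
  shows "f (aline v t) \<noteq> apoint u"
proof
  assume fu: "f (aline v t) = apoint u"
  have "card {t} < CARD('a)" using card_ge by simp
  then obtain s where s: "s \<noteq> t" using ex_notin[of "{t}"] by blast
  \<comment> \<open>The points of the first line; direction \<open>s\<close> joins them to the
    parallel line through \<open>v + kap s\<close>.\<close>
  define p where "p a = v + a *s kap t" for a
  have p: "p a \<in> H" "p a + kap s \<in> H" "v + kap s \<in> H" for a using v by (auto simp: p_def)
  have ps: "p a + kap s = (v + kap s) + a *s kap t" "p a + kap s = p a + 1 *s kap s" for a
    by (simp_all add: p_def add_ac)
  have "{apoint u, f (apoint (p a))} \<in> edges \<Gamma>" for a
    using automorphism_edge[of "aline v t" "apoint (p a)"] p v fu by (simp add: p_def)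
  then have "\<exists>r. f (apoint (p a)) = aline u r" for a
    using edge_apoint_iff[OF u] p by simp
  then obtain r where r: "\<And>a. f (apoint (p a)) = aline u (r a)" by metis
  have "{f (aline (p a) s), aline u (r a)} \<in> edges \<Gamma>" for a
    using automorphism_edge[of "aline (p a) s" "apoint (p a)"] p by (simp add: r)
  then have "\<exists>c. f (aline (p a) s) = apoint (u + c *s kap (r a))" for a
    using edge_aline_iff[OF u] p by simp
  then obtain c where c: "\<And>a. f (aline (p a) s) = apoint (u + c a *s kap (r a))" by metis
  have y: "u + c a *s kap (r a) \<in> H" for a using u by auto
  have "{apoint (u + c a *s kap (r a)), f (apoint (p a + kap s))} \<in> edges \<Gamma>" for a
    using automorphism_edge[of "aline (p a) s" "apoint (p a + kap s)"] edge_aline_apoint_shift[OF p(1), of a s 1] p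
    by (simp add: c)
  then have "\<exists>r'. f (apoint (p a + kap s)) = aline (u + c a *s kap (r a)) r'" for a
    using edge_apoint_iff[OF y] p by simp
  then obtain r' where r': "\<And>a. f (apoint (p a + kap s)) = aline (u + c a *s kap (r a)) (r' a)" by metis
  have "{f (aline (v + kap s) t), aline (u + c a *s kap (r a)) (r' a)} \<in> edges \<Gamma>" for a
    using automorphism_edge[of "aline (v + kap s) t" "apoint (p a + kap s)"] edge_aline_apoint_shift[OF p(3), of t a] p
    by (simp add: r'[symmetric] ps(1))
  then have "\<exists>d. f (aline (v + kap s) t) = apoint (u + c a *s kap (r a) + d *s kap (r' a))" for a
    using edge_aline_iff[OF y] p by simp
  then obtain d where d: "\<And>a. f (aline (v + kap s) t) = apoint (u + c a *s kap (r a) + d a *s kap (r' a))" by metis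
  \<comment> \<open>All the expressions in \<open>d\<close> describe the image of the same parallel
    line, so they are one vector.\<close>
  define u' where "u' = u + c 0 *s kap (r 0) + d 0 *s kap (r' 0)"
  have u': "u' \<in> H" using u by (auto simp: u'_def)
  have u'_eq: "u' = u + c a *s kap (r a) + d a *s kap (r' a)" for a
    using d[of a] d[of 0] y[of a] y[of 0] by (simp add: u'_def H_closed)
  have aline_s: "aline (p a) s \<noteq> aline w t" if "w \<in> H" for a w
    using aline_eq_iff[OF p(1) that] s by blast
  show False
  proof (rule few_decompositions)
    show "inj r"
    proof (rule injI)
      fix a b assume "r a = r b"
      then have "f (apoint (p a)) = f (apoint (p b))" by (simp add: r)
      then have "p a = p b" using p automorphism_eq_iff by simp
      then show "a = b" by (simp add: p_def vec.scale_cancel_right)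
    qed
    show "r a \<noteq> r' a" for a
    proof
      assume "r a = r' a"
      then have "f (apoint (p a)) = f (apoint (p a + kap s))" using u by (simp add: r r')
      then have "p a = p a + kap s" using p automorphism_eq_iff by simp
      then show False by simp
    qed
    show "c a \<noteq> 0" for a
    proof
      assume "c a = 0"
      then have "f (aline (p a) s) = f (aline v t)" by (simp add: c fu)
      then show False using p v automorphism_eq_iff aline_s by simp
    qed
    show "d a \<noteq> 0" for a
    proof
      assume "d a = 0"
      then have "f (aline (p a) s) = f (aline (v + kap s) t)" using d[of a] by (simp add: c)
      then show False using p v automorphism_eq_iff aline_s by simp
    qed
    show "u' - u = c a *s kap (r a) + d a *s kap (r' a)" for a
      using u'_eq[of a] by (simp add: add.assoc)
  qed
qed

lemma automorphism_line: "v \<in> H \<Longrightarrow> \<exists>w t'. w \<in> H \<and> f (aline v t) = aline w t'"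
  using automorphism_verts[OF aline_verts, of v t] automorphism_line_neq_point[of v _ t] by (metis verts_cases)

lemma automorphism_point: "v \<in> H \<Longrightarrow> \<exists>w. w \<in> H \<and> f (apoint v) = apoint w"
proof -
  assume v: "v \<in> H"
  obtain w t where w: "w \<in> H" "f (aline v 0) = aline w t" using automorphism_line[OF v] by blast
  have "{f (apoint v), aline w t} \<in> edges \<Gamma>" using automorphism_edge[of "apoint v" "aline v 0"] v w(2) by simp
  then obtain c where "f (apoint v) = apoint (w + c *s kap t)" using edge_aline_iff[OF w(1)] v by auto
  moreover have "w + c *s kap t \<in> H" using w by blast
  ultimately show ?thesis by blast
qed

text \<open>The direction of an image line might depend on the line and not only on its direction.
  It is shown not to change under a step along a curve direction, and such steps connect all vectors
  of \<open>H\<close>.\<close>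

lemma automorphism_directions:
  obtains g \<pi> where "\<And>v. v \<in> H \<Longrightarrow> g v \<in> H" "\<And>v. v \<in> H \<Longrightarrow> f (apoint v) = apoint (g v)"
    "\<And>v t. v \<in> H \<Longrightarrow> f (aline v t) = aline (g v) (\<pi> t)" "inj_on g H" "inj \<pi>"
    "\<And>v a t. v \<in> H \<Longrightarrow> \<exists>b. g (v + a *s kap t) = g v + b *s kap (\<pi> t)"
proof -
  obtain g where g: "\<And>v. v \<in> H \<Longrightarrow> g v \<in> H \<and> f (apoint v) = apoint (g v)"
    using automorphism_point by metis
  have inj_g: "inj_on g H"
  proof (rule inj_onI)
    fix v w assume vw: "v \<in> H" "w \<in> H" "g v = g w"
    then have "f (apoint v) = f (apoint w)" using g by simp
    then show "v = w" using vw automorphism_eq_iff by simp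
  qed
  have "\<exists>t'. f (aline v t) = aline (g v) t'" if v: "v \<in> H" for v t
    using automorphism_edge[of "apoint v" "aline v t"] edge_apoint_iff[of "g v" "f (aline v t)"] g v by simp
  then obtain \<delta> where \<delta>: "\<And>v t. v \<in> H \<Longrightarrow> f (aline v t) = aline (g v) (\<delta> v t)" by metis
  have step: "\<exists>b. g (v + a *s kap t) = g v + b *s kap (\<delta> v t)" if v: "v \<in> H" for v a t
  proof -
    have "{f (apoint (v + a *s kap t)), f (aline v t)} \<in> edges \<Gamma>" using v by (intro automorphism_edge) auto
    then show ?thesis using v g[of v] g[of "v + a *s kap t"] \<delta>[of v t]
      edge_aline_iff[of "g v" "apoint (g (v + a *s kap t))" "\<delta> v t"] by auto
  qed
  have par: "\<delta> (v + c *s kap s) t = \<delta> v t" if v: "v \<in> H" for v c s t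
  proof (cases "s = t \<or> c = 0")
    case True
    then have "f (aline (v + c *s kap s) t) = f (aline v t)" using v by auto
    then show ?thesis using \<delta> g v aline_eq_iff by (metis H_closed(2,3,5))
  next
    case False
    define v' where "v' = v + c *s kap s"
    have v': "v' \<in> H" using v by (auto simp: v'_def)
    define t1 t2 where "t1 = \<delta> v t" "t2 = \<delta> v' t"
    define p where "p a = v + a *s kap t" for a
    have p: "p a \<in> H" for a using v by (auto simp: p_def)
    have pv': "v' + a *s kap t = p a + c *s kap s" for a by (simp add: p_def v'_def add_ac)
    have gw: "g v \<in> H" "g v' \<in> H" using g v v' by auto
    have "t2 = t1"
    proof (rule ccontr)
      assume ne: "t2 \<noteq> t1"
      obtain x where x: "\<And>a. g (p a) = g v + x a *s kap t1"
        using choice[of "\<lambda>a b. g (p a) = g v + b *s kap t1"] step[OF v]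
        unfolding p_def t1_t2_def by blast
      obtain y where y: "\<And>a. g (p a + c *s kap s) = g v' + y a *s kap t2"
        using choice[of "\<lambda>a b. g (p a + c *s kap s) = g v' + b *s kap t2"] step[OF v']
        unfolding pv'[symmetric] t1_t2_def by blast
      define r where "r a = \<delta> (p a) s" for a
      obtain z where z: "\<And>a. g (p a + c *s kap s) = g (p a) + z a *s kap (r a)"
        using choice[of "\<lambda>a b. g (p a + c *s kap s) = g (p a) + b *s kap (r a)"] step[OF p]
        unfolding r_def by blast
      have fm: "f (aline (p a) s) = aline (g (p a)) (r a)" for a using \<delta>[OF p] by (simp add: r_def)
      \<comment> \<open>The images of the transversals differ from both image lines, so their
        directions avoid \<open>t1\<close> and \<open>t2\<close>.\<close>
      have r1: "r a \<noteq> t1" for a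
      proof
        assume "r a = t1"
        then have "f (aline (p a) s) = f (aline v t)" using \<delta>[OF v] gw by (simp add: fm x t1_t2_def)
        then show False using automorphism_eq_iff p v aline_eq_iff False by auto
      qed
      have r2: "r a \<noteq> t2" for a
      proof
        assume "r a = t2"
        have "f (aline (p a) s) = aline (g (p a) + z a *s kap (r a)) (r a)"
          using fm g p by simp
        also have "\<dots> = aline (g v' + y a *s kap t2) t2"
          using \<open>r a = t2\<close> z y by metis
        also have "\<dots> = f (aline v' t)" using \<delta>[OF v'] gw by (simp add: t1_t2_def)
        finally show False using automorphism_eq_iff p v' aline_eq_iff False by auto
      qed
      \<comment> \<open>Missing the value \<open>t1\<close>, \<open>r\<close> repeats one: two
        transversals become parallel, and subtracting the corresponding paths gives a relation among
        three distinct directions.\<close>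
      have "\<not> inj r"
      proof
        assume "inj r"
        then have "surj r" by (simp add: finite_UNIV_inj_surj)
        then show False using r1 by (metis surjD)
      qed
      then obtain a b where ab: "r a = r b" "a \<noteq> b" by (auto simp: inj_def)
      have "g v + x a *s kap t1 + z a *s kap (r a) = g v' + y a *s kap t2"
        "g v + x b *s kap t1 + z b *s kap (r a) = g v' + y b *s kap t2"
        using x y z ab(1) by metis+
      then have "(g v + x a *s kap t1 + z a *s kap (r a)) - (g v + x b *s kap t1 + z b *s kap (r a))
          = (g v' + y a *s kap t2) - (g v' + y b *s kap t2)"
        by simp
      then have "(x a - x b) *s kap t1 + (z a - z b) *s kap (r a) = (y a - y b) *s kap t2"
        by (simp add: vec.scale_left_diff_distrib algebra_simps)
      moreover have "distinct [t1, r a, t2]" using r1[of a] r2[of a] ne by auto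
      ultimately have "x a - x b = 0" using kap_independent3 by blast
      then have "g (p a) = g (p b)" by (simp add: x)
      then have "p a = p b" using inj_g p by (auto dest: inj_onD)
      then show False using ab(2) by (simp add: p_def vec.scale_cancel_right)
    qed
    then show ?thesis by (simp add: t1_t2_def v'_def)
  qed
  have par': "\<delta> v t = \<delta> 0 t" if v: "v \<in> H" for v t
  proof -
    obtain T :: "'a set" where T: "card T = Suc n" using extend_nodes[of "{}" "{}"] by auto
    have "\<delta> (\<Sum>s\<in>S. lc T s v *s kap s) t = \<delta> 0 t" for S
      using finite[of S]
    proof (induction S)
      case (insert x S)
      have "(\<Sum>s\<in>S. lc T s v *s kap s) \<in> H" by (intro H_sum) auto
      then show ?case using insert par[of "\<Sum>s\<in>S. lc T s v *s kap s" "lc T x v" x t] by (simp add: add.commute)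
    qed simp
    from this[of T] show ?thesis unfolding lc_expand[OF T v] .
  qed
  have "inj (\<delta> 0)"
  proof (rule injI)
    fix s t assume "\<delta> 0 s = \<delta> 0 t"
    then have "f (aline 0 s) = f (aline 0 t)" using \<delta>[of 0] by simp
    then show "s = t" using automorphism_eq_iff aline_eq_iff[of 0 0 s t] by simp
  qed
  moreover have "f (aline v t) = aline (g v) (\<delta> 0 t)" if "v \<in> H" for v t
    using \<delta>[OF that] par'[OF that] by simp
  moreover have "\<exists>b. g (v + a *s kap t) = g v + b *s kap (\<delta> 0 t)" if "v \<in> H" for v a t
    using step[OF that, of a t] par'[OF that] by simp
  ultimately show ?thesis
    using that[of g "\<delta> 0"] g inj_g by blast
qed

end

end

section \<open>The group of affine semilinear maps of the line\<close>

text \<open>Recovers \<open>\<sigma>\<close> from the map sending \<open>x\<close> to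
  \<open>a * \<sigma> x + b\<close>, so that the parameters need not be carried along with
  it.\<close>

definition companion :: "('a::field \<Rightarrow> 'a) \<Rightarrow> 'a \<Rightarrow> 'a" where
  "companion \<gamma> x = (\<gamma> x - \<gamma> 0) / (\<gamma> 1 - \<gamma> 0)"

lemma carrier_AGammaL1:
  "\<gamma> \<in> carrier AGammaL1 \<longleftrightarrow> (\<exists>a b \<sigma>. a \<noteq> 0 \<and> field_automorphism \<sigma> \<and> \<gamma> = (\<lambda>x. a * \<sigma> x + b))"
  by (auto simp: AGammaL1_def)

lemma companion_affine:
  assumes "a \<noteq> 0" "field_automorphism \<sigma>"
  shows "companion (\<lambda>x. a * \<sigma> x + b) = \<sigma>"
  using assms by (auto simp: companion_def field_automorphism_simps[OF assms(2)])

lemma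
  assumes "\<gamma> \<in> carrier AGammaL1"
  shows field_automorphism_companion: "field_automorphism (companion \<gamma>)"
    and AGammaL1_eq: "\<gamma> x = (\<gamma> 1 - \<gamma> 0) * companion \<gamma> x + \<gamma> 0"
    and AGammaL1_inj: "inj \<gamma>"
proof -
  obtain a b \<sigma> where \<gamma>: "a \<noteq> 0" "field_automorphism \<sigma>" "\<gamma> = (\<lambda>x. a * \<sigma> x + b)"
    using assms carrier_AGammaL1 by blast
  show "field_automorphism (companion \<gamma>)"
    using companion_affine[OF \<gamma>(1,2)] \<gamma> by simp
  have "\<gamma> 1 \<noteq> \<gamma> 0"
    using \<gamma> by (simp add: field_automorphism_simps[OF \<gamma>(2)])
  then show "\<gamma> x = (\<gamma> 1 - \<gamma> 0) * companion \<gamma> x + \<gamma> 0"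
    by (simp add: companion_def)
  show "inj \<gamma>"
    using \<gamma> by (auto simp: inj_def field_automorphism_simps[OF \<gamma>(2)])
qed

lemma id_in_AGammaL1: "(\<lambda>x. x) \<in> carrier AGammaL1"
  unfolding carrier_AGammaL1
  by (intro exI[of _ 1] exI[of _ 0] exI[of _ "\<lambda>x. x"]) (simp add: field_automorphism_id)

lemma companion_id [simp]: "companion (\<lambda>x. x) = (\<lambda>x. x)"
  by (auto simp: companion_def)

lemma translation_in_AGammaL1: "(\<lambda>x. x + b) \<in> carrier AGammaL1"
  unfolding carrier_AGammaL1
  by (intro exI[of _ 1] exI[of _ b] exI[of _ "\<lambda>x. x"]) (simp add: field_automorphism_id)

lemma
  assumes "\<gamma> \<in> carrier AGammaL1" "\<delta> \<in> carrier AGammaL1"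
  shows comp_in_AGammaL1: "(\<lambda>x. \<gamma> (\<delta> x)) \<in> carrier AGammaL1"
    and companion_comp: "companion (\<lambda>x. \<gamma> (\<delta> x)) = (\<lambda>x. companion \<gamma> (companion \<delta> x))"
proof -
  obtain a b \<sigma> where \<gamma>: "a \<noteq> 0" "field_automorphism \<sigma>" "\<gamma> = (\<lambda>x. a * \<sigma> x + b)"
    using assms(1) carrier_AGammaL1 by blast
  obtain a' b' \<sigma>' where \<delta>: "a' \<noteq> 0" "field_automorphism \<sigma>'" "\<delta> = (\<lambda>x. a' * \<sigma>' x + b')"
    using assms(2) carrier_AGammaL1 by blast
  have eq: "(\<lambda>x. \<gamma> (\<delta> x)) = (\<lambda>x. (a * \<sigma> a') * \<sigma> (\<sigma>' x) + (a * \<sigma> b' + b))"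
    by (simp add: \<gamma>(3) \<delta>(3) field_automorphism_simps[OF \<gamma>(2)] ring_distribs mult_ac add_ac)
  have ne: "a * \<sigma> a' \<noteq> 0" using \<gamma> \<delta> by (simp add: field_automorphism_simps[OF \<gamma>(2)])
  note fa = field_automorphism_comp[OF \<gamma>(2) \<delta>(2)]
  show "(\<lambda>x. \<gamma> (\<delta> x)) \<in> carrier AGammaL1"
    unfolding eq carrier_AGammaL1 using ne fa by blast
  show "companion (\<lambda>x. \<gamma> (\<delta> x)) = (\<lambda>x. companion \<gamma> (companion \<delta> x))"
    unfolding eq using companion_affine[OF ne fa] companion_affine[OF \<gamma>(1,2)] companion_affine[OF \<delta>(1,2)]
    by (simp add: \<gamma>(3) \<delta>(3))
qed

lemma Bij_UNIV_AGammaL1: "\<gamma> \<in> carrier AGammaL1 \<Longrightarrow> \<gamma> \<in> Bij (UNIV :: 'a::{field,finite} set)"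
  using AGammaL1_inj[of \<gamma>] by (auto simp: Bij_def bij_def finite_UNIV_inj_surj)

lemma mult_AGammaL1:
  fixes \<gamma> \<delta> :: "'a::{field,finite} \<Rightarrow> 'a"
  assumes "\<gamma> \<in> carrier AGammaL1" "\<delta> \<in> carrier AGammaL1"
  shows "\<gamma> \<otimes>\<^bsub>AGammaL1\<^esub> \<delta> = (\<lambda>x. \<gamma> (\<delta> x))"
  using assms[THEN Bij_UNIV_AGammaL1] by (auto simp: AGammaL1_def BijGroup_def compose_def)

lemma card_AGammaL1:
  assumes "prime p" "CARD('a::{field,finite}) = p ^ h"
  shows "card (carrier (AGammaL1 :: ('a \<Rightarrow> 'a) monoid)) = (CARD('a) - 1) * CARD('a) * h"
proof -
  let ?P = "(UNIV - {0 :: 'a}) \<times> (UNIV :: 'a set) \<times> {\<sigma> :: 'a \<Rightarrow> 'a. field_automorphism \<sigma>}"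
  let ?f = "\<lambda>(a, b, \<sigma>) x. a * \<sigma> x + b :: 'a"
  have "carrier (AGammaL1 :: ('a \<Rightarrow> 'a) monoid) = ?f ` ?P"
  proof (intro equalityI subsetI)
    fix \<gamma> assume "\<gamma> \<in> carrier (AGammaL1 :: ('a \<Rightarrow> 'a) monoid)"
    then obtain a b \<sigma> where "a \<noteq> 0" "field_automorphism \<sigma>" "\<gamma> = ?f (a, b, \<sigma>)"
      unfolding carrier_AGammaL1 by auto
    then show "\<gamma> \<in> ?f ` ?P" by blast
  qed (auto simp: carrier_AGammaL1)
  moreover have "inj_on ?f ?P"
  proof (rule inj_onI)
    fix u v assume uv: "u \<in> ?P" "v \<in> ?P" "?f u = ?f v"
    obtain a b \<sigma> where u: "u = (a, b, \<sigma>)" by (cases u) auto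
    obtain a' b' \<sigma>' where v: "v = (a', b', \<sigma>')" by (cases v) auto
    have 1: "a \<noteq> 0" "field_automorphism \<sigma>" "a' \<noteq> 0" "field_automorphism \<sigma>'"
      using uv u v by auto
    have eq: "(\<lambda>x. a * \<sigma> x + b) = (\<lambda>x. a' * \<sigma>' x + b')" using uv(3) u v by simp
    have "\<sigma> = \<sigma>'"
      using companion_affine[OF 1(1,2), of b] companion_affine[OF 1(3,4), of b'] unfolding eq by simp
    moreover have "b = b'" "a + b = a' + b'"
      using fun_cong[OF eq, of 0] fun_cong[OF eq, of 1]
      by (simp_all add: field_automorphism_simps[OF 1(2)] field_automorphism_simps[OF 1(4)])
    ultimately show "u = v" using u v by simp
  qed
  ultimately show ?thesis
    by (simp add: card_image card_cartesian_product card_field_automorphisms[OF assms] card_Diff_subset)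
qed

section \<open>Semilinear maps\<close>

text \<open>Closure of the image under scalars uses that \<open>\<sigma>\<close> is onto.\<close>

lemma semilinear_image_span:
  fixes F :: "'a::field ^ 'd \<Rightarrow> 'a ^ 'd"
  assumes add: "\<And>x y. F (x + y) = F x + F y" and scale: "\<And>c x. F (c *s x) = \<sigma> c *s F x"
    and \<sigma>: "field_automorphism \<sigma>"
  shows "F ` vec.span S = vec.span (F ` S)"
proof (rule equalityI)
  have F0: "F 0 = 0" using scale[of 0 0] field_automorphism_0[OF \<sigma>] by simp
  have "vec.subspace {x. F x \<in> vec.span (F ` S)}"
    by (auto simp: vec.subspace_def F0 add scale vec.span_zero vec.span_add vec.span_scale)
  moreover have "S \<subseteq> {x. F x \<in> vec.span (F ` S)}"
    by (auto intro: vec.span_base)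
  ultimately have "vec.span S \<subseteq> {x. F x \<in> vec.span (F ` S)}"
    by (intro vec.span_minimal)
  then show "F ` vec.span S \<subseteq> vec.span (F ` S)" by blast
  have "vec.subspace (F ` vec.span S)"
    unfolding vec.subspace_def
  proof (intro conjI ballI allI)
    show "0 \<in> F ` vec.span S" using F0 vec.span_zero by (metis image_eqI)
    fix x assume x: "x \<in> F ` vec.span S"
    then obtain u where u: "u \<in> vec.span S" "x = F u" by blast
    show "x + y \<in> F ` vec.span S" if y: "y \<in> F ` vec.span S" for y
    proof -
      obtain v where v: "v \<in> vec.span S" "y = F v" using y by blast
      then have "x + y = F (u + v)" "u + v \<in> vec.span S" using u by (simp_all add: add vec.span_add)
      then show ?thesis by blast
    qed
    show "c *s x \<in> F ` vec.span S" for c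
    proof -
      obtain c' where "c = \<sigma> c'"
        using field_automorphism_bij[OF \<sigma>] by (metis bij_pointE)
      then have "c *s x = F (c' *s u)" using u scale by simp
      then show ?thesis using u vec.span_scale by blast
    qed
  qed
  then show "vec.span (F ` S) \<subseteq> F ` vec.span S"
    by (intro vec.span_minimal) (auto intro: vec.span_base)
qed

context curve_coordinates
begin

text \<open>The curve vectors span \<open>H\<close>, and \<open>e\<close> completes them to a
  spanning set of the whole space.\<close>

lemma semilinear_eqI:
  assumes F: "\<And>x y. F (x + y) = F x + F y" "\<And>c x. F (c *s x) = \<sigma> c *s F x"
    and G: "\<And>x y. G (x + y) = G x + G y" "\<And>c x. G (c *s x) = \<sigma> c *s G x"
    and e: "F e = G e" and kap: "\<And>t. F (kap t) = G (kap t)"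
  shows "F x = (G x :: 'a ^ 'd)"
proof -
  define v where "v = x - ht x *s e"
  have v: "v \<in> H" by (simp only: v_def H_part)
  obtain T :: "'a set" where T: "card T = Suc n" using extend_nodes[of "{}" "{}"] by auto
  have "F v = G v"
  proof -
    have "F (\<Sum>t\<in>T. lc T t v *s kap t) = G (\<Sum>t\<in>T. lc T t v *s kap t)"
      using additive_sum[of F T "\<lambda>t. lc T t v *s kap t"] additive_sum[of G T "\<lambda>t. lc T t v *s kap t"]
      by (simp add: F G kap)
    then show ?thesis by (simp only: lc_expand[OF T v])
  qed
  moreover have "x = ht x *s e + v" by (simp add: v_def)
  ultimately show ?thesis using F G e by metis
qed

text \<open>
  The semilinear map of \<^term>\<open>H\<close> inducing \<^term>\<open>\<gamma>\<close> on the curve: substituting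
  \<open>\<gamma> t = a \<sigma> t + b\<close> into \<open>t ^ i\<close> and expanding gives its coefficients.
\<close>

definition lift :: "('a \<Rightarrow> 'a) \<Rightarrow> 'a ^ 'd \<Rightarrow> 'a ^ 'd" where
  "lift \<gamma> x = (\<Sum>i\<le>n. (\<Sum>j\<le>i. of_nat (i choose j) * (\<gamma> 1 - \<gamma> 0) ^ j * \<gamma> 0 ^ (i - j)
     * companion \<gamma> (crd j x)) *s B i)"

text \<open>The normal form, for \<open>w \<in> H\<close> and \<open>\<mu> \<noteq> 0\<close>, of a
  collineation preserving \<open>H\<close> and \<open>K\<close>, scaled so that \<open>e\<close>
  goes to a vector of height \<open>1\<close>. Fixing the projective scalar in this way makes the
  triple unique.\<close>

definition collin :: "'a ^ 'd \<Rightarrow> 'a \<Rightarrow> ('a \<Rightarrow> 'a) \<Rightarrow> 'a ^ 'd \<Rightarrow> 'a ^ 'd" where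
  "collin w \<mu> \<gamma> x = companion \<gamma> (ht x) *s (e + w) + \<mu> *s lift \<gamma> x"

lemma lift_H [simp, intro]: "lift \<gamma> x \<in> H"
  by (simp add: lift_def H_def ht_sum del: ht_H)

context
  fixes \<gamma> :: "'a \<Rightarrow> 'a" assumes \<gamma>: "\<gamma> \<in> carrier AGammaL1"
begin

lemmas companion_simps = field_automorphism_simps[OF field_automorphism_companion[OF \<gamma>]]

lemma lift_add: "lift \<gamma> (x + y) = lift \<gamma> x + lift \<gamma> y"
  by (simp add: lift_def crd_add companion_simps ring_distribs sum.distrib vec.scale_left_distrib)

lemma lift_scale: "lift \<gamma> (c *s x) = companion \<gamma> c *s lift \<gamma> x"
  by (simp add: lift_def crd_scale companion_simps vec.scale_sum_right sum_distrib_left mult_ac)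

lemma lift_e: "lift \<gamma> e = 0"
  by (simp add: lift_def companion_simps)

lemma lift_kap: "lift \<gamma> (kap t) = kap (\<gamma> t)"
proof -
  have "(\<Sum>j\<le>i. of_nat (i choose j) * (\<gamma> 1 - \<gamma> 0) ^ j * \<gamma> 0 ^ (i - j) * companion \<gamma> (crd j (kap t))) = \<gamma> t ^ i"
    if i: "i \<le> n" for i
  proof -
    have "(\<Sum>j\<le>i. of_nat (i choose j) * (\<gamma> 1 - \<gamma> 0) ^ j * \<gamma> 0 ^ (i - j) * companion \<gamma> (crd j (kap t)))
        = (\<Sum>j\<le>i. of_nat (i choose j) * ((\<gamma> 1 - \<gamma> 0) * companion \<gamma> t) ^ j * \<gamma> 0 ^ (i - j))"
      using i by (intro sum.cong) (simp_all add: crd_kap companion_simps power_mult_distrib mult_ac)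
    also have "\<dots> = ((\<gamma> 1 - \<gamma> 0) * companion \<gamma> t + \<gamma> 0) ^ i"
      by (rule binomial_ring[symmetric])
    also have "\<dots> = \<gamma> t ^ i" using AGammaL1_eq[OF \<gamma>, of t] by simp
    finally show ?thesis .
  qed
  then show ?thesis unfolding lift_def by (simp add: kap_def[of "\<gamma> t"])
qed

lemma collin_add: "collin w \<mu> \<gamma> (x + y) = collin w \<mu> \<gamma> x + collin w \<mu> \<gamma> y"
  by (simp add: collin_def companion_simps lift_add vec.scale_left_distrib vec.scale_right_distrib)

lemma collin_scale: "collin w \<mu> \<gamma> (c *s x) = companion \<gamma> c *s collin w \<mu> \<gamma> x"
  by (simp add: collin_def companion_simps lift_scale vec.scale_right_distrib mult_ac)

lemma collin_e [simp]: "collin w \<mu> \<gamma> e = e + w"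
  by (simp add: collin_def companion_simps lift_e)

lemma collin_H [simp]: "v \<in> H \<Longrightarrow> collin w \<mu> \<gamma> v = \<mu> *s lift \<gamma> v"
  by (simp add: collin_def companion_simps)

lemma ht_collin: "w \<in> H \<Longrightarrow> ht (collin w \<mu> \<gamma> x) = companion \<gamma> (ht x)"
  using lift_H[of \<gamma> x] by (simp add: collin_def)

lemma lift_0: "lift \<gamma> 0 = 0"
  using lift_scale[of 0 0] by (simp add: companion_simps)

text \<open>Since \<open>\<gamma>\<close> is injective it sends nodes to nodes, and an expansion
  over the old nodes becomes one over independent vectors.\<close>

lemma lift_eq_0:
  assumes x: "x \<in> H" "lift \<gamma> x = 0"
  shows "x = 0"
proof -
  obtain T :: "'a set" where T: "card T = Suc n" using extend_nodes[of "{}" "{}"] by auto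
  have inj: "inj_on \<gamma> T" using AGammaL1_inj[OF \<gamma>] by (rule inj_on_subset) simp
  have "0 = lift \<gamma> (\<Sum>t\<in>T. lc T t x *s kap t)"
    unfolding lc_expand[OF T x(1)] x(2) ..
  also have "\<dots> = (\<Sum>t\<in>T. companion \<gamma> (lc T t x) *s kap (\<gamma> t))"
    using additive_sum[of "lift \<gamma>" T "\<lambda>t. lc T t x *s kap t"] lift_add
    by (simp add: lift_scale lift_kap)
  also have "\<dots> = (\<Sum>s\<in>\<gamma> ` T. companion \<gamma> (lc T (inv_into T \<gamma> s) x) *s kap s)"
    by (simp add: sum.reindex[OF inj] inj)
  finally have "(\<Sum>s\<in>\<gamma> ` T. companion \<gamma> (lc T (inv_into T \<gamma> s) x) *s kap s) = 0" by simp
  moreover have "card (\<gamma> ` T) \<le> Suc n" using T inj by (simp add: card_image)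
  ultimately have "companion \<gamma> (lc T (inv_into T \<gamma> s) x) = 0" if "s \<in> \<gamma> ` T" for s
    using kap_independent[of "\<gamma> ` T"] that by (metis finite)
  then have "lc T t x = 0" if "t \<in> T" for t
    using that inj by (fastforce simp: companion_simps)
  then show ?thesis
    using lc_eqI[OF T x(1) H_closed(1)] by simp
qed

lemma collin_inj:
  assumes w: "w \<in> H" and \<mu>: "\<mu> \<noteq> 0"
  shows "inj (collin w \<mu> \<gamma>)"
proof (rule injI)
  fix x y assume eq: "collin w \<mu> \<gamma> x = collin w \<mu> \<gamma> y"
  have "collin w \<mu> \<gamma> (x - y) + collin w \<mu> \<gamma> y = collin w \<mu> \<gamma> x"
    unfolding collin_add[symmetric] by simp
  then have 0: "collin w \<mu> \<gamma> (x - y) = 0" using eq by simp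
  then have "companion \<gamma> (ht (x - y)) = 0" using ht_collin[OF w, of \<mu> "x - y"] by simp
  then have xy: "x - y \<in> H" unfolding H_def mem_Collect_eq by (simp only: companion_simps)
  then have "\<mu> *s lift \<gamma> (x - y) = 0" using 0 by simp
  then show "x = y" using lift_eq_0[OF xy] \<mu> by (simp add: vec.scale_eq_0_iff)
qed

lemma collin_semilinear: "semilinear (collin w \<mu> \<gamma>)"
  unfolding semilinear_def using collin_add collin_scale field_automorphism_companion[OF \<gamma>] by blast

lemma collin_image_span: "collin w \<mu> \<gamma> ` vec.span S = vec.span (collin w \<mu> \<gamma> ` S)"
  using collin_add collin_scale field_automorphism_companion[OF \<gamma>] by (rule semilinear_image_span)

lemma collin_image_apoint:
  assumes "w \<in> H" "v \<in> H"
  shows "collin w \<mu> \<gamma> ` apoint v = apoint (w + \<mu> *s lift \<gamma> v)"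
  using assms by (simp add: apoint_def collin_image_span collin_add add.assoc)

lemma collin_image_aline:
  assumes "w \<in> H" "v \<in> H" and \<mu>: "\<mu> \<noteq> 0"
  shows "collin w \<mu> \<gamma> ` aline v t = aline (w + \<mu> *s lift \<gamma> v) (\<gamma> t)"
proof -
  have "collin w \<mu> \<gamma> ` aline v t = vec.span {e + (w + \<mu> *s lift \<gamma> v), \<mu> *s kap (\<gamma> t)}"
    using assms by (simp add: aline_def collin_image_span collin_add add.assoc lift_kap)
  also have "\<dots> = aline (w + \<mu> *s lift \<gamma> v) (\<gamma> t)"
  proof -
    have "x \<in> vec.span {y, \<mu> *s z} \<longleftrightarrow> x \<in> vec.span {y, z}" for x y z :: "'a ^ 'd"
    proof
      assume "x \<in> vec.span {y, \<mu> *s z}"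
      then obtain a b where "x = a *s y + (b * \<mu>) *s z" by (auto simp: in_span_pair_iff)
      then show "x \<in> vec.span {y, z}" unfolding in_span_pair_iff by blast
    next
      assume "x \<in> vec.span {y, z}"
      then obtain a b where "x = a *s y + b *s z" by (auto simp: in_span_pair_iff)
      then have "x = a *s y + (b / \<mu>) *s (\<mu> *s z)" using \<mu> by simp
      then show "x \<in> vec.span {y, \<mu> *s z}" unfolding in_span_pair_iff by blast
    qed
    then show ?thesis unfolding aline_def by blast
  qed
  finally show ?thesis .
qed

end

lemma lift_id: "v \<in> H \<Longrightarrow> lift (\<lambda>x. x) v = v"
proof -
  assume v: "v \<in> H"
  have "(\<Sum>j\<le>i. of_nat (i choose j) * 0 ^ (i - j) * crd j v) = crd i v" for i
  proof -
    have "(\<Sum>j\<le>i. of_nat (i choose j) * 0 ^ (i - j) * crd j v) = (\<Sum>j\<le>i. if j = i then crd i v else 0)"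
      by (intro sum.cong) (auto simp: power_0_left)
    then show ?thesis by simp
  qed
  then have "lift (\<lambda>x. x) v = (\<Sum>i\<le>n. crd i v *s B i)"
    by (simp add: lift_def)
  also have "\<dots> = v"
    using expand[of v] v by (simp add: H_def ht_def del: ht_H)
  finally show ?thesis .
qed

text \<open>Both sides are semilinear with the same companion, so they are compared only at
  \<open>e\<close> and on the curve.\<close>

lemma collin_comp:
  assumes \<gamma>: "\<gamma> \<in> carrier AGammaL1" and \<delta>: "\<delta> \<in> carrier AGammaL1" and w: "w \<in> H" "w' \<in> H"
  shows "collin w \<mu> \<gamma> (collin w' \<mu>' \<delta> x)
    = collin (w + \<mu> *s lift \<gamma> w') (\<mu> * companion \<gamma> \<mu>') (\<lambda>x. \<gamma> (\<delta> x)) x"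
proof -
  note \<gamma>\<delta> = comp_in_AGammaL1[OF \<gamma> \<delta>]
  show ?thesis
  proof (rule semilinear_eqI[where \<sigma> = "\<lambda>c. companion \<gamma> (companion \<delta> c)"
        and F = "\<lambda>x. collin w \<mu> \<gamma> (collin w' \<mu>' \<delta> x)"])
    show "collin w \<mu> \<gamma> (collin w' \<mu>' \<delta> (x + y)) =
        collin w \<mu> \<gamma> (collin w' \<mu>' \<delta> x) + collin w \<mu> \<gamma> (collin w' \<mu>' \<delta> y)" for x y
      by (simp add: collin_add[OF \<gamma>] collin_add[OF \<delta>])
    show "collin w \<mu> \<gamma> (collin w' \<mu>' \<delta> (c *s x)) =
        companion \<gamma> (companion \<delta> c) *s collin w \<mu> \<gamma> (collin w' \<mu>' \<delta> x)" for c x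
      by (simp add: collin_scale[OF \<gamma>] collin_scale[OF \<delta>])
    show "collin w \<mu> \<gamma> (collin w' \<mu>' \<delta> e) =
        collin (w + \<mu> *s lift \<gamma> w') (\<mu> * companion \<gamma> \<mu>') (\<lambda>x. \<gamma> (\<delta> x)) e"
      using w by (simp add: collin_e[OF \<delta>] collin_e[OF \<gamma>\<delta>] collin_add[OF \<gamma>] collin_e[OF \<gamma>] collin_H[OF \<gamma>] add.assoc)
    show "collin w \<mu> \<gamma> (collin w' \<mu>' \<delta> (kap t)) =
        collin (w + \<mu> *s lift \<gamma> w') (\<mu> * companion \<gamma> \<mu>') (\<lambda>x. \<gamma> (\<delta> x)) (kap t)" for t
      by (simp add: collin_H[OF \<delta>] collin_H[OF \<gamma>\<delta>] collin_H[OF \<gamma>] lift_kap[OF \<gamma>] lift_kap[OF \<delta>]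
          lift_kap[OF \<gamma>\<delta>] lift_scale[OF \<gamma>])
  qed (simp_all add: collin_add[OF \<gamma>\<delta>] collin_scale[OF \<gamma>\<delta>] companion_comp[OF \<gamma> \<delta>])
qed

section \<open>The automorphisms of the graph\<close>

definition induced :: "('a ^ 'd \<Rightarrow> 'a ^ 'd) \<Rightarrow> ('a ^ 'd) set \<Rightarrow> ('a ^ 'd) set" where
  "induced F = (\<lambda>X\<in>verts \<Gamma>. F ` X)"

lemma induced_collin:
  assumes "\<gamma> \<in> carrier AGammaL1" "w \<in> H" "\<mu> \<noteq> 0" "v \<in> H"
  shows "induced (collin w \<mu> \<gamma>) (apoint v) = apoint (w + \<mu> *s lift \<gamma> v)"
    and "induced (collin w \<mu> \<gamma>) (aline v t) = aline (w + \<mu> *s lift \<gamma> v) (\<gamma> t)"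
  using assms by (simp_all add: induced_def collin_image_apoint collin_image_aline)

lemma induced_automorphism:
  assumes \<gamma>: "\<gamma> \<in> carrier AGammaL1" and w: "w \<in> H" and \<mu>: "\<mu> \<noteq> 0"
  shows "induced (collin w \<mu> \<gamma>) \<in> automorphisms \<Gamma>"
proof -
  let ?F = "collin w \<mu> \<gamma>"
  have inj: "inj ?F" using collin_inj[OF \<gamma> w \<mu>] .
  have inj2: "inj ((`) ?F)" using inj_image_eq_iff[OF inj] by (intro injI) blast
  have H': "w + \<mu> *s lift \<gamma> v \<in> H" for v using w by auto
  have into: "induced ?F X \<in> verts \<Gamma>" if "X \<in> verts \<Gamma>" for X
    using that
  proof (cases rule: verts_cases)
    case (1 v) then show ?thesis using induced_collin(1)[OF assms] H' by simp
  next
    case (2 v t) then show ?thesis using induced_collin(2)[OF assms] H' by simp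
  qed
  have inj': "inj_on (induced ?F) (verts \<Gamma>)"
    using inj by (auto simp: inj_on_def induced_def inj_image_eq_iff)
  have "induced ?F ` verts \<Gamma> = verts \<Gamma>"
    using into inj' by (intro endo_inj_surj) auto
  then have Bij: "induced ?F \<in> Bij (verts \<Gamma>)"
    using inj' by (auto simp: Bij_def bij_betw_def induced_def)
  \<comment> \<open>An injection of the finite edge set into itself is onto; this yields the
    converse implication for edges without treating the inverse map.\<close>
  have E: "(\<lambda>E. (`) ?F ` E) ` edges \<Gamma> = edges \<Gamma>"
  proof (rule endo_inj_surj)
    show "(\<lambda>E. (`) ?F ` E) ` edges \<Gamma> \<subseteq> edges \<Gamma>"
    proof clarify
      fix E assume "E \<in> edges \<Gamma>"
      then obtain v t where v: "v \<in> H" "E = {apoint v, aline v t}" unfolding edges_eq by blast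
      have "(`) ?F ` E = {apoint (w + \<mu> *s lift \<gamma> v), aline (w + \<mu> *s lift \<gamma> v) (\<gamma> t)}"
        using v by (simp add: collin_image_apoint[OF \<gamma> w v(1)] collin_image_aline[OF \<gamma> w v(1) \<mu>])
      then show "(`) ?F ` E \<in> edges \<Gamma>" using H' by simp
    qed
    show "inj_on (\<lambda>E. (`) ?F ` E) (edges \<Gamma>)"
      by (rule inj_onI) (rule inj_image_eq_iff[OF inj2, THEN iffD1])
  qed simp
  have "{?F ` X, ?F ` Y} \<in> edges \<Gamma> \<longleftrightarrow> {X, Y} \<in> edges \<Gamma>" for X Y
  proof
    assume "{?F ` X, ?F ` Y} \<in> edges \<Gamma>"
    then have "(`) ?F ` {X, Y} \<in> (\<lambda>E. (`) ?F ` E) ` edges \<Gamma>" unfolding E by simp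
    then obtain E where E': "E \<in> edges \<Gamma>" "(`) ?F ` {X, Y} = (`) ?F ` E" by (rule imageE)
    have "{X, Y} = E" using E'(2) by (rule inj_image_eq_iff[OF inj2, THEN iffD1])
    then show "{X, Y} \<in> edges \<Gamma>" using E'(1) by simp
  next
    assume "{X, Y} \<in> edges \<Gamma>"
    then have "(`) ?F ` {X, Y} \<in> (\<lambda>E. (`) ?F ` E) ` edges \<Gamma>" by (rule imageI)
    then show "{?F ` X, ?F ` Y} \<in> edges \<Gamma>" unfolding E by simp
  qed
  then show ?thesis
    using Bij by (simp add: automorphisms_def induced_def)
qed

text \<open>Once \<open>g 0\<close> is subtracted, the action on \<open>H\<close> and
  \<open>lift \<pi>\<close> have the same companion and the same directions, so they differ by one
  scalar \<open>S t\<close> per direction. A curve vector off the nodes has nonzero coordinates at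
  all of them, which forces these scalars to agree.\<close>

lemma automorphism_induced:
  assumes f: "f \<in> automorphisms \<Gamma>"
  obtains w \<mu> \<gamma> where "w \<in> H" "\<mu> \<noteq> 0" "\<gamma> \<in> carrier AGammaL1" "f = induced (collin w \<mu> \<gamma>)"
proof -
  obtain g \<pi> where g: "\<And>v. v \<in> H \<Longrightarrow> g v \<in> H" "\<And>v. v \<in> H \<Longrightarrow> f (apoint v) = apoint (g v)"
    "\<And>v t. v \<in> H \<Longrightarrow> f (aline v t) = aline (g v) (\<pi> t)" "inj_on g H" "inj \<pi>"
    "\<And>v a t. v \<in> H \<Longrightarrow> \<exists>b. g (v + a *s kap t) = g v + b *s kap (\<pi> t)"
    using automorphism_directions[OF f] by blast
  define f0 where "f0 v = g v - g 0" for v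
  have f0_add: "f0 (v + w) = f0 v + f0 w" if "v \<in> H" "w \<in> H" for v w
    using direction_preserving_additive[of g \<pi> v w, OF g(1,5,6) that] by (simp add: f0_def)
  have f0_kap: "\<exists>b. f0 (a *s kap t) = b *s kap (\<pi> t)" for a t
    using g(6)[OF H_closed(1), of a t] by (auto simp: f0_def)
  have f0_inj: "v = 0" if "v \<in> H" "f0 v = 0" for v
    using that inj_onD[OF g(4), of v 0] by (simp add: f0_def)
  obtain \<sigma> where \<sigma>: "field_automorphism \<sigma>" "\<And>t. \<pi> t = (\<pi> 1 - \<pi> 0) * \<sigma> t + \<pi> 0"
    "\<And>a v. v \<in> H \<Longrightarrow> f0 (a *s v) = \<sigma> a *s f0 v"
    using direction_preserving_semilinear[of f0 \<pi>, OF f0_add g(5) f0_kap f0_inj] by blast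
  have ne: "\<pi> 1 - \<pi> 0 \<noteq> 0" using inj_eq[OF g(5), of 1 0] by simp
  have \<pi>_eq: "\<pi> = (\<lambda>t. (\<pi> 1 - \<pi> 0) * \<sigma> t + \<pi> 0)" using \<sigma>(2) by (intro ext)
  have \<pi>: "\<pi> \<in> carrier AGammaL1"
    unfolding carrier_AGammaL1 using ne \<sigma>(1) \<pi>_eq by blast
  have comp: "companion \<pi> = \<sigma>" using companion_affine[OF ne \<sigma>(1), of "\<pi> 0"] \<pi>_eq by metis
  obtain S where S: "\<And>t. f0 (kap t) = S t *s kap (\<pi> t)"
    using choice[of "\<lambda>t b. f0 (kap t) = b *s kap (\<pi> t)"] f0_kap[of 1] by auto
  have f0_expand: "f0 (\<Sum>s\<in>T. c s *s kap s) = (\<Sum>s\<in>T. (\<sigma> (c s) * S s) *s kap (\<pi> s))" for T c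
    using additive_sum[of f0 T, OF f0_add] by (simp add: \<sigma>(3) S)
  have lift_expand: "lift \<pi> (\<Sum>s\<in>T. c s *s kap s) = (\<Sum>s\<in>T. \<sigma> (c s) *s kap (\<pi> s))" for T c
    using additive_sum[of "lift \<pi>" T "\<lambda>s. c s *s kap s"] lift_add[OF \<pi>]
    by (simp add: lift_scale[OF \<pi>] lift_kap[OF \<pi>] comp)
  have const: "S x = S t" for x t
  proof (cases "x = t")
    case False
    then obtain T where T: "{t} \<subseteq> T" "T \<inter> {x} = {}" "card T = Suc n"
      using extend_nodes[of "{t}" "{x}"] by auto
    then have xT: "x \<notin> T" and tT: "t \<in> T" by auto
    have card\<pi>: "card (\<pi> ` T) = Suc n"
      using T g(5) by (simp add: card_image inj_on_subset)
    have coord: "lc (\<pi> ` T) (\<pi> t) (\<Sum>s\<in>T. c s *s kap (\<pi> s)) = c t" for c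
    proof -
      have "lc (\<pi> ` T) (\<pi> t) (\<Sum>s\<in>T. c s *s kap (\<pi> s)) = (\<Sum>s\<in>T. if s = t then c s else 0)"
        unfolding lc_sum lc_scale using tT inj_eq[OF g(5)]
        by (intro sum.cong) (auto simp: lc_kap_nodes card\<pi>)
      then show ?thesis using tT by simp
    qed
    let ?c = "\<lambda>s. lc T s (kap x)"
    have x: "(\<Sum>s\<in>T. ?c s *s kap s) = kap x" by (rule lc_expand[OF T(3)]) simp
    have "S x * lc (\<pi> ` T) (\<pi> t) (kap (\<pi> x)) = \<sigma> (?c t) * S t"
      using arg_cong[OF f0_expand[of ?c T], of "lc (\<pi> ` T) (\<pi> t)"] unfolding x coord S lc_scale .
    moreover have "lc (\<pi> ` T) (\<pi> t) (kap (\<pi> x)) = \<sigma> (?c t)"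
      using arg_cong[OF lift_expand[of ?c T], of "lc (\<pi> ` T) (\<pi> t)"] unfolding x coord lift_kap[OF \<pi>] .
    moreover have "\<sigma> (?c t) \<noteq> 0"
      using lc_kap_nonzero[OF tT T(3) xT] by (simp add: field_automorphism_eq_0_iff[OF \<sigma>(1)])
    ultimately show ?thesis by simp
  qed simp
  have f0_eq: "f0 v = S 0 *s lift \<pi> v" if v: "v \<in> H" for v
  proof -
    obtain T :: "'a set" where T: "card T = Suc n" using extend_nodes[of "{}" "{}"] by auto
    let ?v = "\<Sum>s\<in>T. lc T s v *s kap s"
    have "f0 ?v = S 0 *s lift \<pi> ?v"
      unfolding f0_expand lift_expand vec.scale_sum_right
    proof (rule sum.cong[OF refl])
      fix s
      show "(\<sigma> (lc T s v) * S s) *s kap (\<pi> s) = S 0 *s (\<sigma> (lc T s v) *s kap (\<pi> s))"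
        using const[of s 0] by (simp add: mult.commute)
    qed
    then show ?thesis unfolding lc_expand[OF T v] .
  qed
  have S0: "S 0 \<noteq> 0"
  proof
    assume "S 0 = 0"
    then have "kap 0 = 0" using f0_inj[of "kap 0"] S[of 0] by simp
    then show False by simp
  qed
  have g_eq: "g v = g 0 + S 0 *s lift \<pi> v" if "v \<in> H" for v
    using f0_eq[OF that] by (simp add: f0_def diff_eq_eq add.commute)
  have g0: "g 0 \<in> H" using g(1) by simp
  have "f = induced (collin (g 0) (S 0) \<pi>)"
  proof
    fix X show "f X = induced (collin (g 0) (S 0) \<pi>) X"
    proof (cases "X \<in> verts \<Gamma>")
      case False
      then show ?thesis using f by (auto simp: induced_def automorphisms_def Bij_def extensional_def)
    next
      case True
      then show ?thesis
      proof (cases rule: verts_cases)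
        case (1 v) then show ?thesis
          using g(2)[OF 1(1)] g_eq[OF 1(1)] induced_collin(1)[OF \<pi> g0 S0 1(1)] by simp
      next
        case (2 v t) then show ?thesis
          using g(3)[OF 2(1)] g_eq[OF 2(1)] induced_collin(2)[OF \<pi> g0 S0 2(1)] by simp
      qed
    qed
  qed
  then show ?thesis using that[OF g0 S0 \<pi>] by blast
qed

text \<open>The image of \<open>apoint 0\<close> gives \<open>w\<close>, the directions of the image
  lines through it give \<open>\<gamma>\<close>, and the image of \<open>apoint (kap 0)\<close>
  gives \<open>\<mu>\<close>.\<close>

lemma induced_collin_inj:
  assumes 1: "\<gamma> \<in> carrier AGammaL1" "w \<in> H" "\<mu> \<noteq> 0"
    and 2: "\<gamma>' \<in> carrier AGammaL1" "w' \<in> H" "\<mu>' \<noteq> 0"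
    and eq: "induced (collin w \<mu> \<gamma>) = induced (collin w' \<mu>' \<gamma>')"
  shows "w = w'" "\<mu> = \<mu>'" "\<gamma> = \<gamma>'"
proof -
  have H0: "0 \<in> H" by simp
  show w: "w = w'"
    using induced_collin(1)[OF 1 H0] induced_collin(1)[OF 2 H0] 1 2
    by (simp add: eq lift_0)
  show \<gamma>: "\<gamma> = \<gamma>'"
  proof
    fix t
    have "aline w (\<gamma> t) = aline w (\<gamma>' t)"
      using induced_collin(2)[OF 1 H0, of t] induced_collin(2)[OF 2 H0, of t] 1 2 w
      by (simp add: eq[unfolded w] lift_0)
    then show "\<gamma> t = \<gamma>' t" using aline_eq_iff[OF 1(2) 1(2)] by blast
  qed
  have "induced (collin w \<mu> \<gamma>) = induced (collin w \<mu>' \<gamma>)" using eq w \<gamma> by simp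
  then have "apoint (w + \<mu> *s kap (\<gamma> 0)) = apoint (w + \<mu>' *s kap (\<gamma> 0))"
    using induced_collin(1)[OF 1 H_closed(2), of 0] induced_collin(1)[OF 1(1,2) 2(3) H_closed(2), of 0]
    by (simp add: lift_kap[OF 1(1)])
  then have "\<mu> *s kap (\<gamma> 0) = \<mu>' *s kap (\<gamma> 0)"
    using 1(2) apoint_eq_iff[of "w + \<mu> *s kap (\<gamma> 0)" "w + \<mu>' *s kap (\<gamma> 0)"] by auto
  then show "\<mu> = \<mu>'" by (simp add: vec.scale_cancel_right)
qed

section \<open>Regularity, edge-transitivity and the failure of vertex-transitivity\<close>

lemma semisymmetric_Gamma: "semisymmetric \<Gamma>"
  unfolding semisymmetric_def
proof (intro conjI)
  show "simple_graph \<Gamma>"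
    unfolding simple_graph_def
  proof (intro conjI ballI)
    show "finite (verts \<Gamma>)" by simp
    fix E assume "E \<in> edges \<Gamma>"
    then obtain v t where v: "v \<in> H" "E = {apoint v, aline v t}" unfolding edges_eq by blast
    then show "E \<subseteq> verts \<Gamma>" "card E = 2" by simp_all
  qed
  have "degree \<Gamma> X = CARD('a)" if "X \<in> verts \<Gamma>" for X
    using that
  proof (cases rule: verts_cases)
    case (1 v)
    have "{E \<in> edges \<Gamma>. X \<in> E} = range (\<lambda>t. {apoint v, aline v t})"
    proof (intro equalityI subsetI)
      fix E assume "E \<in> {E \<in> edges \<Gamma>. X \<in> E}"
      then obtain w t where w: "w \<in> H" "E = {apoint w, aline w t}" "apoint v \<in> E" unfolding edges_eq 1 by blast
      then have "v = w" using 1 by auto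
      then show "E \<in> range (\<lambda>t. {apoint v, aline v t})" using w by blast
    qed (use 1 in auto)
    moreover have "inj (\<lambda>t. {apoint v, aline v t})"
      using 1 aline_eq_iff[OF 1(1) 1(1)] by (auto simp: inj_def doubleton_eq_iff)
    ultimately show ?thesis by (simp add: Defs.degree_def card_image)
  next
    case (2 v t)
    have c: "v + c *s kap t \<in> H" for c using 2 by auto
    have "{E \<in> edges \<Gamma>. X \<in> E} = range (\<lambda>c. {apoint (v + c *s kap t), aline v t})"
    proof (intro equalityI subsetI)
      fix E assume "E \<in> {E \<in> edges \<Gamma>. X \<in> E}"
      then obtain w s where w: "w \<in> H" "E = {apoint w, aline w s}" "aline v t \<in> E" unfolding edges_eq 2 by blast
      then have eq: "aline v t = aline w s" using 2 by auto
      then obtain c where "w = v + c *s kap t" using aline_eq_iff[OF 2(1) w(1)] by blast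
      then show "E \<in> range (\<lambda>c. {apoint (v + c *s kap t), aline v t})" using w(2) eq by auto
    qed (use 2 in auto)
    moreover have "inj (\<lambda>c. {apoint (v + c *s kap t), aline v t})"
    proof (rule injI)
      fix a b assume "{apoint (v + a *s kap t), aline v t} = {apoint (v + b *s kap t), aline v t}"
      then have "apoint (v + a *s kap t) = apoint (v + b *s kap t)"
        using c 2 by (auto simp: doubleton_eq_iff)
      then show "a = b" using apoint_eq_iff[OF c c] by (simp add: vec.scale_cancel_right)
    qed
    ultimately show ?thesis by (simp add: Defs.degree_def card_image)
  qed
  then show "regular \<Gamma>" unfolding regular_def by blast
  show "edge_transitive \<Gamma>"
    unfolding edge_transitive_def
  proof (intro ballI)
    fix D E assume "D \<in> edges \<Gamma>" "E \<in> edges \<Gamma>"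
    then obtain v t w s where D: "v \<in> H" "D = {apoint v, aline v t}" and E: "w \<in> H" "E = {apoint w, aline w s}"
      unfolding edges_eq by blast
    \<comment> \<open>Translating the parameter turns direction \<open>t\<close> into
      \<open>s\<close>; the translation part \<open>w - lift \<gamma> v\<close> then moves the point
      into place.\<close>
    define \<gamma> where "\<gamma> = (\<lambda>x. x + (s - t))"
    have \<gamma>: "\<gamma> \<in> carrier AGammaL1" unfolding \<gamma>_def by (rule translation_in_AGammaL1)
    let ?w = "w - lift \<gamma> v"
    have w: "?w \<in> H" using E by auto
    have "\<gamma> t = s" by (simp add: \<gamma>_def)
    then have "induced (collin ?w 1 \<gamma>) ` D = E"
      using D E induced_collin[OF \<gamma> w one_neq_zero D(1)] by simp
    then show "\<exists>f\<in>automorphisms \<Gamma>. f ` D = E"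
      using induced_automorphism[OF \<gamma> w one_neq_zero] by blast
  qed
  show "\<not> vertex_transitive \<Gamma>"
  proof
    assume "vertex_transitive \<Gamma>"
    then obtain f where "f \<in> automorphisms \<Gamma>" "f (aline 0 0) = apoint 0"
      unfolding vertex_transitive_def using H_closed(1) by (metis aline_verts apoint_verts)
    then show False using automorphism_line_neq_point by blast
  qed
qed

section \<open>The perspectivities\<close>

text \<open>Restricting to \<open>proj_points\<close> makes the map extensional, as membership in
  \<open>BijGroup\<close> demands.\<close>

definition on_points :: "('a ^ 'd \<Rightarrow> 'a ^ 'd) \<Rightarrow> ('a ^ 'd) set \<Rightarrow> ('a ^ 'd) set" where
  "on_points F = (\<lambda>P\<in>proj_points. F ` P)"

abbreviation persp :: "'a ^ 'd \<Rightarrow> 'a \<Rightarrow> 'a ^ 'd \<Rightarrow> 'a ^ 'd" where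
  "persp w \<mu> \<equiv> collin w \<mu> (\<lambda>x. x)"

lemma persp_add: "persp w \<mu> (x + y) = persp w \<mu> x + persp w \<mu> y"
  and persp_scale: "persp w \<mu> (c *s x) = c *s persp w \<mu> x"
  and persp_e [simp]: "persp w \<mu> e = e + w"
  and persp_H [simp]: "v \<in> H \<Longrightarrow> persp w \<mu> v = \<mu> *s v"
  by (simp_all add: collin_add[OF id_in_AGammaL1] collin_scale[OF id_in_AGammaL1]
      collin_e[OF id_in_AGammaL1] collin_H[OF id_in_AGammaL1] lift_id)

text \<open>Every vector of \<open>H\<close> is an eigenvector. The test vectors
  \<open>c *s B 0 + B i\<close> force equal eigenvalues and \<open>\<sigma> c = c\<close>, so the
  map is linear and scalar on \<open>H\<close>.\<close>

lemma fixing_H_scalar: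
  assumes f: "semilinear f" "bij f" and fix_H: "\<And>P. P \<in> proj_points \<Longrightarrow> P \<subseteq> H \<Longrightarrow> f ` P = P"
  obtains \<kappa> where "\<kappa> \<noteq> 0" "\<And>v. v \<in> H \<Longrightarrow> f v = \<kappa> *s v" "\<And>c x. f (c *s x) = c *s f x"
proof -
  obtain \<sigma> where \<sigma>: "field_automorphism \<sigma>" and add: "\<And>x y. f (x + y) = f x + f y"
    and scale: "\<And>c x. f (c *s x) = \<sigma> c *s f x"
    using f(1) unfolding semilinear_def by blast
  have f0: "f 0 = 0" using scale[of 0 0] field_automorphism_0[OF \<sigma>] by simp
  have eigen: "\<exists>c. f v = c *s v" if v: "v \<in> H" for v
  proof (cases "v = 0")
    case False
    then have "vec.span {v} \<in> proj_points" by (auto simp: proj_points_iff)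
    moreover have "vec.span {v} \<subseteq> H" using v subspace_H by (intro vec.span_minimal) auto
    ultimately have "f ` vec.span {v} = vec.span {v}" by (rule fix_H)
    moreover have "v \<in> vec.span {v}" by (simp add: vec.span_base)
    ultimately have "f v \<in> vec.span {v}" by blast
    then show ?thesis by (simp add: in_span_singleton_iff)
  qed (simp add: f0)
  have B_H: "B i \<in> H" if "i \<le> n" for i
    unfolding H_def using that by simp
  have crdB: "crd i (B j) = (if i = j then 1 else 0)" if "i \<le> n" "j \<le> n" for i j
    using that by (simp add: crd_B)
  obtain \<kappa> where \<kappa>: "f (B 0) = \<kappa> *s B 0" using eigen[OF B_H[of 0]] by auto
  have pair: "f (B i) = \<kappa> *s B i \<and> \<sigma> c = c" if i: "0 < i" "i \<le> n" for i c
  proof -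
    obtain l where l: "f (B i) = l *s B i" using eigen[OF B_H] i by blast
    have eq: "\<sigma> c * \<kappa> = l * c" for c
    proof -
      have "c *s B 0 + B i \<in> H" using B_H i by auto
      then obtain k where k: "f (c *s B 0 + B i) = k *s (c *s B 0 + B i)" using eigen by blast
      have k': "\<sigma> c *s (\<kappa> *s B 0) + l *s B i = k *s (c *s B 0 + B i)"
        using k by (simp add: add scale \<kappa> l)
      have "\<sigma> c * \<kappa> = k * c" "l = k"
        using arg_cong[OF k', of "crd 0"] arg_cong[OF k', of "crd i"] i
        by (simp_all add: crd_add crd_scale crdB)
      then show ?thesis by simp
    qed
    have "\<kappa> = l" using eq[of 1] field_automorphism_1[OF \<sigma>] by simp
    moreover have "\<kappa> \<noteq> 0"
    proof
      assume "\<kappa> = 0"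
      then have "f (B 0) = f 0" using \<kappa> f0 by simp
      then have "B 0 = 0" using f(2) by (auto simp: bij_def inj_eq)
      then have "crd 0 (B 0) = 0" by simp
      then show False using crdB[of 0 0] by simp
    qed
    ultimately show ?thesis using l eq[of c] by simp
  qed
  have id: "\<sigma> c = c" for c using pair[of 1 c] n_ge_2 by simp
  have scale': "f (c *s x) = c *s f x" for c x using scale id by simp
  have fB: "f (B i) = \<kappa> *s B i" if "i \<le> n" for i
    using \<kappa> pair[of i] that by (cases "i = 0") auto
  have f_sum: "f (sum u A) = (\<Sum>x\<in>A. f (u x))" for u and A :: "nat set"
    by (induction A rule: infinite_finite_induct) (simp_all add: f0 add)
  have H_expand: "(\<Sum>i\<le>n. crd i v *s B i) = v" if v: "v \<in> H" for v
  proof -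
    have "crd (Suc n) v = 0" using v unfolding H_def ht_def by simp
    then show ?thesis using expand[of v] by simp
  qed
  have fH: "f v = \<kappa> *s v" if v: "v \<in> H" for v
  proof -
    have "f (\<Sum>i\<le>n. crd i v *s B i) = \<kappa> *s (\<Sum>i\<le>n. crd i v *s B i)"
      unfolding f_sum vec.scale_sum_right
      by (intro sum.cong refl) (simp add: scale' fB mult.commute)
    then show ?thesis unfolding H_expand[OF v] .
  qed
  have "\<kappa> \<noteq> 0"
  proof
    assume "\<kappa> = 0"
    then have "f (kap 0) = f 0" using fH[of "kap 0"] f0 by simp
    then show False using f(2) by (simp add: bij_def inj_eq)
  qed
  then show ?thesis using that fH scale' by blast
qed

text \<open>Dividing by the height \<open>c\<close> of \<open>f e\<close> changes no point and turns
  the semilinear map into the normal form.\<close>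

lemma carrier_Persp:
  "carrier (Persp H) = (\<lambda>(w, \<mu>). on_points (persp w \<mu>)) ` (H \<times> (UNIV - {0}))"
proof (intro equalityI subsetI)
  fix g assume "g \<in> carrier (Persp H)"
  then obtain f where f: "semilinear f" "bij f" "g = on_points f"
    and fix_g: "\<And>P. P \<in> proj_points \<Longrightarrow> P \<subseteq> H \<Longrightarrow> g P = P"
    by (auto simp: Persp_def PGammaL_def on_points_def)
  obtain \<kappa> where \<kappa>: "\<kappa> \<noteq> 0" "\<And>v. v \<in> H \<Longrightarrow> f v = \<kappa> *s v" and scale: "\<And>c x. f (c *s x) = c *s f x"
    using fixing_H_scalar[OF f(1,2)] fix_g f(3) by (auto simp: on_points_def)
  have add: "f (x + y) = f x + f y" for x y using f(1) unfolding semilinear_def by blast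
  define c where "c = ht (f e)"
  have decomp: "f x = ht x *s f e + \<kappa> *s (x - ht x *s e)" for x
  proof -
    have "f (ht x *s e + (x - ht x *s e)) = ht x *s f e + \<kappa> *s (x - ht x *s e)"
      unfolding add scale \<kappa>(2)[OF H_part] ..
    then show ?thesis by simp
  qed
  \<comment> \<open>Otherwise every value of \<open>f\<close> would have height \<open>0\<close>,
    against surjectivity.\<close>
  have "c \<noteq> 0"
  proof
    assume "c = 0"
    then have "ht (f x) = 0" for x
      using decomp[of x] by (simp add: c_def)
    moreover obtain x where "f x = e" using f(2) by (metis bij_pointE)
    ultimately show False by (metis ht_e zero_neq_one)
  qed
  define w where "w = (1 / c) *s f e - e"
  have w: "w \<in> H" unfolding H_def mem_Collect_eq using \<open>c \<noteq> 0\<close> by (simp add: w_def c_def)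
  have few: "f e = c *s (e + w)" using \<open>c \<noteq> 0\<close> by (simp add: w_def)
  have fp: "f x = c *s persp w (\<kappa> / c) x" for x
  proof -
    have "persp w (\<kappa> / c) (ht x *s e + (x - ht x *s e)) = ht x *s (e + w) + (\<kappa> / c) *s (x - ht x *s e)"
      unfolding persp_add persp_scale persp_e persp_H[OF H_part] ..
    then have "persp w (\<kappa> / c) x = ht x *s (e + w) + (\<kappa> / c) *s (x - ht x *s e)" by simp
    then have "c *s persp w (\<kappa> / c) x = ht x *s f e + \<kappa> *s (x - ht x *s e)"
      using \<open>c \<noteq> 0\<close> by (simp only: few vec.scale_right_distrib vec.scale_scale) (simp add: mult.commute)
    then show ?thesis using decomp[of x] by simp
  qed
  have "on_points f = on_points (persp w (\<kappa> / c))"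
  proof
    fix P show "on_points f P = on_points (persp w (\<kappa> / c)) P"
    proof (cases "P \<in> proj_points")
      case True
      then obtain x where x: "P = vec.span {x}" by (auto simp: proj_points_iff)
      have "f ` P = vec.span {c *s persp w (\<kappa> / c) x}"
        unfolding x using semilinear_image_span[of f "\<lambda>c. c" "{x}", OF add scale field_automorphism_id] by (simp add: fp)
      also have "\<dots> = vec.span {persp w (\<kappa> / c) x}" using \<open>c \<noteq> 0\<close> by (rule span_singleton_scale)
      also have "\<dots> = persp w (\<kappa> / c) ` P"
        unfolding x by (simp add: collin_image_span[OF id_in_AGammaL1])
      finally show ?thesis using True by (simp add: on_points_def)
    qed (simp add: on_points_def)
  qed
  then show "g \<in> (\<lambda>(w, \<mu>). on_points (persp w \<mu>)) ` (H \<times> (UNIV - {0}))"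
    using f(3) w \<kappa>(1) \<open>c \<noteq> 0\<close> by (intro image_eqI[of _ _ "(w, \<kappa> / c)"]) auto
next
  fix g assume "g \<in> (\<lambda>(w, \<mu>). on_points (persp w \<mu>)) ` (H \<times> (UNIV - {0}))"
  then obtain w \<mu> where g: "w \<in> H" "\<mu> \<noteq> 0" "g = on_points (persp w \<mu>)" by (auto elim!: imageE)
  have "bij (persp w \<mu>)"
    using collin_inj[OF id_in_AGammaL1 g(1,2)] by (simp add: bij_def finite_UNIV_inj_surj)
  moreover have "semilinear (persp w \<mu>)" by (rule collin_semilinear[OF id_in_AGammaL1])
  ultimately have "g \<in> carrier PGammaL" unfolding g(3) on_points_def PGammaL_def by auto
  moreover have "g P = P" if P: "P \<in> proj_points" "P \<subseteq> H" for P
  proof -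
    obtain x where x: "P = vec.span {x}" using P by (auto simp: proj_points_iff)
    then have "x \<in> H" using P vec.span_base[of x "{x}"] by auto
    have "persp w \<mu> ` P = vec.span {\<mu> *s x}"
      unfolding x using \<open>x \<in> H\<close> by (simp add: collin_image_span[OF id_in_AGammaL1])
    then show ?thesis using P(1) span_singleton_scale[OF g(2)] by (simp add: g(3) on_points_def x)
  qed
  ultimately show "g \<in> carrier (Persp H)" by (simp add: Persp_def)
qed

text \<open>The product of \<open>BijGroup\<close> is composition only on members of
  \<open>Bij\<close>, so this is required before products in \<open>Persp H\<close> can be
  computed.\<close>

lemma on_points_Bij:
  assumes "semilinear F" "bij F"
  shows "on_points F \<in> Bij proj_points"
proof -
  obtain \<sigma> where \<sigma>: "field_automorphism \<sigma>" and add: "\<And>x y. F (x + y) = F x + F y"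
    and scale: "\<And>c x. F (c *s x) = \<sigma> c *s F x"
    using assms(1) unfolding semilinear_def by blast
  have F0: "F 0 = 0" using scale[of 0 0] field_automorphism_0[OF \<sigma>] by simp
  have inj: "inj F" using assms(2) by (simp add: bij_def)
  have "on_points F P \<in> proj_points" if P: "P \<in> proj_points" for P
  proof -
    obtain x where x: "x \<noteq> 0" "P = vec.span {x}" using P by (auto simp: proj_points_iff)
    have "F x \<noteq> 0" using x(1) inj_eq[OF inj, of x 0] F0 by simp
    moreover have "on_points F P = vec.span {F x}"
      using P x semilinear_image_span[of F \<sigma> "{x}", OF add scale \<sigma>] by (simp add: on_points_def)
    ultimately show ?thesis by (auto simp: proj_points_iff)
  qed
  moreover have inj': "inj_on (on_points F) proj_points"
    using inj by (auto simp: inj_on_def on_points_def inj_image_eq_iff)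
  ultimately have "on_points F ` proj_points = proj_points"
    by (intro endo_inj_surj) auto
  then show ?thesis using inj' by (auto simp: Bij_def bij_betw_def on_points_def)
qed

lemma persp_Bij:
  assumes "w \<in> H" "\<mu> \<noteq> 0"
  shows "on_points (persp w \<mu>) \<in> Bij proj_points"
  using collin_inj[OF id_in_AGammaL1 assms] collin_semilinear[OF id_in_AGammaL1]
  by (intro on_points_Bij) (simp_all add: bij_def finite_UNIV_inj_surj)

lemma mult_Persp:
  assumes "w \<in> H" "\<mu> \<noteq> 0" "w' \<in> H" "\<mu>' \<noteq> 0"
  shows "on_points (persp w \<mu>) \<otimes>\<^bsub>Persp H\<^esub> on_points (persp w' \<mu>')
    = on_points (persp (w + \<mu> *s w') (\<mu> * \<mu>'))"
proof -
  note Bij = persp_Bij[OF assms(1,2)] persp_Bij[OF assms(3,4)]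
  have comp: "(\<lambda>x. persp w \<mu> (persp w' \<mu>' x)) = persp (w + \<mu> *s w') (\<mu> * \<mu>')"
    using collin_comp[OF id_in_AGammaL1 id_in_AGammaL1 assms(1,3)] assms by (auto simp: lift_id)
  have "on_points (persp w \<mu>) \<otimes>\<^bsub>Persp H\<^esub> on_points (persp w' \<mu>')
      = compose proj_points (on_points (persp w \<mu>)) (on_points (persp w' \<mu>'))"
    using Bij by (simp add: Persp_def PGammaL_def BijGroup_def)
  also have "\<dots> = on_points (\<lambda>x. persp w \<mu> (persp w' \<mu>' x))"
  proof
    fix P show "compose proj_points (on_points (persp w \<mu>)) (on_points (persp w' \<mu>')) P
        = on_points (\<lambda>x. persp w \<mu> (persp w' \<mu>' x)) P"
    proof (cases "P \<in> proj_points")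
      case True
      then have "on_points (persp w' \<mu>') P \<in> proj_points"
        using Bij(2) Bij_imp_funcset by blast
      then show ?thesis using True by (auto simp: compose_def on_points_def image_image)
    qed (simp add: compose_def on_points_def)
  qed
  finally show ?thesis unfolding comp .
qed

section \<open>The structure of the automorphism group\<close>

text \<open>An element of \<open>Persp H\<close> is only a permutation of points. The image of a
  vertex is assembled from images of the points on it, without choosing a linear
  representative.\<close>

definition extend :: "(('a ^ 'd) set \<Rightarrow> ('a ^ 'd) set) \<Rightarrow> ('a ^ 'd) set \<Rightarrow> ('a ^ 'd) set" where
  "extend g = (\<lambda>X\<in>verts \<Gamma>. \<Union> (g ` {P \<in> proj_points. P \<subseteq> X}))"

lemma extend_on_points: "extend (on_points F) = induced F"
proof
  fix X
  show "extend (on_points F) X = induced F X"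
  proof (cases "X \<in> verts \<Gamma>")
    case True
    then obtain S v where X: "X = vec.span S" "e + v \<in> S" "v \<in> H"
      by (cases rule: verts_cases) (auto simp: apoint_def aline_def)
    have "\<Union> {P \<in> proj_points. P \<subseteq> X} = X"
    proof (intro equalityI subsetI)
      fix x assume x: "x \<in> X"
      \<comment> \<open>The zero vector spans no point; it is covered by the point of the nonzero
        vector \<open>e + v\<close>.\<close>
      have "\<exists>y. y \<noteq> 0 \<and> y \<in> X \<and> x \<in> vec.span {y}"
      proof (cases "x = 0")
        case True
        then show ?thesis using e_plus_nonzero[OF X(3)] X vec.span_base vec.span_zero by metis
      next
        case False
        then show ?thesis using x vec.span_base by blast
      qed
      then obtain y where y: "y \<noteq> 0" "y \<in> X" "x \<in> vec.span {y}" by blast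
      have "vec.span {y} \<subseteq> X" using y X by (intro vec.span_minimal) auto
      then show "x \<in> \<Union> {P \<in> proj_points. P \<subseteq> X}" using y proj_points_iff by blast
    qed auto
    then have "F ` X = F ` \<Union> {P \<in> proj_points. P \<subseteq> X}" by simp
    also have "\<dots> = \<Union> (on_points F ` {P \<in> proj_points. P \<subseteq> X})"
      by (auto simp: on_points_def)
    finally show ?thesis using True by (simp add: extend_def induced_def)
  qed (simp add: extend_def induced_def)
qed

lemma group_Aut: "group (Aut \<Gamma>)"
proof -
  interpret B: group "BijGroup (verts \<Gamma>)" by (rule group_BijGroup)
  have sub: "automorphisms \<Gamma> \<subseteq> Bij (verts \<Gamma>)" by (auto simp: automorphisms_def)
  have mult: "f \<otimes>\<^bsub>BijGroup (verts \<Gamma>)\<^esub> g = compose (verts \<Gamma>) f g"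
    if "f \<in> automorphisms \<Gamma>" "g \<in> automorphisms \<Gamma>" for f g
    using that sub by (auto simp: BijGroup_def)
  have closed: "compose (verts \<Gamma>) f g \<in> automorphisms \<Gamma>"
    if f: "f \<in> automorphisms \<Gamma>" and g: "g \<in> automorphisms \<Gamma>" for f g
  proof -
    have gv: "g X \<in> verts \<Gamma>" if "X \<in> verts \<Gamma>" for X using automorphism_verts[OF g that] .
    have "compose (verts \<Gamma>) f g \<in> Bij (verts \<Gamma>)" using f g sub compose_Bij by blast
    then show ?thesis using f g gv by (simp add: automorphisms_def compose_def)
  qed
  have "subgroup (automorphisms \<Gamma>) (BijGroup (verts \<Gamma>))"
  proof (rule B.subgroupI)
    show "automorphisms \<Gamma> \<subseteq> carrier (BijGroup (verts \<Gamma>))" using sub by (simp add: BijGroup_def)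
    show "automorphisms \<Gamma> \<noteq> {}"
      using induced_automorphism[OF id_in_AGammaL1 H_closed(1) one_neq_zero] by blast
    fix f assume f: "f \<in> automorphisms \<Gamma>"
    show "f \<otimes>\<^bsub>BijGroup (verts \<Gamma>)\<^esub> g \<in> automorphisms \<Gamma>" if "g \<in> automorphisms \<Gamma>" for g
      using mult closed f that by simp
    have fB: "f \<in> Bij (verts \<Gamma>)" using f sub by blast
    let ?g = "\<lambda>x\<in>verts \<Gamma>. inv_into (verts \<Gamma>) f x"
    have img: "f ` verts \<Gamma> = verts \<Gamma>" using fB by (simp add: Bij_def bij_betw_def)
    have g: "inv_into (verts \<Gamma>) f X \<in> verts \<Gamma>" "f (inv_into (verts \<Gamma>) f X) = X" if "X \<in> verts \<Gamma>" for X
      using that img inv_into_into[of X f "verts \<Gamma>"] f_inv_into_f[of X f "verts \<Gamma>"] by simp_all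
    have "{inv_into (verts \<Gamma>) f X, inv_into (verts \<Gamma>) f Y} \<in> edges \<Gamma> \<longleftrightarrow> {X, Y} \<in> edges \<Gamma>"
      if "X \<in> verts \<Gamma>" "Y \<in> verts \<Gamma>" for X Y
    proof -
      have "{f (inv_into (verts \<Gamma>) f X), f (inv_into (verts \<Gamma>) f Y)} \<in> edges \<Gamma>
          \<longleftrightarrow> {inv_into (verts \<Gamma>) f X, inv_into (verts \<Gamma>) f Y} \<in> edges \<Gamma>"
        using f g(1)[OF that(1)] g(1)[OF that(2)] unfolding automorphisms_def by blast
      then show ?thesis using g(2)[OF that(1)] g(2)[OF that(2)] by simp
    qed
    then have "?g \<in> automorphisms \<Gamma>"
      using restrict_inv_into_Bij[OF fB] by (simp add: automorphisms_def)
    then show "inv\<^bsub>BijGroup (verts \<Gamma>)\<^esub> f \<in> automorphisms \<Gamma>"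
      using inv_BijGroup[OF fB] by simp
  qed
  then show ?thesis unfolding Aut_def by (rule B.subgroup_imp_group)
qed

lemma mult_Aut:
  assumes "\<gamma> \<in> carrier AGammaL1" "w \<in> H" "\<mu> \<noteq> 0" "\<delta> \<in> carrier AGammaL1" "w' \<in> H" "\<mu>' \<noteq> 0"
  shows "induced (collin w \<mu> \<gamma>) \<otimes>\<^bsub>Aut \<Gamma>\<^esub> induced (collin w' \<mu>' \<delta>)
    = induced (collin (w + \<mu> *s lift \<gamma> w') (\<mu> * companion \<gamma> \<mu>') (\<lambda>x. \<gamma> (\<delta> x)))"
proof -
  note aut = induced_automorphism[OF assms(1-3)] induced_automorphism[OF assms(4-6)]
  have "induced (collin w \<mu> \<gamma>) \<otimes>\<^bsub>Aut \<Gamma>\<^esub> induced (collin w' \<mu>' \<delta>)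
      = compose (verts \<Gamma>) (induced (collin w \<mu> \<gamma>)) (induced (collin w' \<mu>' \<delta>))"
    using aut by (auto simp: Aut_def BijGroup_def automorphisms_def)
  also have "\<dots> = induced (\<lambda>x. collin w \<mu> \<gamma> (collin w' \<mu>' \<delta> x))"
  proof
    fix X show "compose (verts \<Gamma>) (induced (collin w \<mu> \<gamma>)) (induced (collin w' \<mu>' \<delta>)) X
        = induced (\<lambda>x. collin w \<mu> \<gamma> (collin w' \<mu>' \<delta> x)) X"
    proof (cases "X \<in> verts \<Gamma>")
      case True
      then have "induced (collin w' \<mu>' \<delta>) X \<in> verts \<Gamma>" using automorphism_verts[OF aut(2)] by blast
      then show ?thesis using True by (auto simp: compose_def induced_def image_image)
    qed (simp add: compose_def induced_def)
  qed
  finally show ?thesis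
    using collin_comp[OF assms(1,4,2,5)] by simp
qed

lemma carrier_Aut: "carrier (Aut \<Gamma>) = automorphisms \<Gamma>"
  by (simp add: Aut_def)

lemma companion_nonzero: "\<gamma> \<in> carrier AGammaL1 \<Longrightarrow> \<mu> \<noteq> 0 \<Longrightarrow> companion \<gamma> \<mu> \<noteq> (0 :: 'a)"
  using field_automorphism_eq_0_iff[OF field_automorphism_companion, of \<gamma> \<mu>] by simp

lemma inj_on_Persp: "inj_on extend (carrier (Persp H))"
proof (rule inj_onI)
  fix g g' assume "g \<in> carrier (Persp H)" "g' \<in> carrier (Persp H)" and eq: "extend g = extend g'"
  then obtain w \<mu> w' \<mu>' where g: "w \<in> H" "\<mu> \<noteq> 0" "g = on_points (persp w \<mu>)"
    and g': "w' \<in> H" "\<mu>' \<noteq> 0" "g' = on_points (persp w' \<mu>')"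
    unfolding carrier_Persp by auto
  have "induced (persp w \<mu>) = induced (persp w' \<mu>')"
    using eq by (simp add: g(3) g'(3) extend_on_points)
  from induced_collin_inj(1,2)[OF id_in_AGammaL1 g(1,2) id_in_AGammaL1 g'(1,2) this]
  show "g = g'" by (simp add: g(3) g'(3))
qed

lemma extend_mult:
  assumes "g \<in> carrier (Persp H)" "g' \<in> carrier (Persp H)"
  shows "g \<otimes>\<^bsub>Persp H\<^esub> g' \<in> carrier (Persp H)"
    and "extend (g \<otimes>\<^bsub>Persp H\<^esub> g') = extend g \<otimes>\<^bsub>Aut \<Gamma>\<^esub> extend g'"
proof -
  obtain w \<mu> w' \<mu>' where g: "w \<in> H" "\<mu> \<noteq> 0" "g = on_points (persp w \<mu>)"
    and g': "w' \<in> H" "\<mu>' \<noteq> 0" "g' = on_points (persp w' \<mu>')"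
    using assms unfolding carrier_Persp by auto
  have w: "w + \<mu> *s w' \<in> H" "\<mu> * \<mu>' \<noteq> 0" using g g' by auto
  have eq: "g \<otimes>\<^bsub>Persp H\<^esub> g' = on_points (persp (w + \<mu> *s w') (\<mu> * \<mu>'))"
    using mult_Persp[OF g(1,2) g'(1,2)] by (simp add: g(3) g'(3))
  show "g \<otimes>\<^bsub>Persp H\<^esub> g' \<in> carrier (Persp H)"
    unfolding eq carrier_Persp using w by (intro image_eqI[of _ _ "(w + \<mu> *s w', \<mu> * \<mu>')"]) auto
  show "extend (g \<otimes>\<^bsub>Persp H\<^esub> g') = extend g \<otimes>\<^bsub>Aut \<Gamma>\<^esub> extend g'"
    unfolding eq using mult_Aut[OF id_in_AGammaL1 g(1,2) id_in_AGammaL1 g'(1,2)] g'(1)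
    by (simp add: g(3) g'(3) extend_on_points lift_id)
qed

lemma extend_times_lift:
  assumes "w \<in> H" "\<mu> \<noteq> 0" "\<gamma> \<in> carrier AGammaL1"
  shows "extend (on_points (persp w \<mu>)) \<otimes>\<^bsub>Aut \<Gamma>\<^esub> induced (collin 0 1 \<gamma>) = induced (collin w \<mu> \<gamma>)"
  using mult_Aut[OF id_in_AGammaL1 assms(1,2,3) H_closed(1) one_neq_zero]
  by (simp add: extend_on_points lift_0[OF id_in_AGammaL1])

text \<open>Existence and uniqueness of the factorisation are those of the normal form, since
  \<open>collin w \<mu> \<gamma>\<close> splits into \<open>persp w \<mu>\<close> and
  \<open>collin 0 1 \<gamma>\<close>.\<close>

lemma Aut_decomposition:
  "bij_betw (\<lambda>(g, \<gamma>). extend g \<otimes>\<^bsub>Aut \<Gamma>\<^esub> induced (collin 0 1 \<gamma>))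
    (carrier (Persp H) \<times> carrier AGammaL1) (carrier (Aut \<Gamma>))"
proof (rule bij_betw_imageI)
  show "inj_on (\<lambda>(g, \<gamma>). extend g \<otimes>\<^bsub>Aut \<Gamma>\<^esub> induced (collin 0 1 \<gamma>))
      (carrier (Persp H) \<times> carrier AGammaL1)"
  proof (rule inj_onI, clarify)
    fix g \<gamma> g' \<gamma>'
    assume "g \<in> carrier (Persp H)" "g' \<in> carrier (Persp H)"
      and \<gamma>: "\<gamma> \<in> carrier AGammaL1" "\<gamma>' \<in> carrier AGammaL1"
      and eq: "extend g \<otimes>\<^bsub>Aut \<Gamma>\<^esub> induced (collin 0 1 \<gamma>) = extend g' \<otimes>\<^bsub>Aut \<Gamma>\<^esub> induced (collin 0 1 \<gamma>')"
    then obtain w \<mu> w' \<mu>' where g: "w \<in> H" "\<mu> \<noteq> 0" "g = on_points (persp w \<mu>)"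
      and g': "w' \<in> H" "\<mu>' \<noteq> 0" "g' = on_points (persp w' \<mu>')"
      unfolding carrier_Persp by auto
    have "induced (collin w \<mu> \<gamma>) = induced (collin w' \<mu>' \<gamma>')"
      using eq extend_times_lift[OF g(1,2) \<gamma>(1)] extend_times_lift[OF g'(1,2) \<gamma>(2)] by (simp add: g(3) g'(3))
    from induced_collin_inj[OF \<gamma>(1) g(1,2) \<gamma>(2) g'(1,2) this]
    show "g = g' \<and> \<gamma> = \<gamma>'" by (simp add: g(3) g'(3))
  qed
  show "(\<lambda>(g, \<gamma>). extend g \<otimes>\<^bsub>Aut \<Gamma>\<^esub> induced (collin 0 1 \<gamma>))
      ` (carrier (Persp H) \<times> carrier AGammaL1) = carrier (Aut \<Gamma>)"
    unfolding carrier_Aut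
  proof (intro equalityI subsetI)
    fix f assume "f \<in> (\<lambda>(g, \<gamma>). extend g \<otimes>\<^bsub>Aut \<Gamma>\<^esub> induced (collin 0 1 \<gamma>))
      ` (carrier (Persp H) \<times> carrier AGammaL1)"
    then obtain w \<mu> \<gamma> where f: "w \<in> H" "\<mu> \<noteq> 0" "\<gamma> \<in> carrier AGammaL1"
      "f = extend (on_points (persp w \<mu>)) \<otimes>\<^bsub>Aut \<Gamma>\<^esub> induced (collin 0 1 \<gamma>)"
      unfolding carrier_Persp by auto
    show "f \<in> automorphisms \<Gamma>"
      unfolding f(4) extend_times_lift[OF f(1-3)] by (rule induced_automorphism[OF f(3,1,2)])
  next
    fix f assume "f \<in> automorphisms \<Gamma>"
    then obtain w \<mu> \<gamma> where f: "w \<in> H" "\<mu> \<noteq> 0" "\<gamma> \<in> carrier AGammaL1" "f = induced (collin w \<mu> \<gamma>)"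
      by (rule automorphism_induced)
    then have "on_points (persp w \<mu>) \<in> carrier (Persp H)" unfolding carrier_Persp by auto
    then show "f \<in> (\<lambda>(g, \<gamma>). extend g \<otimes>\<^bsub>Aut \<Gamma>\<^esub> induced (collin 0 1 \<gamma>))
      ` (carrier (Persp H) \<times> carrier AGammaL1)"
      using extend_times_lift[OF f(1-3)] f(3,4)
      by (intro image_eqI[of _ _ "(on_points (persp w \<mu>), \<gamma>)"]) auto
  qed
qed

text \<open>The complement consists of the maps \<open>collin 0 1 \<gamma>\<close>, which fix
  \<open>apoint 0\<close>. Conjugation by such a map replaces the data \<open>(w, \<mu>)\<close> of
  a perspectivity by \<open>(lift \<gamma> w, companion \<gamma> \<mu>)\<close>.\<close>

lemma Aut_iso:
  "\<exists>\<phi>\<in>hom (AGammaL1 :: ('a \<Rightarrow> 'a) monoid) (AutoGroup (Persp H)).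
    Aut \<Gamma> \<cong> semidirect_product (Persp H) \<phi> (AGammaL1 :: ('a \<Rightarrow> 'a) monoid)"
proof (rule semidirect_product_iso[where i = extend and j = "\<lambda>\<gamma>. induced (collin 0 1 \<gamma>)"])
  show "group (Aut \<Gamma>)" by (rule group_Aut)
  show "finite (carrier (Persp H))" by (simp add: carrier_Persp)
  show "g \<otimes>\<^bsub>Persp H\<^esub> g' \<in> carrier (Persp H)"
    if "g \<in> carrier (Persp H)" "g' \<in> carrier (Persp H)" for g g'
    using extend_mult(1)[OF that] .
  show "\<gamma> \<otimes>\<^bsub>AGammaL1\<^esub> \<delta> \<in> carrier AGammaL1"
    if "\<gamma> \<in> carrier AGammaL1" "\<delta> \<in> carrier AGammaL1" for \<gamma> \<delta> :: "'a \<Rightarrow> 'a"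
    using that by (simp add: mult_AGammaL1 comp_in_AGammaL1)
  have "extend g \<in> automorphisms \<Gamma>" if "g \<in> carrier (Persp H)" for g
  proof -
    obtain w \<mu> where "w \<in> H" "\<mu> \<noteq> 0" "g = on_points (persp w \<mu>)"
      using \<open>g \<in> carrier (Persp H)\<close> unfolding carrier_Persp by auto
    then show ?thesis
      using induced_automorphism[OF id_in_AGammaL1] by (simp add: extend_on_points)
  qed
  then show "extend \<in> hom (Persp H) (Aut \<Gamma>)"
    using extend_mult(2) by (auto simp: hom_def carrier_Aut)
  show "inj_on extend (carrier (Persp H))" by (rule inj_on_Persp)
  show "(\<lambda>\<gamma>. induced (collin 0 1 \<gamma>)) \<in> hom AGammaL1 (Aut \<Gamma>)"
  proof (intro homI)
    fix \<gamma> :: "'a \<Rightarrow> 'a" assume \<gamma>: "\<gamma> \<in> carrier AGammaL1"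
    show "induced (collin 0 1 \<gamma>) \<in> carrier (Aut \<Gamma>)"
      unfolding carrier_Aut by (rule induced_automorphism[OF \<gamma> H_closed(1) one_neq_zero])
    fix \<delta> :: "'a \<Rightarrow> 'a" assume \<delta>: "\<delta> \<in> carrier AGammaL1"
    show "induced (collin 0 1 (\<gamma> \<otimes>\<^bsub>AGammaL1\<^esub> \<delta>))
        = induced (collin 0 1 \<gamma>) \<otimes>\<^bsub>Aut \<Gamma>\<^esub> induced (collin 0 1 \<delta>)"
      using mult_Aut[OF \<gamma> H_closed(1) one_neq_zero \<delta> H_closed(1) one_neq_zero]
        field_automorphism_1[OF field_automorphism_companion[OF \<gamma>]]
      by (simp add: mult_AGammaL1[OF \<gamma> \<delta>] lift_0[OF \<gamma>])
  qed
  show "bij_betw (\<lambda>(g, \<gamma>). extend g \<otimes>\<^bsub>Aut \<Gamma>\<^esub> induced (collin 0 1 \<gamma>))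
    (carrier (Persp H) \<times> carrier AGammaL1) (carrier (Aut \<Gamma>))" by (rule Aut_decomposition)
  fix g and \<gamma> :: "'a \<Rightarrow> 'a"
  assume "g \<in> carrier (Persp H)" and \<gamma>: "\<gamma> \<in> carrier AGammaL1"
  then obtain w \<mu> where g: "w \<in> H" "\<mu> \<noteq> 0" "g = on_points (persp w \<mu>)"
    unfolding carrier_Persp by auto
  note ne = companion_nonzero[OF \<gamma> g(2)]
  have "induced (collin 0 1 \<gamma>) \<otimes>\<^bsub>Aut \<Gamma>\<^esub> extend g = induced (collin (lift \<gamma> w) (companion \<gamma> \<mu>) \<gamma>)"
    using mult_Aut[OF \<gamma> H_closed(1) one_neq_zero id_in_AGammaL1 g(1,2)]
    by (simp add: g(3) extend_on_points)
  also have "\<dots> = extend (on_points (persp (lift \<gamma> w) (companion \<gamma> \<mu>))) \<otimes>\<^bsub>Aut \<Gamma>\<^esub> induced (collin 0 1 \<gamma>)"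
    using extend_times_lift[OF lift_H ne \<gamma>] by simp
  finally have "induced (collin 0 1 \<gamma>) \<otimes>\<^bsub>Aut \<Gamma>\<^esub> extend g
      = extend (on_points (persp (lift \<gamma> w) (companion \<gamma> \<mu>))) \<otimes>\<^bsub>Aut \<Gamma>\<^esub> induced (collin 0 1 \<gamma>)" .
  moreover have "on_points (persp (lift \<gamma> w) (companion \<gamma> \<mu>)) \<in> carrier (Persp H)"
    unfolding carrier_Persp using lift_H[of \<gamma> w] ne
    by (intro image_eqI[of _ _ "(lift \<gamma> w, companion \<gamma> \<mu>)"]) auto
  ultimately show "\<exists>g'\<in>carrier (Persp H). induced (collin 0 1 \<gamma>) \<otimes>\<^bsub>Aut \<Gamma>\<^esub> extend g
      = extend g' \<otimes>\<^bsub>Aut \<Gamma>\<^esub> induced (collin 0 1 \<gamma>)"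
    by (rule bexI)
qed

section \<open>Orders of the groups\<close>

lemma card_H: "card H * CARD('a) = CARD('a) ^ CARD('d)"
proof -
  have "bij_betw (\<lambda>(v, c). v + c *s e) (H \<times> UNIV) UNIV"
  proof (rule bij_betwI[where g = "\<lambda>x. (x - ht x *s e, ht x)"])
    fix u assume "u \<in> H \<times> (UNIV :: 'a set)"
    then show "(\<lambda>x. (x - ht x *s e, ht x)) ((\<lambda>(v, c). v + c *s e) u) = u" by auto
  qed auto
  then have "card (H \<times> (UNIV :: 'a set)) = CARD('a ^ 'd)"
    by (rule bij_betw_same_card)
  then show ?thesis by (simp add: card_cartesian_product)
qed

lemma card_Persp: "card (carrier (Persp H)) = card H * (CARD('a) - 1)"
proof -
  have "inj_on (\<lambda>(w, \<mu>). on_points (persp w \<mu>)) (H \<times> (UNIV - {0}))"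
  proof (rule inj_onI)
    fix u u' assume u: "u \<in> H \<times> (UNIV - {0})" "u' \<in> H \<times> (UNIV - {0})"
      and eq: "(\<lambda>(w, \<mu>). on_points (persp w \<mu>)) u = (\<lambda>(w, \<mu>). on_points (persp w \<mu>)) u'"
    obtain w \<mu> w' \<mu>' where uu: "u = (w, \<mu>)" "u' = (w', \<mu>')" by (cases u, cases u') auto
    have g: "w \<in> H" "\<mu> \<noteq> 0" and g': "w' \<in> H" "\<mu>' \<noteq> 0" using u uu by auto
    have "on_points (persp w \<mu>) = on_points (persp w' \<mu>')" using eq uu by simp
    then have "induced (persp w \<mu>) = induced (persp w' \<mu>')"
      unfolding extend_on_points[symmetric] by simp
    from induced_collin_inj(1,2)[OF id_in_AGammaL1 g id_in_AGammaL1 g' this]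
    show "u = u'" by (simp add: uu)
  qed
  then show ?thesis
    by (simp add: carrier_Persp card_image card_cartesian_product card_Diff_subset)
qed

lemma order_Aut:
  assumes "prime p" "CARD('a) = p ^ h" "CARD('d) = n + 2"
  shows "order (Aut \<Gamma>) = h * CARD('a) ^ (n + 2) * (CARD('a) - 1)\<^sup>2"
proof -
  have "order (Aut \<Gamma>) = card (carrier (Persp H)) * card (carrier (AGammaL1 :: ('a \<Rightarrow> 'a) monoid))"
    unfolding Coset.order_def using bij_betw_same_card[OF Aut_decomposition]
    by (simp add: card_cartesian_product)
  \<comment> \<open>One factor \<open>q\<close> of the affine semilinear group is moved over to
    \<open>card H\<close>, so that the product counts all vectors of the space.\<close>
  also have "\<dots> = (card H * CARD('a)) * (h * (CARD('a) - 1)\<^sup>2)"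
    unfolding card_Persp card_AGammaL1[OF assms(1,2)] by (simp add: power2_eq_square mult_ac)
  also have "\<dots> = h * CARD('a) ^ (n + 2) * (CARD('a) - 1)\<^sup>2"
    unfolding card_H assms(3) by (simp add: mult_ac)
  finally show ?thesis .
qed

end

section \<open>Choosing coordinates\<close>

text \<open>Any vector outside \<open>H\<^sub>0\<close> completes the basis, and \<open>crd\<close>
  is the representation with respect to the completed basis.\<close>

lemma ordered_basis_nrc:
  fixes b :: "nat \<Rightarrow> 'a::{field,finite} ^ 'd::finite"
  assumes b: "ordered_basis n H\<^sub>0 b" and H: "hyperplane H\<^sub>0" and d: "CARD('d) = n + 2"
    and n: "n \<ge> 2" "CARD('a) \<ge> n + 3" "n \<ge> 3 \<or> odd CARD('a)"
  obtains B crd where "curve_coordinates B crd n" "\<And>i. i \<le> n \<Longrightarrow> B i = b i" "curve_coordinates.H crd n = H\<^sub>0"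
    "curve_coordinates.K B n = range (\<lambda>t. vec.span {\<Sum>i\<le>n. t ^ i *s b i})"
proof -
  have b': "inj_on b {..n}" "vec.independent (b ` {..n})" "vec.span (b ` {..n}) = H\<^sub>0"
    using b by (auto simp: ordered_basis_def)
  have "vec.dim H\<^sub>0 = n + 1" using H d by (simp add: hyperplane_def)
  then have "H\<^sub>0 \<noteq> UNIV" using vec_dim_card[where 'a = 'a and 'n = 'd] d by auto
  then obtain e where e: "e \<notin> H\<^sub>0" by blast
  define B where "B i = (if i \<le> n then b i else e)" for i
  define S where "S = B ` {..Suc n}"
  have S: "S = insert e (b ` {..n})"
  proof -
    have "B ` {..n} = b ` {..n}" by (intro image_cong) (auto simp: B_def)
    moreover have "B (Suc n) = e" by (simp add: B_def)
    ultimately show ?thesis unfolding S_def atMost_Suc image_insert by simp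
  qed
  have ind: "vec.independent S"
    unfolding S using e b' by (intro vec.independent_insertI) auto
  have e_b: "e \<notin> b ` {..n}" using e vec.span_superset[of "b ` {..n}"] unfolding b'(3) by blast
  have inj: "inj_on B {..Suc n}"
  proof (rule eq_card_imp_inj_on)
    show "card (B ` {..Suc n}) = card {..Suc n}"
      using e_b b'(1) unfolding S_def[symmetric] S by (simp add: card_image)
  qed simp
  have span: "vec.span S = UNIV"
  proof -
    have "UNIV \<subseteq> vec.span S"
    proof (rule vec.card_ge_dim_independent)
      have "card S = n + 2" unfolding S using e_b b'(1) by (simp add: card_image)
      then show "vec.dim (UNIV :: ('a ^ 'd) set) \<le> card S"
        unfolding vec_dim_card using d by simp
    qed (use ind in auto)
    then show ?thesis by blast
  qed
  define crd where "crd i x = vec.representation S x (B i)" for i x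
  have curve_coordinates: "curve_coordinates B crd n"
  proof
    show "crd i (x + y) = crd i x + crd i y" for i x y
      using vec.representation_add[OF ind, of y x] span by (simp add: crd_def)
    show "crd i (c *s x) = c * crd i x" for i c x
      using vec.representation_scale[OF ind, of x c] span by (simp add: crd_def)
    show "crd i (B j) = (if i = j then 1 else 0)" if "i \<le> Suc n" "j \<le> Suc n" for i j
    proof -
      have "B j \<in> S" using that by (auto simp: S_def)
      then show ?thesis
        using vec.representation_basis[OF ind, of "B j"] inj_on_eq_iff[OF inj, of i j] that
        by (auto simp: crd_def)
    qed
    show "(\<Sum>i\<le>Suc n. crd i x *s B i) = x" for x
    proof -
      have "(\<Sum>s\<in>S. vec.representation S x s *s s) = x"
        using vec.sum_representation_eq[OF ind, of x S] span by simp
      moreover have "(\<Sum>s\<in>S. vec.representation S x s *s s) = (\<Sum>i\<le>Suc n. crd i x *s B i)"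
        unfolding S_def crd_def by (subst sum.reindex[OF inj]) simp
      ultimately show ?thesis by simp
    qed
  qed (use n in auto)
  interpret N: curve_coordinates B crd n by (rule curve_coordinates)
  have "N.H = H\<^sub>0"
  proof (rule equalityI)
    have "b i \<in> N.H" if "i \<le> n" for i
      using N.ht_B[OF that] that by (simp add: N.H_def B_def del: N.ht_H N.ht_B)
    then show "H\<^sub>0 \<subseteq> N.H"
      unfolding b'(3)[symmetric] by (intro vec.span_minimal N.subspace_H) auto
    show "N.H \<subseteq> H\<^sub>0"
    proof
      fix x assume "x \<in> N.H"
      then have "crd (Suc n) x = 0" unfolding N.H_def N.ht_def by simp
      then have "x = (\<Sum>i\<le>n. crd i x *s B i)" using N.expand[of x] by simp
      also have "\<dots> \<in> H\<^sub>0"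
        unfolding b'(3)[symmetric] by (intro vec.span_sum vec.span_scale vec.span_base) (auto simp: B_def)
      finally show "x \<in> H\<^sub>0" .
    qed
  qed
  moreover have "N.kap t = (\<Sum>i\<le>n. t ^ i *s b i)" for t
    unfolding N.kap_def by (intro sum.cong) (auto simp: B_def)
  ultimately show ?thesis
    using that[of B crd] curve_coordinates by (simp add: N.K_def B_def)
qed

section \<open>Moving a point of the curve to infinity\<close>

context curve_coordinates
begin

lemma inj_span_kap: "inj (\<lambda>t. vec.span {kap t})"
proof (rule injI)
  fix s t assume "vec.span {kap s} = vec.span {kap t}"
  then have "kap s \<in> vec.span {kap t}" using vec.span_base[of "kap s" "{kap s}"] by simp
  then obtain c where "1 *s kap s = c *s kap t" by (auto simp: in_span_singleton_iff)
  then show "s = t" using kap_independent2[of s t 1 c] by auto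
qed

text \<open>The functional \<open>crd 0\<close> is \<open>1\<close> on every \<open>kap t\<close>
  but vanishes on \<open>B n\<close>.\<close>

lemma last_not_on_curve: "vec.span {B n} \<noteq> vec.span {kap t}"
proof
  assume "vec.span {B n} = vec.span {kap t}"
  then have "B n \<in> vec.span {kap t}" using vec.span_base[of "B n" "{B n}"] by simp
  then obtain c where c: "B n = c *s kap t" by (auto simp: in_span_singleton_iff)
  have "c = 0" using arg_cong[OF c, of "crd 0"] n_ge_2 by (simp add: crd_scale crd_kap crd_B)
  then have "crd n (B n) = 0" using c by simp
  then show False by (simp add: crd_B)
qed

text \<open>
  The coordinate change \<open>t = t\<^sub>0 + 1 / u\<close>, under which \<open>u ^ n *s kap t\<close> is again a curve in
  monomial form, with the point at \<open>t\<^sub>0\<close> now at infinity and the old point at infinity at \<open>u = 0\<close>.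
\<close>

definition shifted :: "'a \<Rightarrow> nat \<Rightarrow> 'a ^ 'd" where
  "shifted t\<^sub>0 m = (\<Sum>i\<le>n. (of_nat (i choose (n - m)) * t\<^sub>0 ^ (i - (n - m))) *s B i)"

text \<open>Expanding \<open>u ^ n * (t\<^sub>0 + 1 / u) ^ i\<close> binomially produces the powers
  \<open>u ^ (n - j)\<close>; the reversal \<open>m = n - j\<close> accounts for every
  \<open>n - m\<close> in \<open>shifted\<close>.\<close>

lemma shifted_curve:
  "u \<noteq> 0 \<Longrightarrow> (\<Sum>m\<le>n. u ^ m *s shifted t\<^sub>0 m) = u ^ n *s kap (t\<^sub>0 + 1 / u)"
proof -
  assume u: "u \<noteq> 0"
  have coef: "(\<Sum>j\<le>n. u ^ (n - j) * (of_nat (i choose j) * t\<^sub>0 ^ (i - j))) = u ^ n * (t\<^sub>0 + 1 / u) ^ i"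
    if i: "i \<le> n" for i
  proof -
    have "(\<Sum>j\<le>n. u ^ (n - j) * (of_nat (i choose j) * t\<^sub>0 ^ (i - j)))
        = (\<Sum>j\<le>i. u ^ (n - j) * (of_nat (i choose j) * t\<^sub>0 ^ (i - j)))"
      using i by (intro sum.mono_neutral_right) (auto simp: binomial_eq_0)
    also have "\<dots> = (\<Sum>j\<le>i. u ^ n * (of_nat (i choose j) * (1 / u) ^ j * t\<^sub>0 ^ (i - j)))"
    proof (rule sum.cong[OF refl])
      fix j assume "j \<in> {..i}"
      then have "u ^ (n - j) = u ^ n * (1 / u) ^ j"
        using i u by (simp add: power_diff power_one_over)
      then show "u ^ (n - j) * (of_nat (i choose j) * t\<^sub>0 ^ (i - j))
          = u ^ n * (of_nat (i choose j) * (1 / u) ^ j * t\<^sub>0 ^ (i - j))"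
        by (simp only: mult_ac)
    qed
    also have "\<dots> = u ^ n * (1 / u + t\<^sub>0) ^ i"
      unfolding binomial_ring[of "1 / u" t\<^sub>0 i] sum_distrib_left ..
    finally show ?thesis by (simp only: add.commute)
  qed
  have "(\<Sum>m\<le>n. u ^ m *s shifted t\<^sub>0 m) = (\<Sum>j\<le>n. u ^ (n - j) *s shifted t\<^sub>0 (n - j))"
    by (rule sum.reindex_bij_witness[of _ "\<lambda>j. n - j" "\<lambda>j. n - j"]) auto
  also have "\<dots> = (\<Sum>j\<le>n. \<Sum>i\<le>n. (u ^ (n - j) * (of_nat (i choose j) * t\<^sub>0 ^ (i - j))) *s B i)"
    unfolding shifted_def vec.scale_sum_right by (intro sum.cong) auto
  also have "\<dots> = (\<Sum>i\<le>n. \<Sum>j\<le>n. (u ^ (n - j) * (of_nat (i choose j) * t\<^sub>0 ^ (i - j))) *s B i)"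
    by (rule sum.swap)
  also have "\<dots> = (\<Sum>i\<le>n. (u ^ n * (t\<^sub>0 + 1 / u) ^ i) *s B i)"
    unfolding vec.scale_sum_left[symmetric] using coef by (intro sum.cong) auto
  also have "\<dots> = u ^ n *s kap (t\<^sub>0 + 1 / u)"
    by (simp add: kap_def vec.scale_sum_right)
  finally show ?thesis .
qed

lemma shifted_0: "shifted t\<^sub>0 0 = B n"
proof -
  have "shifted t\<^sub>0 0 = (\<Sum>i\<le>n. if i = n then B n else 0)"
    unfolding shifted_def by (intro sum.cong) (auto simp: binomial_eq_0)
  then show ?thesis by simp
qed

lemma kap_in_span_shifted:
  assumes "t \<noteq> t\<^sub>0"
  obtains u where "u \<noteq> 0" "(\<Sum>m\<le>n. u ^ m *s shifted t\<^sub>0 m) = u ^ n *s kap t"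
proof
  show "1 / (t - t\<^sub>0) \<noteq> 0" using assms by simp
  from shifted_curve[OF this, of t\<^sub>0]
  show "(\<Sum>m\<le>n. (1 / (t - t\<^sub>0)) ^ m *s shifted t\<^sub>0 m) = (1 / (t - t\<^sub>0)) ^ n *s kap t" by simp
qed

text \<open>Spanning suffices, by dimension. It is checked on \<open>n + 1\<close> curve vectors
  with parameters different from \<open>t\<^sub>0\<close>, each of which is a multiple of a vector
  on the new curve.\<close>

lemma shifted_ordered_basis:
  assumes dim: "vec.dim H = Suc n"
  shows "ordered_basis n H (shifted t\<^sub>0)"
proof -
  let ?S = "shifted t\<^sub>0 ` {..n}"
  have sub: "?S \<subseteq> H"
    by (auto simp: shifted_def H_def ht_sum simp del: ht_H)
  have kap: "kap t \<in> vec.span ?S" if t: "t \<noteq> t\<^sub>0" for t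
  proof -
    obtain u where u: "u \<noteq> 0" "(\<Sum>m\<le>n. u ^ m *s shifted t\<^sub>0 m) = u ^ n *s kap t"
      using kap_in_span_shifted[OF t] by blast
    have "u ^ n *s kap t \<in> vec.span ?S"
      unfolding u(2)[symmetric] by (intro vec.span_sum vec.span_scale vec.span_base) auto
    then have "(1 / u ^ n) *s (u ^ n *s kap t) \<in> vec.span ?S" by (rule vec.span_scale)
    then show ?thesis using u(1) by simp
  qed
  have H_sub: "H \<subseteq> vec.span ?S"
  proof
    fix x assume x: "x \<in> H"
    obtain T where T: "T \<inter> {t\<^sub>0} = {}" "card T = Suc n" using extend_nodes[of "{}" "{t\<^sub>0}"] by auto
    have "(\<Sum>t\<in>T. lc T t x *s kap t) \<in> vec.span ?S"
      using T(1) by (intro vec.span_sum vec.span_scale kap) auto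
    then show "x \<in> vec.span ?S" unfolding lc_expand[OF T(2) x] .
  qed
  have card: "card ?S \<le> Suc n" using card_image_le[of "{..n}" "shifted t\<^sub>0"] by simp
  have ind: "vec.independent ?S"
    using sub H_sub card dim by (intro vec.card_le_dim_spanning[of ?S H]) auto
  have span: "vec.span ?S = H"
    using sub H_sub subspace_H by (intro equalityI vec.span_minimal)
  have "card ?S = Suc n"
    using dim vec.dim_eq_card_independent[OF ind] vec.dim_span[of ?S] span by simp
  then have "inj_on (shifted t\<^sub>0) {..n}" by (intro eq_card_imp_inj_on) simp_all
  then show ?thesis using ind span by (simp add: ordered_basis_def)
qed

end

lemma curve_without_point:
  fixes H\<^sub>0 :: "('a::{field,finite} ^ 'd::finite) set"
  assumes H: "hyperplane H\<^sub>0" and C: "normal_rational_curve n H\<^sub>0 C" and d: "CARD('d) = n + 2"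
    and n: "n \<ge> 2" "CARD('a) \<ge> n + 3" "n \<ge> 3 \<or> odd CARD('a)"
    and K: "K \<subseteq> C" "card K = CARD('a)"
  obtains b where "ordered_basis n H\<^sub>0 b" "K = range (\<lambda>t. vec.span {\<Sum>i\<le>n. t ^ i *s b i})"
proof -
  obtain b where b: "ordered_basis n H\<^sub>0 b"
    "C = (\<lambda>x. vec.span {\<Sum>i\<le>n. x i *s b i}) ` standard_curve n"
    using C by (auto simp: normal_rational_curve_def)
  obtain B crd where curve_coordinates: "curve_coordinates B crd n" and Bb: "\<And>i. i \<le> n \<Longrightarrow> B i = b i" and HH: "curve_coordinates.H crd n = H\<^sub>0"
    using ordered_basis_nrc[OF b(1) H d n] by blast
  interpret N: curve_coordinates B crd n by (rule curve_coordinates)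
  have kap: "N.kap t = (\<Sum>i\<le>n. t ^ i *s b i)" for t
    unfolding N.kap_def by (intro sum.cong) (auto simp: Bb)
  have "(\<Sum>i\<le>n. (if i = n then 1 else 0) *s b i) = B n"
  proof -
    have "(\<Sum>i\<le>n. (if i = n then 1 else 0) *s b i) = (\<Sum>i\<le>n. if i = n then b n else 0)"
      by (intro sum.cong) auto
    then show ?thesis by (simp add: Bb)
  qed
  then have C_eq: "C = insert (vec.span {B n}) (range (\<lambda>t. vec.span {N.kap t}))"
    unfolding b(2) standard_curve_def kap by (auto simp: image_Un image_image setcompr_eq_image)
  \<comment> \<open>\<open>K\<close> has \<open>q\<close> elements and a range over the field has at
    most \<open>q\<close>, so inclusion already gives equality.\<close>
  have eqI: "K = range R" if "K \<subseteq> range R" for R :: "'a \<Rightarrow> ('a ^ 'd) set"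
    using that K(2) card_image_le[of UNIV R] by (intro card_seteq) auto
  show ?thesis
  proof (cases "vec.span {B n} \<in> K")
    case False
    then have "K \<subseteq> range (\<lambda>t. vec.span {N.kap t})" using K(1) C_eq by blast
    from eqI[OF this] show ?thesis using that[OF b(1)] by (simp add: kap)
  next
    case True
    \<comment> \<open>The whole curve has \<open>q + 1\<close> points, so \<open>K\<close> omits
      one; as it contains the point at infinity, the omitted point has a finite parameter.\<close>
    have "card (range (\<lambda>t. vec.span {N.kap t})) = CARD('a)"
      using N.inj_span_kap by (simp add: card_image)
    moreover have "vec.span {B n} \<notin> range (\<lambda>t. vec.span {N.kap t})"
      using N.last_not_on_curve by blast
    ultimately have "card C = Suc CARD('a)" by (simp add: C_eq)
    then have "\<not> C \<subseteq> K" using K by (metis Suc_n_not_n subset_antisym)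
    then obtain t\<^sub>0 where t0: "vec.span {N.kap t\<^sub>0} \<notin> K" using True C_eq by blast
    define R where "R u = vec.span {\<Sum>m\<le>n. u ^ m *s N.shifted t\<^sub>0 m}" for u
    have "K \<subseteq> range R"
    proof
      fix P assume P: "P \<in> K"
      then consider "P = vec.span {B n}" | t where "P = vec.span {N.kap t}" using K(1) C_eq by blast
      then show "P \<in> range R"
      proof cases
        case 1
        \<comment> \<open>The former point at infinity is the value \<open>u = 0\<close>: only the
          term with \<open>0 ^ 0 = 1\<close> survives.\<close>
        have "(\<Sum>m\<le>n. 0 ^ m *s N.shifted t\<^sub>0 m) = (\<Sum>m\<le>n. if m = 0 then N.shifted t\<^sub>0 0 else 0)"
          by (intro sum.cong) (auto simp: power_0_left)
        then have "R 0 = P" using 1 by (simp add: R_def N.shifted_0)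
        then show ?thesis by blast
      next
        case (2 t)
        then have "t \<noteq> t\<^sub>0" using t0 P by auto
        then obtain u where u: "u \<noteq> 0" "(\<Sum>m\<le>n. u ^ m *s N.shifted t\<^sub>0 m) = u ^ n *s N.kap t"
          by (rule N.kap_in_span_shifted)
        have "R u = P" unfolding R_def u(2) 2 using u(1) by (intro span_singleton_scale) simp
        then show ?thesis by blast
      qed
    qed
    then have "K = range R" by (rule eqI)
    moreover have "ordered_basis n H\<^sub>0 (N.shifted t\<^sub>0)"
      using N.shifted_ordered_basis H d unfolding HH by (simp add: hyperplane_def)
    ultimately show ?thesis using that by (simp add: R_def)
  qed
qed

theorem theorem3p10:
  fixes H :: "('a::{field,finite} ^ 'd::finite) set"
    and C K :: "('a ^ 'd) set set"
    and n p h q :: nat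
  assumes "prime p" and "q = p ^ h" and "CARD('a) = q"
    and "CARD('d) = n + 2"
    and "n \<ge> 2" and "q \<ge> n + 3"
    and "n \<ge> 3 \<or> (n = 2 \<and> odd q)"
    and "hyperplane H"
    and "normal_rational_curve n H C"
    and "K \<subseteq> C" and "card K = q"
  shows "semisymmetric (Gamma H K)
    \<and> (\<exists>\<phi> \<in> hom (AGammaL1 :: ('a \<Rightarrow> 'a) monoid) (AutoGroup (Persp H)).
          Aut (Gamma H K) \<cong> semidirect_product (Persp H) \<phi> (AGammaL1 :: ('a \<Rightarrow> 'a) monoid))
    \<and> order (Aut (Gamma H K)) = h * q ^ (n + 2) * (q - 1)\<^sup>2"
proof -
  have q: "CARD('a) \<ge> n + 3" "n \<ge> 3 \<or> odd CARD('a)" "CARD('a) = p ^ h" "card K = CARD('a)"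
    using assms by auto
  obtain b where b: "ordered_basis n H b" "K = range (\<lambda>t. vec.span {\<Sum>i\<le>n. t ^ i *s b i})"
    using curve_without_point[OF assms(8,9,4,5) q(1,2) assms(10) q(4)] by blast
  obtain B crd where curve_coordinates: "curve_coordinates B crd n" and "curve_coordinates.H crd n = H"
    "curve_coordinates.K B n = range (\<lambda>t. vec.span {\<Sum>i\<le>n. t ^ i *s b i})"
    using ordered_basis_nrc[OF b(1) assms(8,4,5) q(1,2)] by blast
  then have "H = curve_coordinates.H crd n" "K = curve_coordinates.K B n" using b(2) by simp_all
  then show ?thesis
    using curve_coordinates.semisymmetric_Gamma[OF curve_coordinates] curve_coordinates.Aut_iso[OF curve_coordinates] curve_coordinates.order_Aut[OF curve_coordinates assms(1) q(3) assms(4)]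
      assms(3) by simp
qed

end
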